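(* Let $\mathfrak{H}$ be a complex Hilbert space and let $A$ and $H$ be self-adjoint operators in $\mathfrak{H}$ such that $\inf\operatorname{spec}(A)>0$ and $H$ is bounded and has a bounded inverse. Let $B:=A^{1/2}HA^{1/2}$ be the self-adjoint operator with domain $\operatorname{Dom}(B)=\{x\in\operatorname{Dom}(A^{1/2})\mid HA^{1/2}x\in\operatorname{Dom}(A^{1/2})\}$. Then the following are equivalent: (i) $\operatorname{Dom}(|B|^{1/2})=\operatorname{Dom}(A^{1/2})$; (ii) $\operatorname{Dom}(A^{1/2})\subset\operatorname{Dom}(|B|^{1/2})$; (ii$'$) $\operatorname{Dom}(|B|^{1/2})\subset\operatorname{Dom}(A^{1/2})$; (iii) $X=A^{-1/2}|B|A^{-1/2}$ is a bounded symmetric operator on $\operatorname{Dom}(X)=A^{1/2}\operatorname{Dom}(B)$; (iii$'$) $Y=A^{1/2}|B|^{-1}A^{1/2}$ is a bounded symmetric operator on $\operatorname{Dom}(Y)=\operatorname{Dom}(A^{1/2})$; (iv) $K:=A^{1/2}\operatorname{sign}(B)A^{-1/2}$ is a bounded involution on $\mathfrak{H}$; (v) $\operatorname{sign}(B)\operatorname{Dom}(A^{1/2})\subset\operatorname{Dom}(A^{1/2})$.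
   Context: The operator $B$ is self-adjoint with a bounded inverse and $\operatorname{Dom}(B)\subset\operatorname{Dom}(A^{1/2})$; the operators $|B|$, $|B|^{1/2}$, $|B|^{-1}$ and $\operatorname{sign}(B)$ are defined by the functional calculus. The operators $X$ and $Y$ are densely defined symmetric nonnegative operators on the indicated domains; "bounded" in (iii) and (iii$'$) means bounded on the indicated dense domain. The operator $K$ is considered on its natural domain $\operatorname{Dom}(K)=\{x\in\mathfrak{H}\mid\operatorname{sign}(B)A^{-1/2}x\in\operatorname{Dom}(A^{1/2})\}$; condition (iv) means that $\operatorname{Dom}(K)=\mathfrak{H}$, $K$ is bounded, and $K^2=I$. *)

theory Defs
  imports "HOL-Analysis.Analysis"
begin

text \<open>Complex Hilbert spaces. The inner product is antilinear in its first argument. Positive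
  definiteness of \<open>cinner\<close> is contained in \<open>cinner_self\<close>, because \<open>norm\<close> is a norm;
  completeness comes from \<^class>\<open>banach\<close>. The zero space is allowed.\<close>

class chilbert_space = banach +
  fixes scaleC :: "complex \<Rightarrow> 'a \<Rightarrow> 'a"  (infixr "*\<^sub>C" 75)
    and cinner :: "'a \<Rightarrow> 'a \<Rightarrow> complex"
  assumes scaleC_add_right: "c *\<^sub>C (x + y) = c *\<^sub>C x + c *\<^sub>C y"
    and scaleC_add_left: "(c + d) *\<^sub>C x = c *\<^sub>C x + d *\<^sub>C x"
    and scaleC_scaleC: "c *\<^sub>C d *\<^sub>C x = (c * d) *\<^sub>C x"
    and scaleC_one: "1 *\<^sub>C x = x"
    and scaleR_scaleC: "r *\<^sub>R x = complex_of_real r *\<^sub>C x"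
    and cinner_commute: "cinner x y = cnj (cinner y x)"
    and cinner_add_right: "cinner x (y + z) = cinner x y + cinner x z"
    and cinner_scaleC_right: "cinner x (c *\<^sub>C y) = c * cinner x y"
    and cinner_self: "cinner x x = complex_of_real ((norm x)\<^sup>2)"


text \<open>An operator in \<open>'a\<close> is a partial map \<open>T :: 'a \<rightharpoonup> 'a\<close>; its domain is \<^term>\<open>dom T\<close>, and
  \<open>S \<circ>\<^sub>m T\<close> is the product \<open>S T\<close> on its natural domain:\<close>

lemma dom_op_product: "dom (S \<circ>\<^sub>m T) = {x \<in> dom T. the (T x) \<in> dom S}"
  by (auto simp: map_comp_def dom_def split: option.splits)

definition linear_op :: "('a::chilbert_space \<rightharpoonup> 'a) \<Rightarrow> bool" where
  "linear_op T \<longleftrightarrow> T 0 = Some 0 \<and>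
     (\<forall>x\<in>dom T. \<forall>y\<in>dom T. T (x + y) = Some (the (T x) + the (T y))) \<and>
     (\<forall>c. \<forall>x\<in>dom T. T (c *\<^sub>C x) = Some (c *\<^sub>C the (T x)))"

definition densely_defined :: "('a::chilbert_space \<rightharpoonup> 'a) \<Rightarrow> bool" where
  "densely_defined T \<longleftrightarrow> closure (dom T) = UNIV"

definition bounded_op :: "('a::chilbert_space \<rightharpoonup> 'a) \<Rightarrow> bool" where
  "bounded_op T \<longleftrightarrow> (\<exists>C. \<forall>x\<in>dom T. norm (the (T x)) \<le> C * norm x)"

definition symmetric_op :: "('a::chilbert_space \<rightharpoonup> 'a) \<Rightarrow> bool" where
  "symmetric_op T \<longleftrightarrow> linear_op T \<and> densely_defined T \<and>
     (\<forall>x\<in>dom T. \<forall>y\<in>dom T. cinner (the (T x)) y = cinner x (the (T y)))"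

definition adjoint_op :: "('a::chilbert_space \<rightharpoonup> 'a) \<Rightarrow> ('a \<rightharpoonup> 'a)" where
  "adjoint_op T = (\<lambda>y. if \<exists>z. \<forall>x\<in>dom T. cinner y (the (T x)) = cinner z x
     then Some (THE z. \<forall>x\<in>dom T. cinner y (the (T x)) = cinner z x) else None)"

definition selfadjoint :: "('a::chilbert_space \<rightharpoonup> 'a) \<Rightarrow> bool" where
  "selfadjoint T \<longleftrightarrow> linear_op T \<and> densely_defined T \<and> adjoint_op T = T"

text \<open>Only meaningful if \<open>T\<close> is injective on its domain.\<close>

definition inverse_op :: "('a::chilbert_space \<rightharpoonup> 'a) \<Rightarrow> ('a \<rightharpoonup> 'a)" where
  "inverse_op T = (\<lambda>y. if y \<in> ran T then Some (THE x. T x = Some y) else None)"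

definition has_bounded_inverse :: "('a::chilbert_space \<rightharpoonup> 'a) \<Rightarrow> bool" where
  "has_bounded_inverse T \<longleftrightarrow>
     inj_on T (dom T) \<and> ran T = UNIV \<and> bounded_op (inverse_op T)"

definition spectrum :: "('a::chilbert_space \<rightharpoonup> 'a) \<Rightarrow> complex set" where
  "spectrum T = {z. \<not> has_bounded_inverse (\<lambda>x. map_option (\<lambda>y. y - z *\<^sub>C x) (T x))}"


definition orthogonal_projection :: "('a::chilbert_space \<Rightarrow> 'a) \<Rightarrow> bool" where
  "orthogonal_projection P \<longleftrightarrow> linear_op (\<lambda>x. Some (P x)) \<and> P \<circ> P = P \<and>
     (\<forall>x y. cinner (P x) y = cinner x (P y))"

text \<open>Projection-valued measures on the Borel sets of the real line, countably additive in the
  strong operator topology; \<open>E (S \<inter> T) = E S \<circ> E T\<close> is a consequence.\<close>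

definition projection_valued_measure :: "(real set \<Rightarrow> 'a::chilbert_space \<Rightarrow> 'a) \<Rightarrow> bool" where
  "projection_valued_measure E \<longleftrightarrow>
     (\<forall>S\<in>sets borel. orthogonal_projection (E S)) \<and> E UNIV = id \<and>
     (\<forall>F x. range F \<subseteq> sets borel \<longrightarrow> disjoint_family F \<longrightarrow>
        (\<lambda>n::nat. E (F n) x) sums E (\<Union>n. F n) x)"

definition scalar_measure ::
    "(real set \<Rightarrow> 'a::chilbert_space \<Rightarrow> 'a) \<Rightarrow> 'a \<Rightarrow> real measure" where
  "scalar_measure E x = measure_of UNIV (sets borel) (\<lambda>S. ennreal ((norm (E S x))\<^sup>2))"

text \<open>The operator \<open>\<integral> f dE\<close> for real Borel functions \<open>f\<close>. Its domain consists of the \<open>x\<close> with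
  \<open>\<integral> f\<^sup>2 d\<parallel>E(\<cdot>)x\<parallel>\<^sup>2 < \<infinity>\<close>. This domain is dense, so a linear operator on it is determined by its
  quadratic form \<open>\<langle>x, T x\<rangle> = \<integral> f d\<parallel>E(\<cdot>)x\<parallel>\<^sup>2\<close> (polarization).\<close>

definition spectral_integral ::
    "(real set \<Rightarrow> 'a::chilbert_space \<Rightarrow> 'a) \<Rightarrow> (real \<Rightarrow> real) \<Rightarrow> ('a \<rightharpoonup> 'a)" where
  "spectral_integral E f = (THE T. linear_op T \<and>
     dom T = {x. integrable (scalar_measure E x) (\<lambda>t. (f t)\<^sup>2)} \<and>
     (\<forall>x\<in>dom T. cinner x (the (T x)) =
        complex_of_real (integral\<^sup>L (scalar_measure E x) f)))"

text \<open>By the spectral theorem a self-adjoint \<open>T\<close> has a spectral measure, which is unique on the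
  Borel sets; the choice operator only affects its irrelevant values at other sets.\<close>

definition spectral_measure ::
    "('a::chilbert_space \<rightharpoonup> 'a) \<Rightarrow> real set \<Rightarrow> 'a \<Rightarrow> 'a" where
  "spectral_measure T =
     (SOME E. projection_valued_measure E \<and> spectral_integral E (\<lambda>t. t) = T)"

definition fun_calc :: "(real \<Rightarrow> real) \<Rightarrow> ('a::chilbert_space \<rightharpoonup> 'a) \<Rightarrow> ('a \<rightharpoonup> 'a)" where
  "fun_calc f T = spectral_integral (spectral_measure T) f"


definition all_equivalent :: "bool list \<Rightarrow> bool" where
  "all_equivalent Ps \<longleftrightarrow> (\<forall>P\<in>set Ps. \<forall>Q\<in>set Ps. P \<longleftrightarrow> Q)"

end

theory Submission
  imports Defs
begin

text \<open>
  Write \<open>R = A^(1/2)\<close>, \<open>G\<close> and \<open>M\<close> for the bounded inverses of \<open>R\<close> and \<open>H\<close>, \<open>J = sign B\<close> and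
  \<open>Q = |B|^(-1/2)\<close>. Then \<open>B\<close> is the inverse of \<open>G M G = Q J Q\<close>, and \<open>Dom R\<close>, \<open>Dom |B|^(1/2)\<close> are the
  ranges of \<open>G\<close>, \<open>Q\<close>. On the vectors \<open>M G y\<close> and \<open>G y\<close> the operators \<open>X\<close> and \<open>Y\<close> take the values
  \<open>G J y\<close> and \<open>M G J y\<close>, so that both are bounded iff (d) \<open>\<parallel>G J y\<parallel> \<le> c \<parallel>G y\<parallel>\<close>. A range inclusion
  gives a norm inequality by uniform boundedness, so (v) implies (d); (d) gives
  \<open>\<parallel>Q y\<parallel>\<^sup>2 = \<langle>G y, M G J y\<rangle> \<le> c' \<parallel>G y\<parallel>\<^sup>2\<close>. Conversely \<open>\<parallel>Q y\<parallel> \<le> c \<parallel>G y\<parallel>\<close> and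
  \<open>G M G = Q J Q\<close> imply \<open>ran G \<subseteq> ran Q\<close>, as every \<open>G M u\<close> is a limit of \<open>G M G v\<^sub>n = Q J Q v\<^sub>n\<close>
  with \<open>Q v\<^sub>n\<close> convergent. By symmetry each inclusion implies the other, and \<open>ran G = ran Q\<close> gives (v), because
  \<open>J\<close> commutes with \<open>Q\<close>.

  The functional calculus rests on the spectral theorem. The spectral projections of a bounded symmetric \<open>T\<close>
  are the kernel projections of \<open>(|T - a| + (T - a)) / 2\<close>; Dynkin's theorem extends them to the Borel sets, and the image
  under \<open>t \<mapsto> 1 / t\<close> gives the spectral measure of \<open>inverse T\<close>.
\<close>

section \<open>Symmetric bounded operators\<close>

text \<open>Products of unbounded operators have natural domains that are hard to compare directly;
  the bounded operators \<open>G\<close>, \<open>M\<close>, \<open>J\<close>, \<open>Q\<close> avoid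
  this, and what remains is the comparison of two factorizations of one bounded operator. They have
  the same shape, with \<open>M\<close> and \<open>J\<close> symmetric and surjective, and this is
  the symmetry that exchanges the two inclusions. A bound of \<open>Q\<close> by \<open>G\<close>
  ordinarily places \<open>range Q\<close> inside \<open>range G\<close>; the second factorization
  yields the opposite inclusion.

  The estimate (d) also settles (iv): \<open>K\<close> is the adjoint of the densely defined map
  that sends \<open>G y\<close> to \<open>G J y\<close>, and \<open>K\<close> is defined everywhere
  exactly when (v) holds. The symmetry of \<open>X\<close> and \<open>Y\<close> is the commutation
  of \<open>J\<close> with \<open>G M G\<close>.

  The functional calculus is specified by \<open>THE\<close> and \<open>SOME\<close>, so existence
  and uniqueness have to be settled before a value can be computed. Bounded symmetric operators are
  compared by their quadratic forms, which are real; this is why the real part of the inner product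
  carries most of the estimates.\<close>

lemma cinner_add_left: "cinner (x + y) z = cinner x z + cinner y z"
  by (metis cinner_commute cinner_add_right complex_cnj_add)

lemma cinner_scaleC_left: "cinner (c *\<^sub>C x) y = cnj c * cinner x y"
  by (metis cinner_commute cinner_scaleC_right complex_cnj_mult)

lemma scaleC_minus_one: "(-1) *\<^sub>C x = - x"
  using scaleR_scaleC[of "-1" x] by simp

text \<open>Norms and quadratic forms of symmetric operators are real, so estimates and uniqueness
  arguments can run with this real inner product. The imaginary part is recovered from it through
  \<open>Im_cinner\<close>.\<close>

definition rip :: "'a::chilbert_space \<Rightarrow> 'a \<Rightarrow> real" where
  "rip x y = Re (cinner x y)"

lemma rip_commute: "rip x y = rip y x"
  by (metis rip_def cinner_commute complex_cnj(1) complex_surj complex.sel(1))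

lemma rip_add_right: "rip x (y + z) = rip x y + rip x z"
  by (simp add: rip_def cinner_add_right)

lemma rip_add_left: "rip (x + y) z = rip x z + rip y z"
  by (simp add: rip_def cinner_add_left)

lemma rip_scaleR_right: "rip x (r *\<^sub>R y) = r * rip x y"
  by (simp add: rip_def scaleR_scaleC cinner_scaleC_right)

lemma rip_scaleR_left: "rip (r *\<^sub>R x) y = r * rip x y"
  by (metis rip_commute rip_scaleR_right)

lemma rip_minus_right: "rip x (- y) = - rip x y"
  using rip_scaleR_right[of x "-1" y] by simp

lemma rip_minus_left: "rip (- x) y = - rip x y"
  using rip_scaleR_left[of "-1" x y] by simp

lemma rip_diff_right: "rip x (y - z) = rip x y - rip x z"
  using rip_add_right[of x y "- z"] by (simp add: rip_minus_right)

lemma rip_diff_left: "rip (x - y) z = rip x z - rip y z"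
  using rip_add_left[of x "- y" z] by (simp add: rip_minus_left)

lemma rip_zero [simp]: "rip 0 y = 0" "rip x 0 = 0"
  using rip_scaleR_left[of 0 0 y] rip_scaleR_right[of x 0 0] by simp_all

lemma rip_self: "rip x x = (norm x)\<^sup>2"
  by (simp add: rip_def cinner_self)

lemmas rip_simps = rip_add_left rip_add_right rip_diff_left rip_diff_right
  rip_minus_left rip_minus_right rip_scaleR_left rip_scaleR_right

lemma norm_diff_power2: "(norm (x - y))\<^sup>2 = (norm x)\<^sup>2 - 2 * rip x y + (norm y)\<^sup>2"
  using rip_commute[of x y] by (simp flip: rip_self add: rip_simps)

lemma norm_add_power2: "(norm (x + y))\<^sup>2 = (norm x)\<^sup>2 + 2 * rip x y + (norm y)\<^sup>2"
  using rip_commute[of x y] by (simp flip: rip_self add: rip_simps)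

lemma abs_rip_le: "\<bar>rip x y\<bar> \<le> norm x * norm y"
proof -
  have aux: "rip u v \<le> norm u * norm v" for u v :: 'a
  proof (cases "u = 0 \<or> v = 0")
    case False
    hence p: "norm u > 0" "norm v > 0" by auto
    have "0 \<le> (norm (norm v *\<^sub>R u - norm u *\<^sub>R v))\<^sup>2" by simp
    also have "\<dots> = 2 * (norm u * norm v) * (norm u * norm v - rip u v)"
      unfolding norm_diff_power2 by (simp add: rip_simps power_mult_distrib algebra_simps power2_eq_square)
    finally show ?thesis using mult_pos_pos[OF p] by (simp add: zero_le_mult_iff)
  qed auto
  show ?thesis using aux[of x y] aux[of "-x" y] by (simp add: rip_minus_left abs_le_iff)
qed

lemma Im_cinner: "Im (cinner x y) = rip x ((- \<i>) *\<^sub>C y)"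
  by (simp add: rip_def cinner_scaleC_right)

lemma norm_scaleC: "norm (c *\<^sub>C x) = cmod c * norm x"
proof -
  have "complex_of_real ((norm (c *\<^sub>C x))\<^sup>2) = complex_of_real ((cmod c * norm x)\<^sup>2)"
    unfolding cinner_self[symmetric] cinner_scaleC_left cinner_scaleC_right
    by (simp add: cinner_self power_mult_distrib complex_norm_square del: of_real_power)
  hence "(norm (c *\<^sub>C x))\<^sup>2 = (cmod c * norm x)\<^sup>2" by (simp only: of_real_eq_iff)
  thus ?thesis by (simp add: power2_eq_iff_nonneg)
qed

text \<open>Estimating real and imaginary part separately costs a factor 2, which is harmless for
  the continuity that \<open>bounded_bilinear_cinner\<close> extracts.\<close>

lemma norm_cinner_le: "cmod (cinner x y) \<le> norm x * norm y * 2"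
proof -
  have "cmod (cinner x y) \<le> \<bar>Re (cinner x y)\<bar> + \<bar>Im (cinner x y)\<bar>" by (rule cmod_le)
  also have "\<dots> \<le> norm x * norm y + norm x * norm y"
    unfolding Im_cinner rip_def[symmetric]
    by (intro add_mono order_trans[OF abs_rip_le]) (simp_all add: norm_scaleC)
  finally show ?thesis by simp
qed

lemma cinner_scaleR_right: "cinner x (r *\<^sub>R y) = r *\<^sub>R cinner x y"
  by (simp add: scaleR_scaleC cinner_scaleC_right scaleR_conv_of_real)

lemma cinner_scaleR_left: "cinner (r *\<^sub>R x) y = r *\<^sub>R cinner x y"
  by (simp add: scaleR_scaleC cinner_scaleC_left scaleR_conv_of_real)

lemma bounded_bilinear_cinner: "bounded_bilinear (cinner :: 'a::chilbert_space \<Rightarrow> _)"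
  by unfold_locales
     (auto simp: cinner_add_left cinner_add_right cinner_scaleR_left cinner_scaleR_right intro: norm_cinner_le)

lemmas tendsto_cinner = bounded_bilinear.tendsto[OF bounded_bilinear_cinner]
lemmas cinner_diff_left = bounded_bilinear.diff_left[OF bounded_bilinear_cinner]
lemmas cinner_diff_right = bounded_bilinear.diff_right[OF bounded_bilinear_cinner]
lemmas cinner_zero = bounded_bilinear.zero_left[OF bounded_bilinear_cinner]
  bounded_bilinear.zero_right[OF bounded_bilinear_cinner]

lemma tendsto_rip: "(f \<longlongrightarrow> a) F \<Longrightarrow> (g \<longlongrightarrow> b) F \<Longrightarrow> ((\<lambda>x. rip (f x) (g x)) \<longlongrightarrow> rip a b) F"
  unfolding rip_def by (intro tendsto_Re tendsto_cinner)

lemma cinner_ext: 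
  assumes "\<And>z. cinner x z = cinner y z" shows "x = y"
proof -
  have "cinner (x - y) (x - y) = 0" by (simp only: cinner_diff_left assms) simp
  thus ?thesis by (simp add: cinner_self)
qed

lemma cinner_ext_dense:
  assumes "closure D = UNIV" "\<And>z. z \<in> D \<Longrightarrow> cinner x z = cinner y z" shows "x = y"
proof (rule cinner_ext)
  fix z
  from assms(1) obtain s where s: "\<And>n. s n \<in> D" "s \<longlonglongrightarrow> z"
    by (metis UNIV_I closure_sequential)
  have "(\<lambda>n. cinner x (s n)) \<longlonglongrightarrow> cinner x z" by (intro tendsto_cinner s tendsto_const)
  moreover have "(\<lambda>n. cinner x (s n)) \<longlonglongrightarrow> cinner y z"
    using assms(2)[OF s(1)] by (simp, intro tendsto_cinner s tendsto_const)
  ultimately show "cinner x z = cinner y z" by (rule LIMSEQ_unique)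
qed

text \<open>Linearity follows from symmetry against all vectors (\<open>bsym_add\<close>,
  \<open>bsym_scaleC\<close>), so establishing this predicate amounts to one identity and one
  bound.\<close>

definition bsym :: "('a::chilbert_space \<Rightarrow> 'a) \<Rightarrow> bool" where
  "bsym L \<longleftrightarrow> (\<forall>x y. cinner (L x) y = cinner x (L y)) \<and> (\<exists>c. \<forall>x. norm (L x) \<le> c * norm x)"

lemma bsymI:
  "(\<And>x y. cinner (L x) y = cinner x (L y)) \<Longrightarrow> (\<And>x. norm (L x) \<le> c * norm x) \<Longrightarrow> bsym L"
  by (auto simp: bsym_def)

lemma bsym_cinner: "bsym L \<Longrightarrow> cinner (L x) y = cinner x (L y)"
  by (simp add: bsym_def)

lemma bsym_rip: "bsym L \<Longrightarrow> rip (L x) y = rip x (L y)"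
  by (simp add: bsym_def rip_def)

lemma bsym_bound: assumes "bsym L" obtains c where "c > 0" "\<And>x. norm (L x) \<le> c * norm x"
proof -
  from assms obtain c where c: "\<And>x. norm (L x) \<le> c * norm x" by (auto simp: bsym_def)
  have "norm (L x) \<le> (\<bar>c\<bar> + 1) * norm x" for x
    by (rule order_trans[OF c]) (intro mult_right_mono, auto)
  thus ?thesis by (intro that[of "\<bar>c\<bar> + 1"]) auto
qed

lemma bsym_add: "bsym L \<Longrightarrow> L (x + y) = L x + L y"
  by (rule cinner_ext) (simp add: bsym_cinner cinner_add_left)

lemma bsym_scaleC: "bsym L \<Longrightarrow> L (c *\<^sub>C x) = c *\<^sub>C L x"
  by (rule cinner_ext) (simp add: bsym_cinner cinner_scaleC_left)

lemma bsym_scaleR: "bsym L \<Longrightarrow> L (r *\<^sub>R x) = r *\<^sub>R L x"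
  by (simp add: scaleR_scaleC bsym_scaleC)

lemma bsym_minus: "bsym L \<Longrightarrow> L (- x) = - L x"
  by (metis bsym_scaleC scaleC_minus_one)

lemma bsym_diff: "bsym L \<Longrightarrow> L (x - y) = L x - L y"
  using bsym_add[of L x "- y"] by (simp add: bsym_minus)

lemma bsym_zero [simp]: "bsym L \<Longrightarrow> L 0 = 0"
  using bsym_scaleR[of L 0 0] by simp

lemmas bsym_lin = bsym_add bsym_diff bsym_minus bsym_scaleC bsym_scaleR bsym_zero

lemma bsym_bounded_linear: "bsym L \<Longrightarrow> bounded_linear L"
  using bsym_bound[of L] by (metis bounded_linear_intro bsym_add bsym_scaleR mult.commute)

lemma bsym_tendsto: "bsym L \<Longrightarrow> (f \<longlongrightarrow> a) F \<Longrightarrow> ((\<lambda>x. L (f x)) \<longlongrightarrow> L a) F"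
  by (rule bounded_linear.tendsto[OF bsym_bounded_linear])

lemma bsym_id: "bsym (\<lambda>x. x)" by (rule bsymI[of _ 1]) auto

lemma bsym_const_zero: "bsym (\<lambda>x. 0)" by (rule bsymI[of _ 1]) (auto simp: cinner_zero)

lemma bsym_plus: assumes "bsym L" "bsym M" shows "bsym (\<lambda>x. L x + M x)"
proof -
  obtain c d where c: "\<And>x. norm (L x) \<le> c * norm x" and d: "\<And>x. norm (M x) \<le> d * norm x"
    using assms bsym_def by metis
  show ?thesis
    by (rule bsymI[of _ "c + d"])
       (use assms norm_triangle_mono[OF c d] in \<open>auto simp: cinner_add_left cinner_add_right bsym_cinner algebra_simps\<close>)
qed

lemma bsym_scale: assumes "bsym L" shows "bsym (\<lambda>x. r *\<^sub>R L x)"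
proof -
  obtain c where c: "\<And>x. norm (L x) \<le> c * norm x" 
    using assms bsym_def by metis
  show ?thesis
    by (rule bsymI[of _ "\<bar>r\<bar> * c"])
       (use assms mult_left_mono[OF c, of "\<bar>r\<bar>"] in \<open>auto simp: cinner_scaleR_left cinner_scaleR_right bsym_cinner ac_simps\<close>)
qed

lemma bsym_minus_op: "bsym L \<Longrightarrow> bsym M \<Longrightarrow> bsym (\<lambda>x. L x - M x)"
  using bsym_plus[of L "\<lambda>x. (-1) *\<^sub>R M x"] bsym_scale[of M "-1"] by simp

lemma bsym_comp: assumes "bsym L" "bsym M" "\<And>x. L (M x) = M (L x)" shows "bsym (\<lambda>x. L (M x))"
proof -
  obtain c where c: "c > 0" "\<And>x. norm (L x) \<le> c * norm x" using bsym_bound[OF assms(1)] by blast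
  obtain d where d: "d > 0" "\<And>x. norm (M x) \<le> d * norm x" using bsym_bound[OF assms(2)] by blast
  have "norm (L (M x)) \<le> c * d * norm x" for x
    using order_trans[OF c(2) mult_left_mono[OF d(2), of c x]] c by (simp add: ac_simps)
  thus ?thesis using assms by (intro bsymI) (auto simp: bsym_cinner)
qed

lemma bsym_comp3: assumes "bsym L" "bsym M" shows "bsym (\<lambda>x. L (M (L x)))"
proof -
  obtain c where c: "c > 0" "\<And>x. norm (L x) \<le> c * norm x" using bsym_bound[OF assms(1)] by blast
  obtain d where d: "d > 0" "\<And>x. norm (M x) \<le> d * norm x" using bsym_bound[OF assms(2)] by blast
  have "norm (L (M (L x))) \<le> c * (d * (c * norm x))" for x
    using c d by (meson mult_left_mono order_trans less_imp_le)
  thus ?thesis using assms by (intro bsymI[of _ "c * (d * c)"]) (auto simp: bsym_cinner ac_simps)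
qed

lemma bsym_lim:
  assumes "\<And>n. bsym (L n)" "\<And>n x. norm (L n x) \<le> c * norm x" "\<And>x. (\<lambda>n. L n x) \<longlonglongrightarrow> M x"
  shows "bsym M"
proof (rule bsymI[of _ c])
  fix x y
  have "(\<lambda>n. cinner (L n x) y) \<longlonglongrightarrow> cinner (M x) y" by (intro tendsto_cinner assms tendsto_const)
  moreover have "(\<lambda>n. cinner (L n x) y) \<longlonglongrightarrow> cinner x (M y)"
    by (simp only: bsym_cinner[OF assms(1)]) (intro tendsto_cinner assms tendsto_const)
  ultimately show "cinner (M x) y = cinner x (M y)" by (rule LIMSEQ_unique)
  have "(\<lambda>n. norm (L n x)) \<longlonglongrightarrow> norm (M x)" by (intro tendsto_norm assms)
  thus "norm (M x) \<le> c * norm x" by (rule LIMSEQ_le_const2) (use assms(2) in auto)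
qed

text \<open>In the form at \<open>D x + x\<close> all terms vanish except the two cross terms, and
  by symmetry each of them is \<open>(norm (D x))^2\<close>.\<close>

lemma bsym_zeroI:
  assumes "bsym D" "\<And>x. rip x (D x) = 0" shows "D x = 0"
proof -
  have "rip (D x + x) (D (D x + x)) = 0" by fact
  hence "rip (D x) (D (D x)) + rip (D x) (D x) + rip x (D (D x)) + rip x (D x) = 0"
    using assms(1) by (simp add: bsym_lin rip_simps)
  hence "2 * rip (D x) (D x) = 0"
    using assms(2) bsym_rip[OF assms(1), of x "D x"] by simp
  thus ?thesis by (simp add: rip_self)
qed

lemma bsym_eqI:
  assumes "bsym L" "bsym M" "\<And>x. rip x (L x) = rip x (M x)" shows "L = M"
proof
  fix x show "L x = M x"
    using bsym_zeroI[OF bsym_minus_op[OF assms(1,2)]] assms(3) by (simp add: rip_diff_right)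
qed

section \<open>Orthogonal projections as bounded symmetric idempotents\<close>

lemma orthogonal_projection_iff: "orthogonal_projection P \<longleftrightarrow> bsym P \<and> (\<forall>x. P (P x) = P x)"
proof
  assume a: "orthogonal_projection P"
  hence i: "P (P x) = P x" and s: "cinner (P x) y = cinner x (P y)" for x y
    by (auto simp: orthogonal_projection_def fun_eq_iff)
  have "norm (P x) \<le> 1 * norm x" for x
  proof -
    have "(norm (P x))\<^sup>2 = rip x (P x)" by (simp flip: rip_self add: rip_def s i)
    also have "\<dots> \<le> norm x * norm (P x)" using abs_rip_le[of x "P x"] by simp
    finally show ?thesis by (cases "P x = 0") (auto simp: power2_eq_square)
  qed
  with s have "bsym P" by (rule bsymI)
  with i show "bsym P \<and> (\<forall>x. P (P x) = P x)" by simp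
next
  assume "bsym P \<and> (\<forall>x. P (P x) = P x)"
  thus "orthogonal_projection P"
    by (auto simp: orthogonal_projection_def linear_op_def bsym_lin bsym_cinner)
qed

abbreviation "oproj \<equiv> orthogonal_projection"

lemma oproj_bsym: "oproj P \<Longrightarrow> bsym P" and oproj_idem: "oproj P \<Longrightarrow> P (P x) = P x"
  by (auto simp: orthogonal_projection_iff)

lemma oproj_rip: "oproj P \<Longrightarrow> rip x (P x) = (norm (P x))\<^sup>2"
  by (metis bsym_rip oproj_bsym oproj_idem rip_self)

lemma oproj_norm_le: assumes "oproj P" shows "norm (P x) \<le> norm x"
proof -
  have "(norm (P x))\<^sup>2 \<le> norm x * norm (P x)" 
    using abs_rip_le[of x "P x"] oproj_rip[OF assms, of x] by simp
  thus ?thesis by (cases "P x = 0") (auto simp: power2_eq_square)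
qed

text \<open>The form of a projection is its squared norm by \<open>oproj_rip\<close>, so the values
  of scalar measures pin a projection down.\<close>

lemma oproj_eqI: "oproj P \<Longrightarrow> oproj Q \<Longrightarrow> (\<And>x. norm (P x) = norm (Q x)) \<Longrightarrow> P = Q"
  by (rule bsym_eqI) (auto simp: oproj_bsym oproj_rip)

lemma oproj_compl: assumes "oproj P" shows "oproj (\<lambda>x. x - P x)"
  unfolding orthogonal_projection_iff using assms
  by (auto intro!: bsym_minus_op bsym_id simp: oproj_bsym bsym_lin oproj_idem)

lemma oproj_compl_norm: assumes "oproj P" shows "(norm (x - P x))\<^sup>2 = (norm x)\<^sup>2 - (norm (P x))\<^sup>2"
  using assms by (simp add: norm_diff_power2 oproj_rip)

section \<open>Square roots and spectral projections\<close>

text \<open>Each construction of this section is shown to commute with all bounded symmetric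
  operators that commute with its input. This stands in for approximation by polynomials in the
  operator.\<close>

definition comm :: "('a \<Rightarrow> 'a) \<Rightarrow> ('a \<Rightarrow> 'a) \<Rightarrow> bool" where
  "comm L M \<longleftrightarrow> (\<forall>x. L (M x) = M (L x))"

lemma commD: "comm L M \<Longrightarrow> L (M x) = M (L x)"
  by (simp add: comm_def)

text \<open>The uniform bound makes strong convergence jointly continuous in operator and vector;
  \<open>sqrt_of_compl\<close> uses this for the square of the iterates.\<close>

lemma tendsto_bsym_seq:
  assumes "\<And>n. bsym (L n)" "\<And>n x. norm (L n x) \<le> c * norm x" "\<And>x. (\<lambda>n. L n x) \<longlonglongrightarrow> M x"
    "u \<longlonglongrightarrow> x"
  shows "(\<lambda>n. L n (u n)) \<longlonglongrightarrow> M x"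
proof -
  have "(\<lambda>n. c * norm (u n - x)) \<longlonglongrightarrow> c * norm (x - x)" by (intro tendsto_intros assms)
  hence "(\<lambda>n. c * norm (u n - x)) \<longlonglongrightarrow> 0" by simp
  hence "(\<lambda>n. L n (u n - x)) \<longlonglongrightarrow> 0"
    by (rule Lim_null_comparison[rotated]) (use assms(2) in auto)
  from tendsto_add[OF this assms(3)[of x]] show ?thesis
    by (simp add: bsym_diff[OF assms(1)])
qed

lemma comm_lim:
  assumes "bsym K" "\<And>n. comm K (L n)" "\<And>x. (\<lambda>n. L n x) \<longlonglongrightarrow> M x"
  shows "comm K M"
  unfolding comm_def
proof
  fix x
  have "(\<lambda>n. K (L n x)) \<longlonglongrightarrow> K (M x)" by (rule bsym_tendsto[OF assms(1) assms(3)])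
  moreover have "(\<lambda>n. K (L n x)) \<longlonglongrightarrow> M (K x)"
    using assms(3)[of "K x"] by (simp add: commD[OF assms(2)])
  ultimately show "K (M x) = M (K x)" by (rule LIMSEQ_unique)
qed

text \<open>The iteration for \<open>1 - sqrt (1 - t)\<close> at the worst point \<open>t = 1\<close>.\<close>

fun sqrt_bd :: "nat \<Rightarrow> real" where
  "sqrt_bd 0 = 0"
| "sqrt_bd (Suc n) = (1 + (sqrt_bd n)\<^sup>2) / 2"

fun sqrt_it :: "('a::chilbert_space \<Rightarrow> 'a) \<Rightarrow> nat \<Rightarrow> 'a \<Rightarrow> 'a" where
  "sqrt_it X 0 x = 0"
| "sqrt_it X (Suc n) x = (1/2) *\<^sub>R (X x + sqrt_it X n (sqrt_it X n x))"

lemma sqrt_bd: "0 \<le> sqrt_bd n" "sqrt_bd n \<le> 1"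
proof (induction n)
  case (Suc n)
  { case 1 show ?case by simp
  next case 2 show ?case using Suc power_le_one[of "sqrt_bd n" 2] by simp }
qed auto

lemma sqrt_bd_Suc: "sqrt_bd n \<le> sqrt_bd (Suc n)"
  using zero_le_power2[of "sqrt_bd n - 1"] by (simp add: power2_eq_square algebra_simps)

lemma incseq_sqrt_bd: "incseq sqrt_bd"
  by (rule incseq_SucI) (rule sqrt_bd_Suc)

lemma Cauchy_sqrt_bd: "Cauchy sqrt_bd"
  using incseq_convergent[OF incseq_sqrt_bd, of 1] sqrt_bd(2) by (meson LIMSEQ_imp_Cauchy)

context
  fixes X :: "'a::chilbert_space \<Rightarrow> 'a"
  assumes X: "bsym X" "\<And>x. norm (X x) \<le> norm x"
begin

lemma sqrt_it_comm:
  assumes "bsym L" "comm L X" shows "comm L (sqrt_it X n)"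
proof (induction n)
  case (Suc n)
  thus ?case using assms by (simp add: comm_def bsym_lin)
qed (use assms in \<open>auto simp: comm_def bsym_lin\<close>)

lemma sqrt_it_bsym: "bsym (sqrt_it X n)"
proof (induction n)
  case 0 show ?case using bsym_const_zero by (simp add: fun_eq_iff[symmetric] flip: sqrt_it.simps(1)[of X])
next
  case (Suc n)
  have "bsym (\<lambda>x. (1/2) *\<^sub>R (X x + sqrt_it X n (sqrt_it X n x)))"
    by (rule bsym_scale[OF bsym_plus[OF X(1) bsym_comp[OF Suc Suc refl]]])
  thus ?case by simp
qed

lemma sqrt_it_comm_self: "comm (sqrt_it X n) (sqrt_it X m)"
  by (intro sqrt_it_comm sqrt_it_bsym) (metis comm_def X(1) sqrt_it_comm)

lemma sqrt_it_norm: "norm (sqrt_it X n x) \<le> sqrt_bd n * norm x"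
proof (induction n arbitrary: x)
  case (Suc n)
  have "norm (sqrt_it X n (sqrt_it X n x)) \<le> sqrt_bd n * (sqrt_bd n * norm x)"
    using Suc sqrt_bd(1)[of n] by (meson mult_left_mono order_trans)
  hence "norm (X x + sqrt_it X n (sqrt_it X n x)) \<le> norm x + sqrt_bd n * (sqrt_bd n * norm x)"
    using X(2)[of x] by (meson norm_triangle_mono)
  thus ?case unfolding sqrt_it.simps norm_scaleR by (simp add: power2_eq_square algebra_simps)
qed simp

text \<open>Commuting iterates \<open>Y\<close> and \<open>Z\<close> satisfy
  \<open>Y Y - Z Z = (Y + Z) (Y - Z)\<close>. The scalar recursion obeys the same identity, so it
  majorizes the increments of the operator recursion, and its convergence transfers.\<close>

lemma sqrt_it_step: "norm (sqrt_it X (Suc n) x - sqrt_it X n x) \<le> (sqrt_bd (Suc n) - sqrt_bd n) * norm x"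
proof (induction n arbitrary: x)
  case 0 show ?case using X(2) by simp
next
  case (Suc n)
  define Y Z where "Y = sqrt_it X (Suc n)" and "Z = sqrt_it X n"
  define y z where "y = sqrt_bd (Suc n)" and "z = sqrt_bd n"
  have bs: "bsym Y" "bsym Z" unfolding Y_def Z_def by (rule sqrt_it_bsym)+
  have c: "Y (Z x) = Z (Y x)" unfolding Y_def Z_def by (intro commD sqrt_it_comm_self)
  have IH: "norm (Y x - Z x) \<le> (y - z) * norm x" for x
    unfolding Y_def Z_def y_def z_def by (rule Suc)
  have "norm (Y u + Z u) \<le> (y + z) * norm u" for u
    using norm_triangle_mono[OF sqrt_it_norm[of "Suc n" u] sqrt_it_norm[of n u]]
    unfolding Y_def Z_def y_def z_def by (simp only: distrib_right)
  from order_trans[OF this mult_left_mono[OF IH]]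
  have *: "norm (Y (Y x - Z x) + Z (Y x - Z x)) \<le> (y + z) * ((y - z) * norm x)"
    using sqrt_bd(1) by (simp add: y_def z_def del: sqrt_bd.simps)
  have "sqrt_it X (Suc (Suc n)) x - sqrt_it X (Suc n) x = (1/2) *\<^sub>R (X x + Y (Y x)) - (1/2) *\<^sub>R (X x + Z (Z x))"
    by (simp add: Y_def Z_def)
  also have "\<dots> = (1/2) *\<^sub>R (Y (Y x - Z x) + Z (Y x - Z x))"
    using bs c by (simp add: bsym_lin algebra_simps)
  finally have "norm (sqrt_it X (Suc (Suc n)) x - sqrt_it X (Suc n) x) \<le> (1/2) * ((y + z) * ((y - z) * norm x))"
    using * by simp
  also have "\<dots> = (sqrt_bd (Suc (Suc n)) - sqrt_bd (Suc n)) * norm x"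
    unfolding sqrt_bd.simps(2)[of "Suc n"] y_def[symmetric] by (simp add: y_def z_def power2_eq_square field_simps)
  finally show ?case .
qed

lemma sqrt_it_diff: "m \<le> n \<Longrightarrow> norm (sqrt_it X n x - sqrt_it X m x) \<le> (sqrt_bd n - sqrt_bd m) * norm x"
proof (induction n rule: dec_induct)
  case (step n)
  have "norm (sqrt_it X (Suc n) x - sqrt_it X m x) \<le>
      norm (sqrt_it X (Suc n) x - sqrt_it X n x) + norm (sqrt_it X n x - sqrt_it X m x)"
    using norm_triangle_ineq[of "sqrt_it X (Suc n) x - sqrt_it X n x" "sqrt_it X n x - sqrt_it X m x"] by simp
  thus ?case using step.IH sqrt_it_step[of n x] by (simp add: algebra_simps)
qed simp

lemma sqrt_it_Cauchy: "Cauchy (\<lambda>n. sqrt_it X n x)"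
proof (rule CauchyI')
  fix e :: real assume e: "e > 0"
  hence "e / (norm x + 1) > 0" by (simp add: add_nonneg_pos)
  from CauchyD[OF Cauchy_sqrt_bd this] obtain M where
    M: "\<And>m n. m \<ge> M \<Longrightarrow> n \<ge> M \<Longrightarrow> norm (sqrt_bd m - sqrt_bd n) < e / (norm x + 1)" by blast
  show "\<exists>M. \<forall>m\<ge>M. \<forall>n>m. dist (sqrt_it X m x) (sqrt_it X n x) < e"
  proof (intro exI allI impI)
    fix m n assume mn: "m \<ge> M" "n > m"
    have "dist (sqrt_it X m x) (sqrt_it X n x) \<le> (sqrt_bd n - sqrt_bd m) * norm x"
      using sqrt_it_diff[of m n x] mn by (simp add: dist_norm norm_minus_commute)
    also have "\<dots> \<le> (sqrt_bd n - sqrt_bd m) * (norm x + 1)"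
      using incseqD[OF incseq_sqrt_bd, of m n] mn by (intro mult_left_mono) auto
    also have "sqrt_bd n - sqrt_bd m < e / (norm x + 1)" using M[of n m] mn by auto
    hence "(sqrt_bd n - sqrt_bd m) * (norm x + 1) < e" by (simp add: pos_less_divide_eq add_nonneg_pos)
    finally show "dist (sqrt_it X m x) (sqrt_it X n x) < e" .
  qed
qed

text \<open>The limit \<open>Y\<close> of the iterates solves \<open>2 Y = X + Y Y\<close>, hence
  \<open>(1 - Y) (1 - Y) = 1 - X\<close>; the norm bound on \<open>Y\<close> makes
  \<open>1 - Y\<close> nonnegative.\<close>

lemma sqrt_of_compl:
  obtains N where "bsym N" "\<And>x. rip x (N x) \<ge> 0" "\<And>x. N (N x) = x - X x"
    "\<And>L. bsym L \<Longrightarrow> comm L X \<Longrightarrow> comm L N"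
proof
  define Y where "Y x = lim (\<lambda>n. sqrt_it X n x)" for x
  have Y: "(\<lambda>n. sqrt_it X n x) \<longlonglongrightarrow> Y x" for x
    unfolding Y_def using sqrt_it_Cauchy Cauchy_convergent_iff convergent_LIMSEQ_iff by blast
  have le: "norm (sqrt_it X n x) \<le> 1 * norm x" for n x
    by (rule order_trans[OF sqrt_it_norm]) (intro mult_right_mono sqrt_bd, simp)
  have bY: "bsym Y" by (rule bsym_lim[OF sqrt_it_bsym le Y])
  have nY: "norm (Y x) \<le> norm x" for x
    using LIMSEQ_le_const2[OF tendsto_norm[OF Y[of x]], of "norm x"] le[of _ x] by auto
  have "(\<lambda>n. sqrt_it X (Suc n) x) \<longlonglongrightarrow> (1/2) *\<^sub>R (X x + Y (Y x))" for x
    unfolding sqrt_it.simps by (intro tendsto_intros tendsto_bsym_seq[OF sqrt_it_bsym le Y] Y)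
  with LIMSEQ_Suc[OF Y] have eq: "Y x = (1/2) *\<^sub>R (X x + Y (Y x))" for x
    by (rule LIMSEQ_unique)
  have eq': "Y (Y x) = Y x + Y x - X x" for x
    by (subst (2 3) eq) (simp flip: scaleR_add_left)
  show "bsym (\<lambda>x. x - Y x)" by (intro bsym_minus_op bsym_id bY)
  show "rip x (x - Y x) \<ge> 0" for x
    using abs_rip_le[of x "Y x"] mult_left_mono[OF nY[of x], of "norm x"]
    by (simp add: rip_diff_right rip_self power2_eq_square)
  show "x - Y x - Y (x - Y x) = x - X x" for x
    using bY eq' by (simp add: bsym_lin)
  show "comm L (\<lambda>x. x - Y x)" if L: "bsym L" "comm L X" for L
    using comm_lim[OF L(1) sqrt_it_comm[OF L] Y] L(1) by (simp add: comm_def bsym_lin)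
qed

end

text \<open>The square root of \<open>T T\<close>, written as \<open>1 - (1 - T T)\<close>:
  expanding the squared norm shows that \<open>1 - T T\<close> is a contraction whenever
  \<open>T\<close> is one.\<close>

lemma abs_op:
  assumes "bsym T" "\<And>x. norm (T x) \<le> norm x"
  obtains N where "bsym N" "\<And>x. rip x (N x) \<ge> 0" "\<And>x. N (N x) = T (T x)"
    "\<And>L. bsym L \<Longrightarrow> comm L T \<Longrightarrow> comm L N"
proof -
  have "bsym (\<lambda>x. x - T (T x))" by (rule bsym_minus_op[OF bsym_id bsym_comp[OF assms(1,1) refl]])
  moreover have "norm (x - T (T x)) \<le> norm x" for x
  proof -
    have "(norm (x - T (T x)))\<^sup>2 = (norm x)\<^sup>2 - 2 * (norm (T x))\<^sup>2 + (norm (T (T x)))\<^sup>2"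
      by (simp add: norm_diff_power2 rip_self flip: bsym_rip[OF assms(1)])
    also have "(norm (T (T x)))\<^sup>2 \<le> (norm (T x))\<^sup>2" by (intro power_mono assms) auto
    finally have "(norm (x - T (T x)))\<^sup>2 \<le> (norm x)\<^sup>2" using zero_le_power2[of "norm (T x)"] by linarith
    thus ?thesis by (rule power2_le_imp_le) (rule norm_ge_zero)
  qed
  ultimately obtain N where N: "bsym N" "\<And>x. rip x (N x) \<ge> 0" "\<And>x. N (N x) = x - (x - T (T x))"
    "\<And>L. bsym L \<Longrightarrow> comm L (\<lambda>x. x - T (T x)) \<Longrightarrow> comm L N"
    by (rule sqrt_of_compl) blast
  show ?thesis
    by (rule that[OF N(1,2)]) (use N(3,4) in \<open>auto simp: comm_def bsym_lin\<close>)
qed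

text \<open>The projection is the strong limit of \<open>(1 - (N / c)\<^sup>2) ^ (2 n)\<close> (von Neumann's ergodic theorem).\<close>

lemma kernel_projection:
  assumes N: "bsym N"
  obtains P where "oproj P" "\<And>x. P x = x \<longleftrightarrow> N x = 0" "\<And>L. bsym L \<Longrightarrow> comm L N \<Longrightarrow> comm L P"
proof -
  obtain c where c: "c > 0" "\<And>x. norm (N x) \<le> c * norm x" using bsym_bound[OF N] by blast
  define U where "U x = x - (1 / c\<^sup>2) *\<^sub>R N (N x)" for x
  have bU: "bsym U" unfolding U_def by (rule bsym_minus_op[OF bsym_id bsym_scale[OF bsym_comp[OF N N refl]]])
  have U2: "(norm (U x))\<^sup>2 \<le> (norm x)\<^sup>2 - (norm (N x))\<^sup>2 / c\<^sup>2" for x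
  proof -
    have "(norm (U x))\<^sup>2 = (norm x)\<^sup>2 - 2 * ((norm (N x))\<^sup>2 / c\<^sup>2) + (norm (N (N x)))\<^sup>2 / (c\<^sup>2)\<^sup>2"
      using c unfolding U_def norm_diff_power2
      by (simp add: rip_simps rip_self power_mult_distrib power_divide flip: bsym_rip[OF N])
    moreover have "(norm (N (N x)))\<^sup>2 \<le> (c * norm (N x))\<^sup>2" by (intro power_mono c) auto
    hence "(norm (N (N x)))\<^sup>2 / (c\<^sup>2)\<^sup>2 \<le> (c * norm (N x))\<^sup>2 / (c\<^sup>2)\<^sup>2"
      by (rule divide_right_mono) simp
    hence "(norm (N (N x)))\<^sup>2 / (c\<^sup>2)\<^sup>2 \<le> (norm (N x))\<^sup>2 / c\<^sup>2"
      using c(1) by (simp add: power_mult_distrib power2_eq_square)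
    ultimately show ?thesis by linarith
  qed
  have U1: "norm (U x) \<le> norm x" for x
    by (rule power2_le_imp_le, rule order_trans[OF U2]) simp_all
  define V where "V n = U ^^ n" for n
  have V_Suc: "V (Suc n) x = U (V n x)" for n x by (simp add: V_def)
  have V_add: "V (m + n) x = V m (V n x)" for m n x by (simp add: V_def funpow_add)
  have bV: "bsym (V n)" for n
  proof (induction n)
    case 0 show ?case using bsym_id by (simp add: V_def id_def)
  next
    case (Suc n)
    have "bsym (\<lambda>x. U (V n x))" by (rule bsym_comp[OF bU Suc]) (simp add: V_def funpow_swap1)
    moreover have "V (Suc n) = (\<lambda>x. U (V n x))" by (auto simp: V_Suc)
    ultimately show ?case by simp
  qed
  have V1: "norm (V n x) \<le> 1 * norm x" for n x
    by (induction n) (auto simp: V_Suc intro: order_trans[OF U1], simp add: V_def)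
  have cV: "comm L (V n)" if "bsym L" "comm L N" for L n
  proof (induction n)
    case (Suc n) thus ?case using that by (simp add: comm_def V_Suc U_def bsym_lin)
  qed (simp add: V_def comm_def)
  have dec: "decseq (\<lambda>n. (norm (V n x))\<^sup>2)" for x
    by (rule decseq_SucI) (simp add: V_Suc U1)
  have "Cauchy (\<lambda>n. V (2 * n) x)" for x
  proof -
    from decseq_convergent[OF dec, of 0 x] obtain l where l: "(\<lambda>n. (norm (V n x))\<^sup>2) \<longlonglongrightarrow> l" by auto
    show ?thesis
    proof (rule CauchyI)
      fix e :: real assume e: "e > 0"
      from LIMSEQ_D[OF l, of "e\<^sup>2 / 4"] e obtain k where
        k: "\<And>n. n \<ge> k \<Longrightarrow> \<bar>(norm (V n x))\<^sup>2 - l\<bar> < e\<^sup>2 / 4" by auto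
      show "\<exists>M. \<forall>m\<ge>M. \<forall>n\<ge>M. norm (V (2 * m) x - V (2 * n) x) < e"
      proof (intro exI allI impI)
        fix m n assume mn: "m \<ge> k" "n \<ge> k"
        \<comment> \<open>Even exponents split evenly: moving powers across the inner product yields
          \<open>(norm (V (m + n) x))^2\<close>, so the Cauchy property reduces to convergence of
          the decreasing norms.\<close>
        have "rip (V (2 * m) x) (V (2 * n) x) = rip x (V (2 * m) (V (2 * n) x))"
          by (rule bsym_rip[OF bV])
        also have "\<dots> = rip (V (m + n) x) (V (m + n) x)"
          unfolding bsym_rip[OF bV] V_add[symmetric] by (simp add: mult_2 add_ac)
        finally have "(norm (V (2 * m) x - V (2 * n) x))\<^sup>2 =
            (norm (V (2 * m) x))\<^sup>2 - 2 * (norm (V (m + n) x))\<^sup>2 + (norm (V (2 * n) x))\<^sup>2"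
          by (simp add: norm_diff_power2 rip_self)
        also have "\<dots> < e\<^sup>2" using k[of "2 * m"] k[of "2 * n"] k[of "m + n"] mn
          by (simp only: abs_less_iff) linarith
        finally show "norm (V (2 * m) x - V (2 * n) x) < e"
          using e by (meson power2_less_imp_less less_imp_le)
      qed
    qed
  qed
  hence conv: "convergent (\<lambda>n. V (2 * n) x)" for x by (simp add: Cauchy_convergent_iff)
  define P where "P x = lim (\<lambda>n. V (2 * n) x)" for x
  have P: "(\<lambda>n. V (2 * n) x) \<longlonglongrightarrow> P x" for x
    unfolding P_def using conv convergent_LIMSEQ_iff by blast
  have bP: "bsym P" by (rule bsym_lim[OF bV V1 P])
  have NP: "N (P x) = 0" for x
  proof -
    \<comment> \<open>\<open>P x\<close> is fixed by \<open>U\<close> applied twice, so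
      \<open>U\<close> does not shrink it, and the loss term in \<open>U2\<close> must
      vanish.\<close>
    have "(\<lambda>n. V (2 * Suc n) x) \<longlonglongrightarrow> U (U (P x))"
      using bsym_tendsto[OF bU bsym_tendsto[OF bU P]] by (simp add: V_Suc)
    hence "U (U (P x)) = P x" using LIMSEQ_Suc[OF P] by (rule LIMSEQ_unique)
    hence "norm (U (P x)) = norm (P x)" using U1[of "P x"] U1[of "U (P x)"] by simp
    hence "(norm (N (P x)))\<^sup>2 / c\<^sup>2 \<le> 0" using U2[of "P x"] by simp
    thus ?thesis using c(1) by (simp add: divide_le_0_iff)
  qed
  have fix_iff: "P x = x \<longleftrightarrow> N x = 0" for x
  proof
    assume "N x = 0"
    hence "U x = x" using N by (simp add: U_def)
    hence "V n x = x" for n by (induction n) (simp_all add: V_Suc, simp add: V_def)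
    thus "P x = x" by (simp add: P_def)
  qed (use NP in metis)
  show ?thesis
  proof (rule that)
    show "oproj P" using bP fix_iff NP by (auto simp: orthogonal_projection_iff)
    show "comm L P" if "bsym L" "comm L N" for L
      using comm_lim[OF that(1) cV[OF that] P] .
  qed (fact fix_iff)
qed

text \<open>Let \<open>N\<close> be the absolute value of the rescaled operator \<open>S\<close>. On
  the kernel of \<open>N + S\<close> one has \<open>S = - N\<close>. A vector orthogonal to this
  kernel is orthogonal to the range of \<open>N - S\<close>, because
  \<open>(N + S) (N - S) = 0\<close>, and so satisfies \<open>S x = N x\<close>. The kernel of
  \<open>T\<close> falls to the nonpositive side, which makes the later projections belong to the
  closed half-lines \<open>{..a}\<close>.\<close>

lemma negative_projection:
  assumes T: "bsym T"
  obtains P where "oproj P" "\<And>x. P x = x \<Longrightarrow> rip x (T x) \<le> 0" "\<And>x. P x = 0 \<Longrightarrow> rip x (T x) \<ge> 0"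
    "\<And>x. T x = 0 \<Longrightarrow> P x = x" "\<And>L. bsym L \<Longrightarrow> comm L T \<Longrightarrow> comm L P"
proof -
  obtain c where c: "c > 0" "\<And>x. norm (T x) \<le> c * norm x" using bsym_bound[OF T] by blast
  define S where "S x = (1 / c) *\<^sub>R T x" for x
  have bS: "bsym S" unfolding S_def by (intro bsym_scale T)
  have nS: "norm (S x) \<le> norm x" for x
    using c(1) c(2)[of x] by (simp add: S_def divide_le_eq mult.commute)
  have TS: "rip x (T x) = c * rip x (S x)" for x using c(1) by (simp add: S_def rip_simps)
  obtain N where N: "bsym N" "\<And>x. rip x (N x) \<ge> 0" "\<And>x. N (N x) = S (S x)"
    "\<And>L. bsym L \<Longrightarrow> comm L S \<Longrightarrow> comm L N"
    using abs_op[OF bS nS] by blast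
  have NS: "S (N x) = N (S x)" for x using N(4)[OF bS] by (simp add: comm_def)
  obtain P where P: "oproj P" "\<And>x. P x = x \<longleftrightarrow> N x + S x = 0"
      "\<And>L. bsym L \<Longrightarrow> comm L (\<lambda>x. N x + S x) \<Longrightarrow> comm L P"
    using kernel_projection[OF bsym_plus[OF N(1) bS]] by metis
  show ?thesis
  proof (rule that[OF P(1)])
    fix x
    show "rip x (T x) \<le> 0" if "P x = x"
    proof -
      from that have "S x = - N x" using P(2) by (simp add: eq_neg_iff_add_eq_0 add.commute)
      thus ?thesis using c(1) N(2)[of x] by (simp add: TS rip_simps)
    qed
    show "rip x (T x) \<ge> 0" if 0: "P x = 0"
    proof -
      have "rip (N x - S x) v = 0" for v
      proof -
        have "P (N v - S v) = N v - S v"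
          unfolding P(2) using N(1) bS N(3) by (simp add: bsym_lin NS)
        hence "rip x (N v - S v) = rip (P x) (N v - S v)"
          by (metis bsym_rip oproj_bsym P(1))
        thus ?thesis using 0 N(1) bS by (simp add: rip_simps bsym_rip)
      qed
      from this[of "N x - S x"] have "S x = N x" by (simp add: rip_self)
      thus ?thesis using c(1) N(2)[of x] by (simp add: TS)
    qed
    show "P x = x" if "T x = 0"
    proof -
      from that have S0: "S x = 0" by (simp add: S_def)
      have "rip (N x) (N x) = 0" using N(1) N(3)[of x] S0 bS by (simp add: bsym_rip)
      thus ?thesis unfolding P(2) using S0 by (simp add: rip_self)
    qed
    show "comm L P" if "bsym L" "comm L T" for L
    proof (rule P(3))
      have "comm L S" using that by (simp add: comm_def S_def bsym_lin)
      with N(4) that(1) show "comm L (\<lambda>x. N x + S x)" by (simp add: comm_def bsym_lin)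
    qed (fact that)
  qed
qed

section \<open>Construction of the projection-valued measure\<close>

lemma comm_shift: "bsym L \<Longrightarrow> comm L T \<Longrightarrow> comm L (\<lambda>x. T x - (a::real) *\<^sub>R x)"
  by (simp add: comm_def bsym_lin)

lemma tendsto_at_right_mono:
  fixes F :: "real \<Rightarrow> real"
  assumes "mono F" "\<And>e. e > 0 \<Longrightarrow> \<exists>b>a. F b < F a + e"
  shows "(F \<longlongrightarrow> F a) (at_right a)"
proof (rule tendstoI)
  fix e :: real assume "e > 0"
  then obtain b where b: "b > a" "F b < F a + e" using assms(2) by blast
  show "\<forall>\<^sub>F x in at_right a. dist (F x) (F a) < e"
    unfolding eventually_at_right_field
  proof (intro exI[of _ b] conjI allI impI)
    fix y assume "a < y" "y < b"
    thus "dist (F y) (F a) < e"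
      using b monoD[OF assms(1), of a y] monoD[OF assms(1), of y b] by (simp add: dist_real_def)
  qed (fact b)
qed

text \<open>For increasing projections, orthogonal partial sums and spectral truncations the squared
  distances are differences of real numbers, the squared norms, whose convergence is easy to get;
  this transfers it to the vectors.\<close>

lemma convergent_of_power2:
  fixes u :: "nat \<Rightarrow> 'a::banach" and a :: "nat \<Rightarrow> real"
  assumes "convergent a" "\<And>m n. m \<le> n \<Longrightarrow> (dist (u m) (u n))\<^sup>2 \<le> \<bar>a m - a n\<bar>"
  shows "convergent u"
  unfolding Cauchy_convergent_iff[symmetric]
proof (rule CauchyI')
  fix e :: real assume e: "e > 0"
  hence "e\<^sup>2 > 0" by simp
  from CauchyD[OF convergent_Cauchy[OF assms(1)] this] obtain k where
    k: "\<And>m n. m \<ge> k \<Longrightarrow> n \<ge> k \<Longrightarrow> \<bar>a m - a n\<bar> < e\<^sup>2" by auto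
  have "dist (u m) (u n) < e" if "m \<ge> k" "n > m" for m n
    using le_less_trans[OF assms(2)[of m n] k[of m n]] that e
    by (auto intro: power2_less_imp_less)
  thus "\<exists>M. \<forall>m\<ge>M. \<forall>n>m. dist (u m) (u n) < e" by blast
qed

lemma oproj_monotone_diff:
  assumes "oproj P" "oproj Q" "\<And>x. P (Q x) = P x"
  shows "(norm (Q x - P x))\<^sup>2 = (norm (Q x))\<^sup>2 - (norm (P x))\<^sup>2"
proof -
  have "rip (Q x) (P x) = rip (P (Q x)) (P x)"
    using assms(1) by (metis bsym_rip oproj_bsym oproj_idem)
  thus ?thesis by (simp add: norm_diff_power2 assms(3) rip_self)
qed

text \<open>What is known of the projections when each is built separately: \<open>le\<close> and
  \<open>ge\<close> compare the form with \<open>a\<close>, \<open>eigen\<close> assigns the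
  eigenvectors for \<open>a\<close> to \<open>P a\<close> and will give right continuity, and
  \<open>commP\<close> relates different values of \<open>a\<close>.\<close>

locale spectral_family =
  fixes T :: "'a::chilbert_space \<Rightarrow> 'a" and P :: "real \<Rightarrow> 'a \<Rightarrow> 'a"
  assumes T: "bsym T" and P: "oproj (P a)"
    and le: "P a x = x \<Longrightarrow> rip x (T x) \<le> a * (norm x)\<^sup>2"
    and ge: "P a x = 0 \<Longrightarrow> rip x (T x) \<ge> a * (norm x)\<^sup>2"
    and eigen: "T x = a *\<^sub>R x \<Longrightarrow> P a x = x"
    and commP: "bsym L \<Longrightarrow> comm L T \<Longrightarrow> comm L (P a)"

lemma spectral_family_exists:
  assumes T: "bsym T" obtains P where "spectral_family T P"
proof -
  have "\<exists>P. oproj P \<and> (\<forall>x. P x = x \<longrightarrow> rip x (T x) \<le> a * (norm x)\<^sup>2) \<and>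
     (\<forall>x. P x = 0 \<longrightarrow> rip x (T x) \<ge> a * (norm x)\<^sup>2) \<and> (\<forall>x. T x = a *\<^sub>R x \<longrightarrow> P x = x) \<and>
     (\<forall>L. bsym L \<longrightarrow> comm L T \<longrightarrow> comm L P)" for a
  proof -
    have b: "bsym (\<lambda>x. T x - a *\<^sub>R x)" by (rule bsym_minus_op[OF T bsym_scale[OF bsym_id]])
    obtain Q where Q: "oproj Q" "\<And>x. Q x = x \<Longrightarrow> rip x (T x - a *\<^sub>R x) \<le> 0"
        "\<And>x. Q x = 0 \<Longrightarrow> rip x (T x - a *\<^sub>R x) \<ge> 0" "\<And>x. T x - a *\<^sub>R x = 0 \<Longrightarrow> Q x = x"
        "\<And>L. bsym L \<Longrightarrow> comm L (\<lambda>x. T x - a *\<^sub>R x) \<Longrightarrow> comm L Q"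
      using negative_projection[OF b] by blast
    have "rip x (T x - a *\<^sub>R x) = rip x (T x) - a * (norm x)\<^sup>2" for x
      by (simp add: rip_simps rip_self)
    with Q show ?thesis by (intro exI[of _ Q]) (auto simp: comm_shift)
  qed
  then obtain P where "\<forall>a. oproj (P a) \<and> (\<forall>x. P a x = x \<longrightarrow> rip x (T x) \<le> a * (norm x)\<^sup>2) \<and>
     (\<forall>x. P a x = 0 \<longrightarrow> rip x (T x) \<ge> a * (norm x)\<^sup>2) \<and> (\<forall>x. T x = a *\<^sub>R x \<longrightarrow> P a x = x) \<and>
     (\<forall>L. bsym L \<longrightarrow> comm L T \<longrightarrow> comm L (P a))" by metis
  thus ?thesis using T by (intro that[of P]) (unfold_locales, auto)
qed

context spectral_family
begin

lemmas lin = bsym_lin[OF T] bsym_lin[OF oproj_bsym[OF P]]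

lemma commT: "comm T (P a)"
  by (rule commP[OF T]) (simp add: comm_def)

lemma commPP: "comm (P a) (P b)"
  by (rule commP[OF oproj_bsym[OF P]]) (use commT in \<open>simp add: comm_def\<close>)

text \<open>A vector \<open>y\<close> in the range of \<open>P a\<close> and in the kernel of
  \<open>P b\<close> has \<open>b * (norm y)^2 \<le> rip y (T y) \<le> a * (norm y)^2\<close>, so it
  vanishes if \<open>a < b\<close>.\<close>

lemma mono_proj: assumes "a \<le> b" shows "P b (P a x) = P a x" "P a (P b x) = P a x"
proof -
  define y where "y = P a x - P b (P a x)"
  have "y = 0" if "a < b"
  proof -
    have "P a y = y" using commPP[of a b] oproj_idem[OF P] by (simp add: y_def lin comm_def)
    from le[OF this] have 1: "rip y (T y) \<le> a * (norm y)\<^sup>2" .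
    have "P b y = 0" using oproj_idem[OF P] by (simp add: y_def lin)
    from ge[OF this] have "b * (norm y)\<^sup>2 \<le> a * (norm y)\<^sup>2" using 1 by simp
    thus "y = 0" using that by (auto simp: mult_le_cancel_right)
  qed
  thus 1: "P b (P a x) = P a x" using assms oproj_idem[OF P, of a x] by (cases "a = b") (auto simp: y_def)
  show "P a (P b x) = P a x" using 1 commPP[of a b] by (simp add: comm_def)
qed

lemma bounds: obtains c where "c > 0" "\<And>a x. a \<le> - c \<Longrightarrow> P a x = 0" "\<And>a x. a \<ge> c \<Longrightarrow> P a x = x"
proof -
  obtain c where c: "c > 0" "\<And>x. norm (T x) \<le> c * norm x" using bsym_bound[OF T] by blast
  have *: "\<bar>rip x (T x)\<bar> \<le> c * (norm x)\<^sup>2" for x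
    using order_trans[OF abs_rip_le mult_left_mono[OF c(2), of "norm x" x]] by (simp add: power2_eq_square ac_simps)
  \<comment> \<open>The additional 1 makes \<open>a + c\<close> negative in the first case and
    \<open>a - c\<close> positive in the second, so that the form inequalities force the norms to
    vanish.\<close>
  show ?thesis
  proof (rule that[of "c + 1"])
    fix a x assume a: "a \<le> - (c + 1)"
    have "P a (P a x) = P a x" by (rule oproj_idem[OF P])
    from le[OF this] *[of "P a x"] have "0 \<le> (a + c) * (norm (P a x))\<^sup>2" by (simp add: algebra_simps)
    thus "P a x = 0" using a by (auto simp: zero_le_mult_iff)
  next
    fix a x assume a: "a \<ge> c + 1"
    have "P a (x - P a x) = 0" by (simp add: lin oproj_idem[OF P])
    from ge[OF this] *[of "x - P a x"] have "(a - c) * (norm (x - P a x))\<^sup>2 \<le> 0" by (simp add: algebra_simps)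
    thus "P a x = x" using a by (auto simp: mult_le_0_iff)
  qed (use c in auto)
qed

definition F :: "'a \<Rightarrow> real \<Rightarrow> real" where "F x a = (norm (P a x))\<^sup>2"

lemma F_diff: "a \<le> b \<Longrightarrow> F x b - F x a = (norm (P b x - P a x))\<^sup>2"
  unfolding F_def by (rule oproj_monotone_diff[symmetric, OF P P]) (rule mono_proj)

lemma mono_F: "mono (F x)"
  by (rule monoI) (metis F_diff diff_ge_0_iff_ge zero_le_power2)

text \<open>On such vectors the form of \<open>T - a\<close> is nonnegative and, letting
  \<open>b\<close> tend to \<open>a\<close>, also nonpositive. The set of these vectors is invariant
  under \<open>T - a\<close>, so the argument of \<open>bsym_zeroI\<close> applies inside it:
  \<open>u\<close> is an eigenvector for \<open>a\<close>, hence fixed by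
  \<open>P a\<close>.\<close>

lemma jump_zero:
  assumes "P a u = 0" "\<And>b. b > a \<Longrightarrow> P b u = u" shows "u = 0"
proof -
  define S where "S x = T x - a *\<^sub>R x" for x
  have S: "bsym S" unfolding S_def by (rule bsym_minus_op[OF T bsym_scale[OF bsym_id]])
  have cS: "P b (S x) = S (P b x)" for b x using commT[of b] by (simp add: S_def lin comm_def)
  have form: "rip v (S v) = 0" if v: "P a v = 0" "\<And>b. b > a \<Longrightarrow> P b v = v" for v
  proof -
    have "rip v (T v) \<le> a * (norm v)\<^sup>2"
    proof (rule tendsto_lowerbound)
      show "((\<lambda>b. b * (norm v)\<^sup>2) \<longlongrightarrow> a * (norm v)\<^sup>2) (at_right a)" by (intro tendsto_intros)
      show "\<forall>\<^sub>F b in at_right a. rip v (T v) \<le> b * (norm v)\<^sup>2"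
        unfolding eventually_at_right_field by (intro exI[of _ "a + 1"]) (use le v(2) in auto)
    qed simp
    with ge[OF v(1)] show ?thesis by (simp add: S_def rip_simps rip_self)
  qed
  have "rip (u + S u) (S (u + S u)) = 0"
    by (rule form) (use assms in \<open>simp_all add: lin cS bsym_lin[OF S]\<close>)
  moreover have "rip (S u) (S (S u)) = 0" "rip u (S u) = 0"
    by (rule form; use assms in \<open>simp add: lin cS bsym_lin[OF S]\<close>)+
  ultimately have "rip (S u) (S u) = 0"
    by (simp add: rip_simps bsym_lin[OF S] bsym_rip[OF S, symmetric])
  hence "T u = a *\<^sub>R u" by (simp add: rip_self S_def)
  from eigen[OF this] assms(1) show "u = 0" by simp
qed

lemma right_cont_F: "continuous (at_right a) (F x)"
  unfolding continuous_within
proof (rule tendsto_at_right_mono[OF mono_F])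
  fix e :: real assume e: "e > 0"
  define s where "s n = a + inverse (real (Suc n))" for n
  have s: "s n > a" "m \<le> n \<Longrightarrow> s n \<le> s m" for m n by (auto simp: s_def le_imp_inverse_le)
  have s_lim: "s \<longlonglongrightarrow> a + 0" unfolding s_def by (intro tendsto_intros LIMSEQ_inverse_real_of_nat)
  have "decseq (\<lambda>n. F x (s n))" by (auto simp: decseq_def intro: monoD[OF mono_F] s)
  from decseq_convergent[OF this, of 0] have "convergent (\<lambda>n. F x (s n))"
    by (auto simp: F_def convergent_def)
  hence "convergent (\<lambda>n. P (s n) x)"
    by (rule convergent_of_power2) (metis F_diff s(2) dist_norm order_refl abs_ge_self)
  then obtain q where q: "(\<lambda>n. P (s n) x) \<longlonglongrightarrow> q" by (auto simp: convergent_def)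
  \<comment> \<open>The defect of the right limit lies above \<open>a\<close> but below every
    \<open>b > a\<close>, which is the situation of \<open>jump_zero\<close>.\<close>
  have "q - P a x = 0"
  proof (rule jump_zero)
    have "(\<lambda>n. P a (P (s n) x)) \<longlonglongrightarrow> P a q" by (rule bsym_tendsto[OF oproj_bsym[OF P] q])
    moreover have "(\<lambda>n. P a (P (s n) x)) = (\<lambda>n. P a x)" using mono_proj(2)[OF less_imp_le[OF s(1)]] by auto
    ultimately have "P a q = P a x" using LIMSEQ_unique tendsto_const by metis
    thus "P a (q - P a x) = 0" by (simp add: lin oproj_idem[OF P])
    fix b assume b: "b > a"
    have "\<forall>\<^sub>F n in sequentially. s n < b" using order_tendstoD(2)[OF s_lim, of b] b by simp
    hence "\<forall>\<^sub>F n in sequentially. P b (P (s n) x) = P (s n) x"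
      by eventually_elim (simp add: mono_proj)
    hence "(\<lambda>n. P b (P (s n) x)) \<longlonglongrightarrow> q" using q by (simp add: tendsto_cong)
    moreover have "(\<lambda>n. P b (P (s n) x)) \<longlonglongrightarrow> P b q" by (rule bsym_tendsto[OF oproj_bsym[OF P] q])
    ultimately have "P b q = q" using LIMSEQ_unique by metis
    thus "P b (q - P a x) = q - P a x" using b mono_proj(1)[of a b x] by (simp add: lin)
  qed
  hence "(\<lambda>n. F x (s n)) \<longlonglongrightarrow> F x a" unfolding F_def using q by (intro tendsto_intros) auto
  from order_tendstoD(2)[OF this, of "F x a + e"] e obtain n where "F x (s n) < F x a + e"
    by (auto simp: eventually_sequentially)
  thus "\<exists>b>a. F x b < F x a + e" using s(1) by blast
qed

lemma emeasure_F: 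
  "emeasure (interval_measure (F x)) {..a} = ennreal ((norm (P a x))\<^sup>2)"
  "emeasure (interval_measure (F x)) UNIV = ennreal ((norm x)\<^sup>2)"
proof -
  obtain c where c: "c > 0" "\<And>a x. a \<le> - c \<Longrightarrow> P a x = 0" "\<And>a x. a \<ge> c \<Longrightarrow> P a x = x" using bounds by blast
  have Ioc: "emeasure (interval_measure (F x)) {a<..b} = (if a \<le> b then F x b - F x a else 0)" for a b
    by (rule emeasure_interval_measure_Ioc_eq) (use mono_F right_cont_F in \<open>auto simp: mono_def\<close>)
  \<comment> \<open>\<open>F x\<close> vanishes below \<open>- c\<close>, so the masses of the
    approximating half-open intervals are eventually constant and no limit of \<open>F x\<close> has
    to be computed.\<close>
  have *: "emeasure (interval_measure (F x)) (\<Union>n. {- real n<..b n}) = ennreal l"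
    if b: "\<And>m n. m \<le> n \<Longrightarrow> b m \<le> b n" "\<And>n. n \<ge> k \<Longrightarrow> F x (b n) = l" "\<And>n. n \<ge> k \<Longrightarrow> b n \<ge> - real n" for b k l
  proof (rule LIMSEQ_unique)
    show "(\<lambda>n. emeasure (interval_measure (F x)) {- real n<..b n}) \<longlonglongrightarrow> 
        emeasure (interval_measure (F x)) (\<Union>n. {- real n<..b n})"
      by (rule Lim_emeasure_incseq) (auto simp: incseq_def intro: order_trans[OF _ b(1)])
    obtain K where K: "real K \<ge> c" using real_arch_simple by blast
    have "emeasure (interval_measure (F x)) {- real n<..b n} = ennreal l" if "n \<ge> max k K" for n
    proof -
      have "F x (- real n) = 0" unfolding F_def using c(2)[of "- real n" x] K that by simp
      thus ?thesis using that b by (simp add: Ioc)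
    qed
    hence "\<forall>\<^sub>F n in sequentially. emeasure (interval_measure (F x)) {- real n<..b n} = ennreal l"
      unfolding eventually_sequentially by blast
    thus "(\<lambda>n. emeasure (interval_measure (F x)) {- real n<..b n}) \<longlonglongrightarrow> ennreal l"
      by (rule tendsto_eventually)
  qed
  obtain k where k: "real k \<ge> \<bar>a\<bar>" using real_arch_simple by blast
  have "(\<Union>n. {- real n<..a}) = {..a}" by (auto, metis minus_less_iff reals_Archimedean2)
  moreover have "emeasure (interval_measure (F x)) (\<Union>n. {- real n<..a}) = ennreal (F x a)"
    by (rule *[of _ k]) (use k in auto)
  ultimately show "emeasure (interval_measure (F x)) {..a} = ennreal ((norm (P a x))\<^sup>2)" by (simp add: F_def)
  obtain k where k: "real k \<ge> c" using real_arch_simple by blast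
  have "(\<Union>n. {- real n<..real n}) = UNIV"
  proof -
    have "\<exists>n. - real n < y \<and> y \<le> real n" for y
    proof -
      obtain n where "\<bar>y\<bar> < real n" using reals_Archimedean2 by blast
      thus ?thesis by (intro exI[of _ n]) auto
    qed
    thus ?thesis by auto
  qed
  moreover have "emeasure (interval_measure (F x)) (\<Union>n. {- real n<..real n}) = ennreal ((norm x)\<^sup>2)"
    by (rule *[of _ k]) (use k in \<open>auto simp: F_def c(3)\<close>)
  ultimately show "emeasure (interval_measure (F x)) UNIV = ennreal ((norm x)\<^sup>2)" by simp
qed

end

text \<open>At the vector \<open>Q x\<close> the hypothesis leaves no mass for
  \<open>P (Q x)\<close>.\<close>

lemma oproj_orthogonal:
  assumes "oproj P" "oproj Q" "\<And>x. (norm (P x))\<^sup>2 + (norm (Q x))\<^sup>2 \<le> (norm x)\<^sup>2"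
  shows "P (Q x) = 0"
  using assms(3)[of "Q x"] by (simp add: oproj_idem[OF assms(2)])

text \<open>The partial sums \<open>S n\<close> are projections that increase with \<open>n\<close>,
  so their bounded squared norms force strong convergence. Passing to the limit in
  \<open>S m (S n x) = S m x\<close> gives idempotence of the sum.\<close>

lemma oproj_sum:
  assumes Q: "\<And>i. oproj (Q i)" and orth: "\<And>i j x. i \<noteq> j \<Longrightarrow> Q i (Q j x) = 0"
  obtains P where "oproj P" "\<And>x. (\<lambda>n::nat. Q n x) sums P x" "\<And>x. (\<lambda>n. (norm (Q n x))\<^sup>2) sums (norm (P x))\<^sup>2"
proof -
  define S where "S n x = (\<Sum>i<n. Q i x)" for n x
  have S_Suc: "S (Suc n) = (\<lambda>x. S n x + Q n x)" for n by (auto simp: S_def)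
  have bS: "bsym (S n)" for n
    by (induction n) (simp_all add: S_Suc bsym_plus oproj_bsym Q, simp add: S_def bsym_const_zero)
  have SQ: "S m (Q n x) = (if n < m then Q n x else 0)" for m n x
    by (induction m) (auto simp: S_Suc orth oproj_idem[OF Q] less_Suc_eq, simp add: S_def)
  have SS: "S m (S n x) = S (min m n) x" for m n x
  proof (induction n)
    case 0 thus ?case by (simp add: S_def bsym_zero[OF bS, unfolded S_def])
  next
    case (Suc n)
    thus ?case by (cases "n < m") (simp_all add: S_Suc bsym_lin[OF bS] SQ min_absorb1 min_absorb2 not_less)
  qed
  have oS: "oproj (S n)" for n by (simp add: orthogonal_projection_iff bS SS)
  have nS: "(norm (S n x))\<^sup>2 = (\<Sum>i<n. (norm (Q i x))\<^sup>2)" for n x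
  proof (induction n)
    case (Suc n)
    thus ?case by (simp add: S_Suc norm_add_power2 bsym_rip[OF bS] SQ)
  qed (simp add: S_def)
  have summable: "summable (\<lambda>i. (norm (Q i x))\<^sup>2)" for x
    by (rule summableI_nonneg_bounded[of _ "(norm x)\<^sup>2"])
       (auto simp flip: nS intro!: power_mono oproj_norm_le[OF oS])
  hence lim: "(\<lambda>n. (norm (S n x))\<^sup>2) \<longlonglongrightarrow> (\<Sum>i. (norm (Q i x))\<^sup>2)" for x
    unfolding nS by (rule summable_LIMSEQ)
  have conv: "convergent (\<lambda>n. S n x)" for x
  proof (rule convergent_of_power2)
    show "convergent (\<lambda>n. (norm (S n x))\<^sup>2)" using lim by (rule convergentI)
    show "(dist (S m x) (S n x))\<^sup>2 \<le> \<bar>(norm (S m x))\<^sup>2 - (norm (S n x))\<^sup>2\<bar>" if "m \<le> n" for m n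
      using oproj_monotone_diff[OF oS oS, of m n x] that
      by (simp add: SS dist_norm norm_minus_commute)
  qed
  define P where "P x = lim (\<lambda>n. S n x)" for x
  have P: "(\<lambda>n. S n x) \<longlonglongrightarrow> P x" for x
    unfolding P_def using conv convergent_LIMSEQ_iff by blast
  have SP: "S m (P x) = S m x" for m x
  proof (rule LIMSEQ_unique)
    show "(\<lambda>n. S m (S n x)) \<longlonglongrightarrow> S m (P x)" by (rule bsym_tendsto[OF bS P])
    show "(\<lambda>n. S m (S n x)) \<longlonglongrightarrow> S m x"
      by (rule tendsto_eventually) (auto simp: SS eventually_sequentially intro!: exI[of _ m])
  qed
  show ?thesis
  proof (rule that)
    have "bsym P" by (rule bsym_lim[OF bS _ P, of 1]) (simp add: oproj_norm_le[OF oS])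
    moreover have "P (P x) = P x" for x
      using P[of "P x"] P[of x] by (simp add: SP LIMSEQ_unique)
    ultimately show "oproj P" by (simp add: orthogonal_projection_iff)
    show "(\<lambda>n. Q n x) sums P x" for x using P[of x] by (simp add: sums_def S_def)
    show "(\<lambda>n. (norm (Q n x))\<^sup>2) sums (norm (P x))\<^sup>2" for x
      unfolding sums_def nS[symmetric] by (intro tendsto_intros P)
  qed
qed

text \<open>A set is good if some projection has its measures as squared norms. Orthogonality comes
  from additivity of the measures, and \<open>oproj_eqI\<close> makes the projection of a good set
  unique, so the values chosen set by set fit together.\<close>

theorem pvm_extension:
  fixes m :: "'a::chilbert_space \<Rightarrow> real measure"
  assumes sets: "\<And>x. sets (m x) = sets borel"
    and space: "\<And>x. emeasure (m x) UNIV = ennreal ((norm x)\<^sup>2)"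
    and P: "\<And>a. oproj (P a)" "\<And>x a. emeasure (m x) {..a} = ennreal ((norm (P a x))\<^sup>2)"
  obtains E where "projection_valued_measure E" "\<And>a. E {..a} = P a"
proof -
  define good where "good S Q \<longleftrightarrow> oproj Q \<and> (\<forall>x. emeasure (m x) S = ennreal ((norm (Q x))\<^sup>2))" for S Q
  have spc: "space (m x) = UNIV" for x using sets_eq_imp_space_eq[OF sets] by simp
  have union_ex: "\<exists>P. good (\<Union>i. D i) P \<and> (\<forall>x. (\<lambda>n. Q n x) sums P x)"
    if "disjoint_family D" "range D \<subseteq> sets borel" "\<And>i. good (D i) (Q i)" for D :: "nat \<Rightarrow> real set" and Q
  proof -
    have Q: "oproj (Q i)" "emeasure (m x) (D i) = ennreal ((norm (Q i x))\<^sup>2)" for i x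
      using that(3) by (auto simp: good_def)
    have "Q i (Q j x) = 0" if ij: "i \<noteq> j" for i j x
    proof (rule oproj_orthogonal[OF Q(1) Q(1)])
      fix x
      have "ennreal ((norm (Q i x))\<^sup>2 + (norm (Q j x))\<^sup>2) = emeasure (m x) (D i) + emeasure (m x) (D j)"
        by (simp add: Q(2))
      also have "\<dots> = emeasure (m x) (D i \<union> D j)"
        using \<open>disjoint_family D\<close> \<open>range D \<subseteq> sets borel\<close> ij
        by (intro plus_emeasure) (auto simp: sets disjoint_family_on_def)
      also have "\<dots> \<le> emeasure (m x) UNIV" by (rule emeasure_mono) (auto simp: sets)
      finally show "(norm (Q i x))\<^sup>2 + (norm (Q j x))\<^sup>2 \<le> (norm x)\<^sup>2"
        by (simp add: space ennreal_plus[symmetric] del: ennreal_plus)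
    qed
    with oproj_sum[of Q] Q(1) obtain P where P: "oproj P" "\<And>x. (\<lambda>n. Q n x) sums P x"
        "\<And>x. (\<lambda>n. (norm (Q n x))\<^sup>2) sums (norm (P x))\<^sup>2" by metis
    have "emeasure (m x) (\<Union>i. D i) = ennreal ((norm (P x))\<^sup>2)" for x
    proof -
      have "emeasure (m x) (\<Union>i. D i) = (\<Sum>i. emeasure (m x) (D i))"
        using that by (intro suminf_emeasure[symmetric]) (auto simp: sets)
      also have "\<dots> = ennreal ((norm (P x))\<^sup>2)"
        unfolding Q(2) by (rule suminf_ennreal_eq[OF _ P(3)]) simp
      finally show ?thesis .
    qed
    with P show ?thesis by (auto simp: good_def)
  qed
  have ex: "\<exists>Q. good S Q" if "S \<in> sets borel" for S
  proof -
    let ?G = "range (\<lambda>a::real. {..a})"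
    have G: "Int_stable ?G" "?G \<subseteq> Pow UNIV" by (auto simp: Int_stable_def)
    have sb: "sigma_sets UNIV ?G = sets borel" by (subst borel_eq_atMost) simp
    from that have "S \<in> sigma_sets UNIV ?G" by (simp add: sb)
    from G this show ?thesis
    proof (induction S rule: sigma_sets_induct_disjoint)
      case (basic A) thus ?case using P by (auto simp: good_def)
    next
      case empty show ?case
        by (rule exI[of _ "\<lambda>x. 0"]) (auto simp: good_def orthogonal_projection_iff bsym_const_zero)
    next
      case (compl A)
      then obtain Q where Q: "good A Q" by blast
      have "emeasure (m x) (UNIV - A) = ennreal ((norm (x - Q x))\<^sup>2)" for x
      proof -
        have "emeasure (m x) (UNIV - A) = emeasure (m x) UNIV - emeasure (m x) A"
          using compl(1) Q emeasure_compl[of A "m x"] by (simp add: spc sb sets good_def)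
        thus ?thesis using Q by (simp add: good_def space oproj_compl_norm ennreal_minus)
      qed
      thus ?case using Q by (intro exI[of _ "\<lambda>x. x - Q x"]) (auto simp: good_def oproj_compl)
    next
      case (union A)
      then obtain Q where "\<And>i. good (A i) (Q i)" by metis
      with union(1,2) union_ex[of A Q] show ?case by (auto simp: sb)
    qed
  qed
  define E where "E S = (SOME Q. good S Q)" for S
  have E: "good S (E S)" if "S \<in> sets borel" for S
    unfolding E_def using ex[OF that] by (rule someI_ex)
  have uniq: "Q = E S" if "S \<in> sets borel" "good S Q" for S Q
    using E[OF that(1)] that(2) by (intro oproj_eqI) (auto simp: good_def)
  show ?thesis
  proof (rule that)
    show "projection_valued_measure E"
      unfolding projection_valued_measure_def
    proof (intro conjI ballI allI impI)
      show "oproj (E S)" if "S \<in> sets borel" for S using E[OF that] by (simp add: good_def)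
      have "good UNIV id" by (auto simp: good_def space orthogonal_projection_iff id_def bsym_id)
      thus "E UNIV = id" by (intro uniq[symmetric]) auto
      fix F :: "nat \<Rightarrow> real set" and x
      assume F: "range F \<subseteq> sets borel" "disjoint_family F"
      have "\<And>i. good (F i) (E (F i))" using F(1) E by auto
      from union_ex[OF F(2,1) this] obtain Q where Q: "good (\<Union>i. F i) Q" "\<And>x. (\<lambda>n. E (F n) x) sums Q x" by blast
      have "Q = E (\<Union>i. F i)" using F(1) by (intro uniq Q) auto
      thus "(\<lambda>n. E (F n) x) sums E (\<Union>n. F n) x" using Q by simp
    qed
    show "E {..a} = P a" for a using P by (intro uniq[symmetric]) (auto simp: good_def)
  qed
qed

theorem (in spectral_family) pvm:
  obtains E where "projection_valued_measure E" "\<And>a. E {..a} = P a"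
  by (rule pvm_extension[of "\<lambda>x. interval_measure (F x)" P]) (auto simp: emeasure_F P)

section \<open>Bounded functional calculus\<close>

lemma bounded_linear_rip: "bounded_linear (rip x)"
  using bounded_linear_compose[OF bounded_linear_Re bounded_bilinear.bounded_linear_right[OF bounded_bilinear_cinner]]
  by (simp add: rip_def[abs_def])

section \<open>Bounded Borel functions on the line\<close>

definition bdd_borel :: "(real \<Rightarrow> real) \<Rightarrow> bool" where
  "bdd_borel g \<longleftrightarrow> g \<in> borel_measurable borel \<and> (\<exists>c. \<forall>t. \<bar>g t\<bar> \<le> c)"

lemma bdd_borelI: "g \<in> borel_measurable borel \<Longrightarrow> (\<And>t. \<bar>g t\<bar> \<le> c) \<Longrightarrow> bdd_borel g"
  by (auto simp: bdd_borel_def)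

lemma bdd_borel_meas [measurable_dest]: "bdd_borel g \<Longrightarrow> g \<in> borel_measurable borel"
  by (simp add: bdd_borel_def)

lemma bdd_borel_bound: assumes "bdd_borel g" obtains c where "c > 0" "\<And>t. \<bar>g t\<bar> \<le> c"
proof -
  from assms obtain c where c: "\<And>t. \<bar>g t\<bar> \<le> c" by (auto simp: bdd_borel_def)
  show ?thesis by (rule that[of "\<bar>c\<bar> + 1"]) (auto intro: order_trans[OF c])
qed

lemma bdd_borel_unit:
  assumes "g \<in> borel_measurable borel" "\<And>t. 0 \<le> g t" "\<And>t. g t < 1" shows "bdd_borel g"
proof (rule bdd_borelI[OF assms(1)])
  show "\<bar>g t\<bar> \<le> 1" for t using assms(2,3)[of t] by simp
qed

lemma bdd_borel_add: assumes "bdd_borel g" "bdd_borel h" shows "bdd_borel (\<lambda>t. g t + h t)"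
proof -
  obtain c d where "\<And>t. \<bar>g t\<bar> \<le> c" "\<And>t. \<bar>h t\<bar> \<le> d" using assms by (meson bdd_borel_bound)
  moreover have "(\<lambda>t. g t + h t) \<in> borel_measurable borel" using assms by measurable
  ultimately show ?thesis by (intro bdd_borelI[of _ "c + d"]) (auto intro: order_trans[OF abs_triangle_ineq] add_mono)
qed

lemma bdd_borel_mult: assumes "bdd_borel g" "bdd_borel h" shows "bdd_borel (\<lambda>t. g t * h t)"
proof -
  obtain c d where "c > 0" "d > 0" "\<And>t. \<bar>g t\<bar> \<le> c" "\<And>t. \<bar>h t\<bar> \<le> d" using assms by (meson bdd_borel_bound)
  moreover have "(\<lambda>t. g t * h t) \<in> borel_measurable borel" using assms by measurable
  ultimately show ?thesis by (intro bdd_borelI[of _ "c * d"]) (auto simp: abs_mult intro!: mult_mono)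
qed

lemma bdd_borel_const: "bdd_borel (\<lambda>t. c)" by (rule bdd_borelI[of _ "\<bar>c\<bar>"]) auto

lemma bdd_borel_cmult: "bdd_borel g \<Longrightarrow> bdd_borel (\<lambda>t. c * g t)"
  by (intro bdd_borel_mult bdd_borel_const)

lemma bdd_borel_diff: "bdd_borel g \<Longrightarrow> bdd_borel h \<Longrightarrow> bdd_borel (\<lambda>t. g t - h t)"
  using bdd_borel_add[OF _ bdd_borel_cmult[of h "-1"], of g] by simp

lemma bdd_borel_power2: "bdd_borel g \<Longrightarrow> bdd_borel (\<lambda>t. (g t)\<^sup>2)"
  unfolding power2_eq_square by (rule bdd_borel_mult)

lemma bdd_borel_indicator: "S \<in> sets borel \<Longrightarrow> bdd_borel (indicator S)"
  by (rule bdd_borelI[of _ 1]) (auto simp: indicator_def)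

text \<open>Binary digits write a function with values in \<open>[0, 1)\<close> as a series \<open>\<Sum>j. 2 ^ -(j + 1) * indicator (D j)\<close>, which
  turns into a norm convergent series of projections.\<close>

definition bit_set :: "(real \<Rightarrow> real) \<Rightarrow> nat \<Rightarrow> real set" where
  "bit_set h j = {t. odd \<lfloor>2 ^ Suc j * h t\<rfloor>}"

definition bit_sum :: "(real \<Rightarrow> real) \<Rightarrow> nat \<Rightarrow> real \<Rightarrow> real" where
  "bit_sum h n t = (\<Sum>j<n. (1/2) ^ Suc j * indicator (bit_set h j) t)"

lemma bit_set_borel:
  assumes [measurable]: "h \<in> borel_measurable borel" shows "bit_set h j \<in> sets borel"
proof -
  have "(\<lambda>t. \<lfloor>2 ^ Suc j * h t\<rfloor>) \<in> borel \<rightarrow>\<^sub>M count_space UNIV" by measurable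
  from measurable_sets[OF this, of "{k. odd k}"] show ?thesis by (simp add: bit_set_def vimage_def)
qed

text \<open>In the induction step \<open>2 ^ n * h t\<close> is half of \<open>a\<close>, so its
  floor is the floor of \<open>a\<close> without the last binary digit, and that digit is recorded
  by membership in \<open>bit_set h n\<close>.\<close>

lemma bit_sum_eq:
  assumes "0 \<le> h t" "h t < 1" shows "bit_sum h n t = \<lfloor>2 ^ n * h t\<rfloor> / 2 ^ n"
proof (induction n)
  case 0
  have "\<lfloor>h t\<rfloor> = 0" using assms by (simp add: floor_eq_iff)
  thus ?case by (simp add: bit_sum_def)
next
  case (Suc n)
  define a where "a = 2 ^ Suc n * h t"
  have "\<lfloor>2 ^ n * h t\<rfloor> = \<lfloor>a / of_int 2\<rfloor>" by (simp add: a_def)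
  also have "\<dots> = \<lfloor>a\<rfloor> div 2" by (rule floor_divide_real_eq_div) simp
  finally have *: "\<lfloor>2 ^ n * h t\<rfloor> = \<lfloor>a\<rfloor> div 2" .
  have "real_of_int k = 2 * real_of_int (k div 2) + (if odd k then 1 else 0)" for k
    by (cases "odd k") (auto elim!: oddE evenE)
  from this[of "\<lfloor>a\<rfloor>"]
  have "real_of_int \<lfloor>a\<rfloor> = 2 * real_of_int (\<lfloor>a\<rfloor> div 2) + (if odd \<lfloor>a\<rfloor> then 1 else 0)" .
  moreover have "bit_sum h (Suc n) t = bit_sum h n t + (1/2) ^ Suc n * (if odd \<lfloor>a\<rfloor> then 1 else 0)"
    by (simp add: bit_sum_def bit_set_def a_def indicator_def)
  ultimately show ?case unfolding Suc * a_def[symmetric]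
    by (simp only: add_divide_distrib power_one_over) simp
qed

lemma bit_sum_tendsto:
  assumes "0 \<le> h t" "h t < 1" shows "(\<lambda>n. bit_sum h n t) \<longlonglongrightarrow> h t"
proof -
  have "norm (h t - bit_sum h n t) \<le> (1/2) ^ n" for n
  proof -
    have "\<bar>2 ^ n * h t - \<lfloor>2 ^ n * h t\<rfloor>\<bar> \<le> 1" by linarith
    hence "\<bar>2 ^ n * h t - \<lfloor>2 ^ n * h t\<rfloor>\<bar> / 2 ^ n \<le> 1 / 2 ^ n" by (rule divide_right_mono) simp
    moreover have "\<bar>2 ^ n * h t - \<lfloor>2 ^ n * h t\<rfloor>\<bar> / 2 ^ n = \<bar>h t - \<lfloor>2 ^ n * h t\<rfloor> / 2 ^ n\<bar>"
    proof -
      have "h t - \<lfloor>2 ^ n * h t\<rfloor> / 2 ^ n = (2 ^ n * h t - \<lfloor>2 ^ n * h t\<rfloor>) / 2 ^ n" by (simp add: field_simps)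
      thus ?thesis by (simp only: abs_divide) simp
    qed
    ultimately show ?thesis by (simp add: bit_sum_eq[of h t, OF assms] power_divide)
  qed
  hence "(\<lambda>n. h t - bit_sum h n t) \<longlonglongrightarrow> 0"
    by (intro Lim_null_comparison[OF _ LIMSEQ_realpow_zero[of "1/2"]]) auto
  from tendsto_diff[OF tendsto_const[of "h t"] this] show ?thesis by simp
qed

lemma sum_half_le: "(\<Sum>j<n. (1/2::real) ^ Suc j) \<le> 1"
proof -
  have "(\<Sum>j<n. (1/2::real) ^ Suc j) = 1 - (1/2) ^ n" by (induction n) auto
  thus ?thesis by simp
qed

lemma bit_sum_abs_le: "\<bar>bit_sum h n t\<bar> \<le> 1"
proof -
  have "\<bar>bit_sum h n t\<bar> \<le> (\<Sum>j<n. \<bar>(1/2) ^ Suc j * indicator (bit_set h j) t\<bar>)"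
    unfolding bit_sum_def by (rule sum_abs)
  also have "\<dots> \<le> (\<Sum>j<n. (1/2) ^ Suc j)" by (rule sum_mono) (auto simp: indicator_def)
  finally show ?thesis using sum_half_le[of n] by simp
qed

lemma bit_sum_borel: "h \<in> borel_measurable borel \<Longrightarrow> bit_sum h n \<in> borel_measurable borel"
  unfolding bit_sum_def[abs_def] using bit_set_borel[of h] by (auto intro!: borel_measurable_sum borel_measurable_times)

locale pvm =
  fixes E :: "real set \<Rightarrow> 'a::chilbert_space \<Rightarrow> 'a"
  assumes pvm: "projection_valued_measure E"
begin

lemma E: "S \<in> sets borel \<Longrightarrow> oproj (E S)"
  using pvm by (simp add: projection_valued_measure_def)

lemma E_UNIV: "E UNIV x = x"
  using pvm by (simp add: projection_valued_measure_def)

lemma E_sums: "range F \<subseteq> sets borel \<Longrightarrow> disjoint_family F \<Longrightarrow> (\<lambda>n::nat. E (F n) x) sums E (\<Union>n. F n) x"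
  using pvm unfolding projection_valued_measure_def by blast

text \<open>Countable additivity on the constant empty family makes a constant series converge, so
  its term is 0.\<close>

lemma E_empty: "E {} x = 0"
proof -
  have "(\<lambda>n::nat. E {} x) sums E {} x" using E_sums[of "\<lambda>_. {}"] by (simp add: disjoint_family_on_def)
  hence "summable (\<lambda>n::nat. E {} x)" by (rule sums_summable)
  thus ?thesis by (simp add: summable_const_iff)
qed

section \<open>The scalar measures of a projection-valued measure\<close>

abbreviation "\<mu> \<equiv> scalar_measure E"

lemma sets_mu [simp, measurable_cong]: "sets (\<mu> x) = sets borel"
  unfolding scalar_measure_def by (simp add: sets.sigma_sets_eq[of borel, simplified])

lemma space_mu [simp]: "space (\<mu> x) = UNIV"
  using sets_eq_imp_space_eq[OF sets_mu] by simp

text \<open>\<open>measure_of\<close> returns the intended values once the set function is known to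
  be countably additive. For squared norms this follows from the strong series by taking the inner
  product with \<open>x\<close>, since \<open>rip x (E S x)\<close> is the squared norm.\<close>

lemma emeasure_mu: assumes "S \<in> sets borel" shows "emeasure (\<mu> x) S = ennreal ((norm (E S x))\<^sup>2)"
  unfolding scalar_measure_def
proof (rule emeasure_measure_of_sigma)
  show "sigma_algebra UNIV (sets (borel :: real measure))" using sets.sigma_algebra_axioms[of borel] by simp
  show "positive (sets borel) (\<lambda>S. ennreal ((norm (E S x))\<^sup>2))" by (simp add: positive_def E_empty)
  show "countably_additive (sets borel) (\<lambda>S. ennreal ((norm (E S x))\<^sup>2))"
    unfolding countably_additive_def
  proof (intro allI impI)
    fix F :: "nat \<Rightarrow> real set" assume F: "range F \<subseteq> sets borel" "disjoint_family F" "\<Union> (range F) \<in> sets borel"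
    from bounded_linear.sums[OF bounded_linear_rip E_sums[OF F(1,2), of x], of x]
    have "(\<lambda>n. (norm (E (F n) x))\<^sup>2) sums (norm (E (\<Union> (range F)) x))\<^sup>2"
      using F E by (simp add: oproj_rip image_subset_iff)
    thus "(\<Sum>i. ennreal ((norm (E (F i) x))\<^sup>2)) = ennreal ((norm (E (\<Union> (range F)) x))\<^sup>2)"
      by (intro suminf_ennreal_eq) auto
  qed
qed fact

lemma measure_mu: "S \<in> sets borel \<Longrightarrow> measure (\<mu> x) S = (norm (E S x))\<^sup>2"
  by (simp add: measure_def emeasure_mu)

lemma finite_mu: "finite_measure (\<mu> x)"
  by (rule finite_measureI) (simp add: emeasure_mu E_UNIV)

lemma E_add:
  assumes "S \<in> sets borel" "T \<in> sets borel" "S \<inter> T = {}" shows "E (S \<union> T) = (\<lambda>x. E S x + E T x)"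
proof (rule bsym_eqI)
  show "bsym (E (S \<union> T))" using assms by (intro oproj_bsym E) auto
  show "bsym (\<lambda>x. E S x + E T x)" by (rule bsym_plus[OF oproj_bsym[OF E] oproj_bsym[OF E]]) fact+
  fix x show "rip x (E (S \<union> T) x) = rip x (E S x + E T x)"
    using finite_measure.finite_measure_Union[OF finite_mu, of S x T] assms
    by (simp add: rip_add_right oproj_rip E measure_mu)
qed

lemma E_disjoint:
  assumes "S \<in> sets borel" "T \<in> sets borel" "S \<inter> T = {}" shows "E S (E T x) = 0"
proof (rule oproj_orthogonal[OF E E])
  fix x
  have "(norm (E S x))\<^sup>2 + (norm (E T x))\<^sup>2 = (norm (E (S \<union> T) x))\<^sup>2"
    using finite_measure.finite_measure_Union[OF finite_mu, of S x T] assms by (simp add: measure_mu)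
  also have "\<dots> \<le> (norm x)\<^sup>2" using assms by (intro power_mono oproj_norm_le E) auto
  finally show "(norm (E S x))\<^sup>2 + (norm (E T x))\<^sup>2 \<le> (norm x)\<^sup>2" .
qed (use assms in auto)

lemma E_Int:
  assumes [measurable]: "S \<in> sets borel" "T \<in> sets borel" shows "E (S \<inter> T) x = E S (E T x)"
proof -
  have S: "E S y = E (S \<inter> T) y + E (S - T) y" for y
    using E_add[of "S \<inter> T" "S - T"] by (simp add: Int_Diff_Un Int_Diff_disjoint)
  have "(S \<inter> T) \<union> (T - S) = T" "(S \<inter> T) \<inter> (T - S) = {}" by auto
  hence T: "E T x = E (S \<inter> T) x + E (T - S) x"
    using E_add[of "S \<inter> T" "T - S"] by simp
  have "E S (E T x) = E S (E (S \<inter> T) x) + E S (E (T - S) x)"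
    by (subst T) (simp add: bsym_lin[OF oproj_bsym[OF E]])
  also have "E S (E (T - S) x) = 0" by (intro E_disjoint) auto
  also have "E S (E (S \<inter> T) x) = E (S \<inter> T) x"
    unfolding S[of "E (S \<inter> T) x"] by (subst E_disjoint[of "S - T"]) (auto simp: oproj_idem[OF E])
  finally show ?thesis by simp
qed

lemma comm_E: "S \<in> sets borel \<Longrightarrow> T \<in> sets borel \<Longrightarrow> comm (E S) (E T)"
  unfolding comm_def by (metis E_Int inf_commute)

lemma mu_E:
  assumes [measurable]: "T \<in> sets borel"
  shows "\<mu> (E T x) = density (\<mu> x) (\<lambda>t. ennreal (indicator T t))"
proof (rule measure_eqI)
  fix S assume "S \<in> sets (\<mu> (E T x))"
  hence [measurable]: "S \<in> sets borel" by simp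
  have "emeasure (density (\<mu> x) (\<lambda>t. ennreal (indicator T t))) S = (\<integral>\<^sup>+t. ennreal (indicator T t) * indicator S t \<partial>\<mu> x)"
    by (rule emeasure_density) simp_all
  also have "\<dots> = (\<integral>\<^sup>+t. indicator (S \<inter> T) t \<partial>\<mu> x)"
    by (rule nn_integral_cong) (simp split: split_indicator)
  also have "\<dots> = ennreal ((norm (E (S \<inter> T) x))\<^sup>2)" by (simp add: emeasure_mu)
  finally show "emeasure (\<mu> (E T x)) S = emeasure (density (\<mu> x) (\<lambda>t. ennreal (indicator T t))) S"
    by (simp add: emeasure_mu E_Int)
qed simp

lemma integrable_bdd: assumes "bdd_borel g" shows "integrable (\<mu> x) g"
proof -
  obtain c where "\<And>t. \<bar>g t\<bar> \<le> c" using assms by (meson bdd_borel_bound)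
  thus ?thesis using bdd_borel_meas[OF assms]
    by (intro finite_measure.integrable_const_bound[OF finite_mu, of _ c]) auto
qed

lemma integral_tendsto:
  assumes "\<And>n. bdd_borel (g n)" "\<And>n t. \<bar>g n t\<bar> \<le> c" "\<And>t. (\<lambda>n. g n t) \<longlonglongrightarrow> h t"
  shows "bdd_borel h" "(\<lambda>n. \<integral>t. g n t \<partial>\<mu> x) \<longlonglongrightarrow> (\<integral>t. h t \<partial>\<mu> x)"
proof -
  have [measurable]: "g n \<in> borel_measurable borel" for n using assms(1) by (rule bdd_borel_meas)
  have h [measurable]: "h \<in> borel_measurable borel"
    by (rule borel_measurable_LIMSEQ_real[where u = g]) (use assms(3) in auto)
  have "\<bar>h t\<bar> \<le> c" for t
    using LIMSEQ_le_const2[OF tendsto_rabs[OF assms(3)[of t]], of c] assms(2) by auto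
  thus "bdd_borel h" by (rule bdd_borelI[OF h])
  show "(\<lambda>n. \<integral>t. g n t \<partial>\<mu> x) \<longlonglongrightarrow> (\<integral>t. h t \<partial>\<mu> x)"
    by (rule integral_dominated_convergence[where w = "\<lambda>_. c"])
       (use assms finite_measure.finite_emeasure_space[OF finite_mu] in \<open>auto simp: integrable_bdd bdd_borel_const\<close>)
qed

lemma integral_mu_E:
  assumes [measurable]: "T \<in> sets borel" and g: "bdd_borel g"
  shows "(\<integral>t. g t \<partial>\<mu> (E T x)) = (\<integral>t. g t * indicator T t \<partial>\<mu> x)"
  unfolding mu_E[OF assms(1)] using bdd_borel_meas[OF g]
  by (subst integral_density) (auto simp: mult.commute)

text \<open>Quadratic forms determine bounded symmetric operators (\<open>bsym_eqI\<close>), so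
  identities between operator integrals can be checked on scalar integrals.\<close>

definition represents :: "(real \<Rightarrow> real) \<Rightarrow> ('a \<Rightarrow> 'a) \<Rightarrow> bool" where
  "represents g L \<longleftrightarrow> bsym L \<and> (\<forall>x. rip x (L x) = (\<integral>t. g t \<partial>\<mu> x))"

lemma represents_unique: "represents g L \<Longrightarrow> represents g M \<Longrightarrow> L = M"
  by (rule bsym_eqI) (auto simp: represents_def)

definition bit_op :: "(real \<Rightarrow> real) \<Rightarrow> nat \<Rightarrow> 'a \<Rightarrow> 'a" where
  "bit_op h n x = (\<Sum>j<n. (1/2) ^ Suc j *\<^sub>R E (bit_set h j) x)"

lemma bit_op_Suc: "bit_op h (Suc n) x = bit_op h n x + (1/2) ^ Suc n *\<^sub>R E (bit_set h n) x"
  by (simp add: bit_op_def)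

lemma bit_op_bsym: "h \<in> borel_measurable borel \<Longrightarrow> bsym (bit_op h n)"
  by (induction n)
     (simp_all add: bit_op_def[abs_def] bsym_const_zero bsym_plus bsym_scale oproj_bsym E bit_set_borel del: power_Suc)

lemma bit_op_norm: assumes "h \<in> borel_measurable borel" shows "norm (bit_op h n x) \<le> 1 * norm x"
proof -
  have "norm (bit_op h n x) \<le> (\<Sum>j<n. norm ((1/2) ^ Suc j *\<^sub>R E (bit_set h j) x))"
    unfolding bit_op_def by (rule norm_sum)
  also have "\<dots> \<le> (\<Sum>j<n. (1/2) ^ Suc j * norm x)"
    by (intro sum_mono) (use oproj_norm_le[OF E[OF bit_set_borel[OF assms]]] in simp)
  also have "\<dots> \<le> 1 * norm x"
    unfolding sum_distrib_right[symmetric] by (intro mult_right_mono sum_half_le) auto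
  finally show ?thesis .
qed

lemma bit_op_represents:
  assumes "h \<in> borel_measurable borel" shows "rip x (bit_op h n x) = (\<integral>t. bit_sum h n t \<partial>\<mu> x)"
proof -
  note [measurable] = bit_set_borel[OF assms]
  have "(\<integral>t. bit_sum h n t \<partial>\<mu> x) = (\<Sum>j<n. \<integral>t. (1/2) ^ Suc j * indicator (bit_set h j) t \<partial>\<mu> x)"
    unfolding bit_sum_def
    by (rule Bochner_Integration.integral_sum) (intro integrable_bdd bdd_borel_cmult bdd_borel_indicator bit_set_borel assms)
  also have "\<dots> = rip x (bit_op h n x)"
    unfolding bit_op_def linear_sum[OF bounded_linear.linear[OF bounded_linear_rip]]
    by (rule sum.cong) (simp_all add: rip_simps oproj_rip[OF E[OF bit_set_borel[OF assms]]] measure_mu[OF bit_set_borel[OF assms]])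
  finally show ?thesis by simp
qed

text \<open>Projections do not increase norms, so the geometric weights dominate the series.
  Commutation with every \<open>E T\<close> is carried to the limit because \<open>bint_E\<close>
  starts from it.\<close>

lemma bit_op_limit:
  assumes h: "h \<in> borel_measurable borel" "\<And>t. 0 \<le> h t" "\<And>t. h t < 1"
  obtains L where "represents h L" "\<And>x. (\<lambda>n. bit_op h n x) \<longlonglongrightarrow> L x" "\<And>T. T \<in> sets borel \<Longrightarrow> comm (E T) L"
proof -
  have "summable (\<lambda>j. (1/2) ^ Suc j *\<^sub>R E (bit_set h j) x)" for x
  proof (rule summable_comparison_test)
    show "summable (\<lambda>j. (1/2) ^ Suc j * norm x)" by (intro summable_mult2) (simp add: summable_geometric)
    show "\<exists>N. \<forall>n\<ge>N. norm ((1/2) ^ Suc n *\<^sub>R E (bit_set h n) x) \<le> (1/2) ^ Suc n * norm x"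
      using oproj_norm_le[OF E[OF bit_set_borel[OF h(1)]]] by simp
  qed
  note summable = this
  define L where "L x = (\<Sum>j. (1/2) ^ Suc j *\<^sub>R E (bit_set h j) x)" for x
  have L: "(\<lambda>n. bit_op h n x) \<longlonglongrightarrow> L x" for x
    unfolding bit_op_def L_def by (rule summable_LIMSEQ[OF summable])
  have bL: "bsym L" by (rule bsym_lim[OF bit_op_bsym[OF h(1)] bit_op_norm[OF h(1)] L])
  have "rip x (L x) = (\<integral>t. h t \<partial>\<mu> x)" for x
  proof (rule LIMSEQ_unique)
    show "(\<lambda>n. rip x (bit_op h n x)) \<longlonglongrightarrow> rip x (L x)" by (intro tendsto_rip L tendsto_const)
    show "(\<lambda>n. rip x (bit_op h n x)) \<longlonglongrightarrow> (\<integral>t. h t \<partial>\<mu> x)"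
      unfolding bit_op_represents[OF h(1)]
      by (rule integral_tendsto[where c = 1])
         (use h bit_sum_abs_le in \<open>auto intro!: bdd_borelI bit_sum_borel bit_sum_tendsto\<close>)
  qed
  hence "represents h L" using bL by (simp add: represents_def)
  moreover have "comm (E T) L" if "T \<in> sets borel" for T
  proof (rule comm_lim[OF oproj_bsym[OF E[OF that]] _ L])
    show "comm (E T) (bit_op h n)" for n
    proof (induction n)
      case 0 show ?case using bsym_zero[OF oproj_bsym[OF E[OF that]]] by (simp add: comm_def bit_op_def)
    next
      case (Suc n)
      thus ?case using comm_E[OF that bit_set_borel[OF h(1), of n]]
        by (simp add: comm_def bit_op_Suc bsym_lin[OF oproj_bsym[OF E[OF that]]])
    qed
  qed
  ultimately show ?thesis using L that by blast
qed

lemma unit_rescale: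
  assumes "bdd_borel g"
  obtains h c d where "h \<in> borel_measurable borel" "\<And>t. 0 \<le> h t" "\<And>t. h t < 1" "g = (\<lambda>t. c * h t + d)"
proof -
  obtain c where c: "c > 0" "\<And>t. \<bar>g t\<bar> \<le> c" using bdd_borel_bound[OF assms] by blast
  have b: "- c \<le> g t" "g t \<le> c" for t using c(2)[of t] by auto
  \<comment> \<open>Dividing by \<open>2 * c + 1\<close> instead of \<open>2 * c\<close> keeps the
    quotient strictly below 1, as the binary digits require.\<close>
  show ?thesis
  proof (rule that[of "\<lambda>t. (g t + c) / (2 * c + 1)" "2 * c + 1" "- c"])
    show "(\<lambda>t. (g t + c) / (2 * c + 1)) \<in> borel_measurable borel"
      using bdd_borel_meas[OF assms] by measurable
    show "0 \<le> (g t + c) / (2 * c + 1)" "(g t + c) / (2 * c + 1) < 1" for t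
      using b[of t] c(1) by (auto simp: divide_less_eq)
    show "g = (\<lambda>t. (2 * c + 1) * ((g t + c) / (2 * c + 1)) + - c)"
      using c(1) by (auto simp: fun_eq_iff)
  qed
qed

lemma represents_add:
  assumes "bdd_borel g" "bdd_borel h" "represents g L" "represents h M"
  shows "represents (\<lambda>t. g t + h t) (\<lambda>x. L x + M x)"
  using assms by (simp add: represents_def bsym_plus rip_add_right integrable_bdd)

lemma represents_cmult:
  assumes "represents g L" shows "represents (\<lambda>t. c * g t) (\<lambda>x. c *\<^sub>R L x)"
  using assms by (simp add: represents_def bsym_scale rip_scaleR_right)

lemma represents_const: "represents (\<lambda>t. c) (\<lambda>x. c *\<^sub>R x)"
  by (simp add: represents_def bsym_scale bsym_id rip_scaleR_right rip_self measure_mu E_UNIV)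

lemma represents_exists:
  assumes "bdd_borel g"
  shows "\<exists>L. represents g L \<and> (\<forall>T\<in>sets borel. comm (E T) L)"
proof -
  obtain h c d where h: "h \<in> borel_measurable borel" "\<And>t. 0 \<le> h t" "\<And>t. h t < 1" and g: "g = (\<lambda>t. c * h t + d)"
    using unit_rescale[OF assms] by blast
  obtain L where L: "represents h L" "\<And>T. T \<in> sets borel \<Longrightarrow> comm (E T) L"
    by (rule bit_op_limit[OF h], rule that)
  have bh: "bdd_borel h" by (rule bdd_borel_unit[OF h])
  have "represents g (\<lambda>x. c *\<^sub>R L x + d *\<^sub>R x)"
    unfolding g by (intro represents_add represents_cmult represents_const L bdd_borel_cmult bdd_borel_const bh)
  moreover have "\<forall>T\<in>sets borel. comm (E T) (\<lambda>x. c *\<^sub>R L x + d *\<^sub>R x)"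
    using L(2) by (simp add: comm_def bsym_lin[OF oproj_bsym[OF E]])
  ultimately show ?thesis by blast
qed

text \<open>The operator \<open>\<integral> g dE\<close> for bounded \<open>g\<close>.\<close>

definition bint :: "(real \<Rightarrow> real) \<Rightarrow> 'a \<Rightarrow> 'a" where
  "bint g = (SOME L. represents g L \<and> (\<forall>T\<in>sets borel. comm (E T) L))"

lemma bint: assumes "bdd_borel g"
  shows "represents g (bint g)" "T \<in> sets borel \<Longrightarrow> comm (E T) (bint g)"
  using someI_ex[OF represents_exists[OF assms]] by (auto simp: bint_def)

lemma bint_bsym: "bdd_borel g \<Longrightarrow> bsym (bint g)"
  and bint_form: "bdd_borel g \<Longrightarrow> rip x (bint g x) = (\<integral>t. g t \<partial>\<mu> x)"
  using bint(1) by (auto simp: represents_def)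

lemma bint_eqI: "bdd_borel g \<Longrightarrow> represents g L \<Longrightarrow> bint g = L"
  using bint(1) by (rule represents_unique)

lemma bint_add: "bdd_borel g \<Longrightarrow> bdd_borel h \<Longrightarrow> bint (\<lambda>t. g t + h t) x = bint g x + bint h x"
  by (subst bint_eqI[OF _ represents_add[OF _ _ bint(1) bint(1)]]) (auto intro: bdd_borel_add)

lemma bint_cmult: "bdd_borel g \<Longrightarrow> bint (\<lambda>t. c * g t) x = c *\<^sub>R bint g x"
  by (subst bint_eqI[OF _ represents_cmult[OF bint(1)]]) (auto intro: bdd_borel_cmult)

lemma bint_const: "bint (\<lambda>t. c) x = c *\<^sub>R x"
  by (subst bint_eqI[OF _ represents_const]) (auto intro: bdd_borel_const)

lemma bint_diff: "bdd_borel g \<Longrightarrow> bdd_borel h \<Longrightarrow> bint (\<lambda>t. g t - h t) x = bint g x - bint h x"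
  using bint_add[OF _ bdd_borel_cmult[of h "-1"], of g x] bint_cmult[of h "-1" x] by simp

lemma bint_indicator: "S \<in> sets borel \<Longrightarrow> bint (indicator S) = E S"
  by (rule bint_eqI) (auto simp: bdd_borel_indicator represents_def oproj_bsym E oproj_rip measure_mu)

text \<open>Multiplicativity when the second factor is an indicator. Commutation with
  \<open>E T\<close> turns the form of the product at \<open>x\<close> into the form of
  \<open>bint g\<close> at \<open>E T x\<close>, whose measure is restricted to
  \<open>T\<close>.\<close>

lemma bint_E:
  assumes g: "bdd_borel g" and T: "T \<in> sets borel" shows "bint g (E T x) = bint (\<lambda>t. g t * indicator T t) x"
proof -
  have c: "bint g (E T x) = E T (bint g x)" for x using bint(2)[OF g T] by (simp add: comm_def)
  have "represents (\<lambda>t. g t * indicator T t) (\<lambda>x. bint g (E T x))"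
    unfolding represents_def
  proof (intro conjI allI)
    show "bsym (\<lambda>x. bint g (E T x))" by (rule bsym_comp[OF bint_bsym[OF g] oproj_bsym[OF E[OF T]] c])
    fix x
    have "rip x (bint g (E T x)) = rip (E T x) (bint g (E T x))"
      by (metis c bsym_rip oproj_bsym oproj_idem E[OF T])
    thus "rip x (bint g (E T x)) = (\<integral>t. g t * indicator T t \<partial>\<mu> x)"
      by (simp add: bint_form g integral_mu_E T)
  qed
  thus ?thesis by (subst bint_eqI[of "\<lambda>t. g t * indicator T t"]) (auto intro: bdd_borel_mult bdd_borel_indicator g T)
qed

lemma bint_bit_op:
  assumes g: "bdd_borel g" and h: "h \<in> borel_measurable borel"
  shows "bint g (bit_op h n x) = bint (\<lambda>t. g t * bit_sum h n t) x"
proof (induction n)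
  case 0 show ?case using bint_const[of 0 x] bsym_zero[OF bint_bsym[OF g]] by (simp add: bit_op_def bit_sum_def)
next
  case (Suc n)
  note bg = g bdd_borel_indicator[OF bit_set_borel[OF h, of n]]
  have "bdd_borel (bit_sum h n)" using h bit_sum_abs_le by (intro bdd_borelI bit_sum_borel)
  hence "bint (\<lambda>t. g t * bit_sum h n t + (1/2) ^ Suc n * (g t * indicator (bit_set h n) t)) x =
      bint (\<lambda>t. g t * bit_sum h n t) x + (1/2) ^ Suc n *\<^sub>R bint (\<lambda>t. g t * indicator (bit_set h n) t) x"
    using bg by (simp only: bint_add bint_cmult bdd_borel_mult bdd_borel_cmult)
  moreover have "(\<lambda>t. g t * bit_sum h (Suc n) t) =
      (\<lambda>t. g t * bit_sum h n t + (1/2) ^ Suc n * (g t * indicator (bit_set h n) t))"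
    by (simp add: bit_sum_def fun_eq_iff distrib_left)
  ultimately have "bint (\<lambda>t. g t * bit_sum h (Suc n) t) x =
      bint (\<lambda>t. g t * bit_sum h n t) x + (1/2) ^ Suc n *\<^sub>R bint (\<lambda>t. g t * indicator (bit_set h n) t) x"
    by (simp only:)
  thus ?case using bint_E[OF g bit_set_borel[OF h]]
    by (simp add: bit_op_Suc bsym_lin[OF bint_bsym[OF g]] Suc)
qed

text \<open>Linearity carries the indicator case to binary partial sums, and dominated convergence
  carries their forms to the limit; \<open>unit_rescale\<close> reduces a general second factor to
  values in \<open>[0, 1)\<close>.\<close>

lemma bint_mult:
  assumes g: "bdd_borel g" and h: "bdd_borel h"
  shows "bint g (bint h x) = bint (\<lambda>t. g t * h t) x"
proof -
  obtain k c d where k: "k \<in> borel_measurable borel" "\<And>t. 0 \<le> k t" "\<And>t. k t < 1" and h_eq: "h = (\<lambda>t. c * k t + d)"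
    using unit_rescale[OF h] by blast
  have bk: "bdd_borel k" by (rule bdd_borel_unit[OF k])
  obtain L where L: "represents k L" "\<And>x. (\<lambda>n. bit_op k n x) \<longlonglongrightarrow> L x" by (rule bit_op_limit[OF k], rule that)
  have L_eq: "L = bint k" using bint_eqI[OF bk L(1)] by simp
  obtain b where b: "b > 0" "\<And>t. \<bar>g t\<bar> \<le> b" using bdd_borel_bound[OF g] by blast
  have bs: "bdd_borel (bit_sum k n)" for n using k bit_sum_abs_le by (intro bdd_borelI bit_sum_borel)
  have lim: "(\<lambda>n. bint g (bit_op k n x)) \<longlonglongrightarrow> bint g (bint k x)" for x
    using bsym_tendsto[OF bint_bsym[OF g] L(2)] by (simp add: L_eq)
  have "represents (\<lambda>t. g t * k t) (\<lambda>x. bint g (bint k x))"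
    unfolding represents_def
  proof (intro conjI allI)
    obtain C where C: "C > 0" "\<And>x. norm (bint g x) \<le> C * norm x" using bsym_bound[OF bint_bsym[OF g]] by blast
    show "bsym (\<lambda>x. bint g (bint k x))"
    proof (rule bsym_lim[of "\<lambda>n x. bint g (bit_op k n x)" C])
      show "bsym (\<lambda>x. bint g (bit_op k n x))" for n
        unfolding bint_bit_op[OF g k(1)] by (intro bint_bsym bdd_borel_mult g bs)
      show "norm (bint g (bit_op k n x)) \<le> C * norm x" for n x
        using order_trans[OF C(2) mult_left_mono[OF bit_op_norm[OF k(1)]]] C(1) by simp
    qed (fact lim)
    fix x
    show "rip x (bint g (bint k x)) = (\<integral>t. g t * k t \<partial>\<mu> x)"
    proof (rule LIMSEQ_unique)
      show "(\<lambda>n. rip x (bint g (bit_op k n x))) \<longlonglongrightarrow> rip x (bint g (bint k x))"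
        by (intro tendsto_rip lim tendsto_const)
      have "\<bar>g t * bit_sum k n t\<bar> \<le> b" for n t
        using mult_mono[OF b(2) bit_sum_abs_le[of k n t]] b(1) by (simp add: abs_mult)
      thus "(\<lambda>n. rip x (bint g (bit_op k n x))) \<longlonglongrightarrow> (\<integral>t. g t * k t \<partial>\<mu> x)"
        by (simp only: bint_bit_op[OF g k(1)] bint_form bdd_borel_mult g bs)
           (rule integral_tendsto[where c = b], auto intro!: bdd_borel_mult g bs tendsto_mult bit_sum_tendsto k)
    qed
  qed
  from bint_eqI[OF bdd_borel_mult[OF g bk] this]
  have gk: "bint (\<lambda>t. g t * k t) = (\<lambda>x. bint g (bint k x))" .
  have "bint (\<lambda>t. c * k t + d) y = c *\<^sub>R bint k y + d *\<^sub>R y" for y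
    by (simp add: bint_add bint_cmult bint_const bdd_borel_cmult bdd_borel_const bk)
  moreover have "bint (\<lambda>t. c * (g t * k t) + d * g t) x = c *\<^sub>R bint g (bint k x) + d *\<^sub>R bint g x"
    by (simp add: bint_add bint_cmult bdd_borel_cmult bdd_borel_mult bk g gk)
  ultimately show ?thesis
    by (simp add: h_eq bsym_lin[OF bint_bsym[OF g]] algebra_simps)
qed

lemma bint_norm: assumes "bdd_borel g" shows "(norm (bint g x))\<^sup>2 = (\<integral>t. (g t)\<^sup>2 \<partial>\<mu> x)"
proof -
  have "(norm (bint g x))\<^sup>2 = rip x (bint g (bint g x))"
    by (simp flip: rip_self add: bsym_rip[OF bint_bsym[OF assms]])
  also have "\<dots> = (\<integral>t. (g t)\<^sup>2 \<partial>\<mu> x)"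
    using assms by (simp add: bint_mult bint_form bdd_borel_mult power2_eq_square)
  finally show ?thesis .
qed

text \<open>\<open>bint_norm\<close> rewrites the squared distance as a scalar integral, to which
  dominated convergence applies.\<close>

lemma bint_tendsto:
  assumes "\<And>n. bdd_borel (g n)" "\<And>n t. \<bar>g n t\<bar> \<le> c" "\<And>t. (\<lambda>n. g n t) \<longlonglongrightarrow> h t"
  shows "(\<lambda>n. bint (g n) x) \<longlonglongrightarrow> bint h x"
proof -
  have h: "bdd_borel h" by (rule integral_tendsto[OF assms])
  have hc: "\<bar>h t\<bar> \<le> c" for t
    using LIMSEQ_le_const2[OF tendsto_rabs[OF assms(3)[of t]], of c] assms(2) by auto
  have "(\<lambda>n. \<integral>t. (g n t - h t)\<^sup>2 \<partial>\<mu> x) \<longlonglongrightarrow> (\<integral>t. 0 \<partial>\<mu> x)"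
  proof (rule integral_tendsto[where c = "(c + c)\<^sup>2"])
    show "\<bar>(g n t - h t)\<^sup>2\<bar> \<le> (c + c)\<^sup>2" for n t
    proof -
      have "\<bar>g n t - h t\<bar> \<le> \<bar>c + c\<bar>" using assms(2)[of n t] hc[of t] by linarith
      thus ?thesis by (simp add: abs_le_square_iff)
    qed
    show "(\<lambda>n. (g n t - h t)\<^sup>2) \<longlonglongrightarrow> 0" for t
      using tendsto_power[OF tendsto_diff[OF assms(3)[of t] tendsto_const[of "h t"]], of 2] by simp
  qed (intro bdd_borel_power2 bdd_borel_diff assms h)
  hence "(\<lambda>n. (norm (bint (g n) x - bint h x))\<^sup>2) \<longlonglongrightarrow> 0"
    by (simp add: bint_norm[symmetric] bint_diff bdd_borel_diff assms(1) h)
  from tendsto_real_sqrt[OF this] have "(\<lambda>n. norm (bint (g n) x - bint h x)) \<longlonglongrightarrow> 0" by simp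
  thus ?thesis by (simp add: LIM_zero_cancel tendsto_norm_zero_iff)
qed

end

section \<open>Unbounded functional calculus\<close>

text \<open>Operators with a bounded inverse are handled through that inverse: for injective \<open>C\<close>, \<open>inv_map C\<close> is the partial map
  \<open>inverse C\<close> with domain \<open>range C\<close>.\<close>

definition inv_map :: "('a \<Rightarrow> 'a) \<Rightarrow> ('a \<rightharpoonup> 'a)" where
  "inv_map C = (\<lambda>x. if x \<in> range C then Some (inv C x) else None)"

lemma inv_map_Some: "inj C \<Longrightarrow> inv_map C x = Some y \<longleftrightarrow> x = C y"
  by (auto simp: inv_map_def f_inv_into_f)

lemma dom_inv_map: "dom (inv_map C) = range C"
  by (auto simp: inv_map_def dom_def split: if_splits)

lemma inv_map_apply [simp]: "inj C \<Longrightarrow> inv_map C (C y) = Some y"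
  by (simp add: inv_map_Some)

lemma option_map_eqI: "(\<And>x y. f x = Some y \<longleftrightarrow> g x = Some y) \<Longrightarrow> f = g"
  by (rule ext) (metis not_None_eq)

lemma bsym_cinner_real: "bsym L \<Longrightarrow> cinner x (L x) = complex_of_real (rip x (L x))"
  by (metis bsym_cinner cinner_commute complex_cnj_cancel_iff rip_def Reals_cnj_iff complex_is_Real_iff of_real_Re)

text \<open>Large values are set to 0 rather than clipped. A truncation is then \<open>f\<close>
  times the indicator of a level set, and the difference of two truncations is supported where the
  earlier one vanishes, which gives \<open>trunc_diff_power2\<close>.\<close>

definition trunc :: "(real \<Rightarrow> real) \<Rightarrow> nat \<Rightarrow> real \<Rightarrow> real" where
  "trunc f n t = (if \<bar>f t\<bar> \<le> real n then f t else 0)"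

lemma trunc_bdd: assumes "f \<in> borel_measurable borel" shows "bdd_borel (trunc f n)"
proof (rule bdd_borelI[of _ "real n"])
  show "trunc f n \<in> borel_measurable borel" unfolding trunc_def[abs_def] using assms by measurable
qed (simp add: trunc_def)

lemma trunc_diff_power2: "m \<le> n \<Longrightarrow> (trunc f n t - trunc f m t)\<^sup>2 = (trunc f n t)\<^sup>2 - (trunc f m t)\<^sup>2"
  by (auto simp: trunc_def)

lemma trunc_eventually: "\<forall>\<^sub>F n in sequentially. trunc f n t = f t"
proof -
  obtain k where "\<bar>f t\<bar> \<le> real k" using real_arch_simple by blast
  thus ?thesis by (auto simp: eventually_sequentially trunc_def intro!: exI[of _ k])
qed

lemma trunc_tendsto: "(\<lambda>n. trunc f n t) \<longlonglongrightarrow> f t"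
  by (rule tendsto_eventually) (rule trunc_eventually)

lemma trunc_abs_le: "\<bar>trunc f n t\<bar> \<le> \<bar>f t\<bar>"
  by (simp add: trunc_def)

lemma bounded_linear_scaleC: "bounded_linear ((*\<^sub>C) c :: 'a::chilbert_space \<Rightarrow> 'a)"
  by (rule bounded_linear_intro[of _ "cmod c"])
     (auto simp: scaleC_add_right scaleR_scaleC scaleC_scaleC norm_scaleC mult.commute)

lemma linear_op_add:
  "linear_op T \<Longrightarrow> x \<in> dom T \<Longrightarrow> y \<in> dom T \<Longrightarrow> T (x + y) = Some (the (T x) + the (T y))"
  unfolding linear_op_def by blast

lemma linear_op_scale: "linear_op T \<Longrightarrow> x \<in> dom T \<Longrightarrow> T (c *\<^sub>C x) = Some (c *\<^sub>C the (T x))"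
  unfolding linear_op_def by blast

text \<open>Complex polarization: evaluating the zero form at \<open>x + y\<close> and at
  \<open>x + \<i> y\<close> separates the two cross terms. It supplies the uniqueness behind the
  \<open>THE\<close> in \<open>spectral_integral\<close>.\<close>

lemma linear_op_eqI:
  fixes T T' :: "'a::chilbert_space \<rightharpoonup> 'a"
  assumes lin: "linear_op T" "linear_op T'" and dom: "dom T' = dom T" and dense: "closure (dom T) = UNIV"
    and form: "\<And>x. x \<in> dom T \<Longrightarrow> cinner x (the (T x)) = cinner x (the (T' x))"
  shows "T = T'"
proof -
  let ?D = "dom T"
  define S where "S x = the (T x) - the (T' x)" for x
  have add: "x + y \<in> ?D" "S (x + y) = S x + S y" if "x \<in> ?D" "y \<in> ?D" for x y
  proof -
    have "T (x + y) = Some (the (T x) + the (T y))" "T' (x + y) = Some (the (T' x) + the (T' y))"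
      using that dom by (simp_all add: linear_op_add[OF lin(1)] linear_op_add[OF lin(2)])
    thus "x + y \<in> ?D" "S (x + y) = S x + S y" by (simp_all add: S_def domI)
  qed
  have scale: "c *\<^sub>C x \<in> ?D" "S (c *\<^sub>C x) = c *\<^sub>C S x" if "x \<in> ?D" for c x
  proof -
    have "T (c *\<^sub>C x) = Some (c *\<^sub>C the (T x))" "T' (c *\<^sub>C x) = Some (c *\<^sub>C the (T' x))"
      using that dom by (simp_all add: linear_op_scale[OF lin(1)] linear_op_scale[OF lin(2)])
    thus "c *\<^sub>C x \<in> ?D" "S (c *\<^sub>C x) = c *\<^sub>C S x"
      by (simp_all add: S_def domI linear_diff[OF bounded_linear.linear[OF bounded_linear_scaleC]])
  qed
  have q: "cinner x (S x) = 0" if "x \<in> ?D" for x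
    using form[OF that] by (simp add: S_def cinner_diff_right)
  have "cinner x (S y) = 0" if xy: "x \<in> ?D" "y \<in> ?D" for x y
  proof -
    have 1: "cinner x (S y) + cinner y (S x) = 0"
      using q[OF add(1)[OF xy]] q[OF xy(1)] q[OF xy(2)]
      by (simp add: add xy cinner_add_left cinner_add_right add.commute)
    have "\<i> * cinner x (S y) - \<i> * cinner y (S x) = 0"
      using q[OF add(1)[OF xy(1) scale(1)[OF xy(2), of \<i>]]] q[OF xy(1)] q[OF scale(1)[OF xy(2), of \<i>]]
      by (simp add: add scale xy cinner_add_left cinner_add_right cinner_scaleC_left cinner_scaleC_right)
    hence "cinner x (S y) = cinner y (S x)" by simp
    with 1 show ?thesis by simp
  qed
  hence "S y = 0" if "y \<in> ?D" for y
    using that by (intro cinner_ext_dense[OF dense]) (metis cinner_commute cinner_zero complex_cnj_zero)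
  hence "the (T y) = the (T' y)" if "y \<in> ?D" for y using that by (simp add: S_def)
  show ?thesis
  proof
    fix y show "T y = T' y"
      using \<open>\<And>y. y \<in> ?D \<Longrightarrow> the (T y) = the (T' y)\<close>[of y] dom by (metis domIff option.expand)
  qed
qed

section \<open>Integrals of unbounded functions as strong limits of truncations\<close>

context pvm
begin

text \<open>Multiplying by the indicator of a set that carries \<open>E\<close> changes no integral,
  so values off the spectrum may be chosen to keep functions bounded.\<close>

lemma bint_cong:
  assumes "bdd_borel g" "bdd_borel h" "U \<in> sets borel" "\<And>x. E U x = x" "\<And>t. t \<in> U \<Longrightarrow> g t = h t"
  shows "bint g = bint h"
proof
  fix x
  have "(\<lambda>t. g t * indicator U t) = (\<lambda>t. h t * indicator U t)" using assms(5) by (auto simp: indicator_def)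
  thus "bint g x = bint h x"
    using bint_E[OF assms(1,3), of x] bint_E[OF assms(2,3), of x] by (simp add: assms(4))
qed

lemma bint_norm_le:
  assumes "bdd_borel g" "\<And>t. \<bar>g t\<bar> \<le> c" shows "norm (bint g x) \<le> c * norm x"
proof (rule power2_le_imp_le)
  have c: "c \<ge> 0" using assms(2)[of 0] by simp
  have "(norm (bint g x))\<^sup>2 \<le> (\<integral>t. c\<^sup>2 \<partial>\<mu> x)"
    unfolding bint_norm[OF assms(1)]
    using assms(2) c by (intro integral_mono integrable_bdd bdd_borel_power2 assms(1) bdd_borel_const) (simp add: abs_le_square_iff[symmetric])
  thus "(norm (bint g x))\<^sup>2 \<le> (c * norm x)\<^sup>2"
    by (simp add: measure_mu E_UNIV power_mult_distrib mult.commute)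
  show "0 \<le> c * norm x" using c by simp
qed

lemma bint_commute: "bdd_borel g \<Longrightarrow> bdd_borel h \<Longrightarrow> bint g (bint h x) = bint h (bint g x)"
  by (simp add: bint_mult mult.commute)

lemma bint_trunc_E:
  assumes f: "f \<in> borel_measurable borel" and n: "k \<le> n"
  shows "bint (trunc f n) (E {t. \<bar>f t\<bar> \<le> real k} x) = bint (trunc f k) x"
proof -
  have m: "{t. \<bar>f t\<bar> \<le> real k} \<in> sets borel" using f by measurable
  have "(\<lambda>t. trunc f n t * indicator {t. \<bar>f t\<bar> \<le> real k} t) = trunc f k"
    using n by (auto simp: fun_eq_iff trunc_def indicator_def)
  thus ?thesis using bint_E[OF trunc_bdd[OF f] m] by simp
qed

lemma E_level_tendsto:
  assumes f: "f \<in> borel_measurable borel" shows "(\<lambda>n. E {t. \<bar>f t\<bar> \<le> real n} x) \<longlonglongrightarrow> x"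
proof -
  have m: "{t. \<bar>f t\<bar> \<le> real n} \<in> sets borel" for n using f by measurable
  have "(\<lambda>n. bint (indicator {t. \<bar>f t\<bar> \<le> real n}) x) \<longlonglongrightarrow> bint (\<lambda>t. 1) x"
  proof (rule bint_tendsto[where c = 1])
    show "(\<lambda>n. indicator {t. \<bar>f t\<bar> \<le> real n} t :: real) \<longlonglongrightarrow> 1" for t
    proof (rule tendsto_eventually)
      obtain k where "\<bar>f t\<bar> \<le> real k" using real_arch_simple by blast
      thus "\<forall>\<^sub>F n in sequentially. indicator {t. \<bar>f t\<bar> \<le> real n} t = (1::real)"
        by (auto simp: eventually_sequentially indicator_def intro!: exI[of _ k])
    qed
  qed (auto intro: bdd_borel_indicator m simp: indicator_def)
  thus ?thesis by (simp add: bint_indicator m bint_const)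
qed

text \<open>Squared distances between the vectors are differences of the integrals of
  \<open>(trunc f n)^2\<close>. Dominated convergence handles these integrals when
  \<open>f^2\<close> is integrable, and monotone convergence gives integrability back.\<close>

lemma trunc_convergent_iff:
  assumes f [measurable]: "f \<in> borel_measurable borel"
  shows "convergent (\<lambda>n. bint (trunc f n) x) \<longleftrightarrow> integrable (\<mu> x) (\<lambda>t. (f t)\<^sup>2)"
proof
  note b = trunc_bdd[OF f]
  have ab: "(trunc f n t)\<^sup>2 \<le> (f t)\<^sup>2" for n t using trunc_abs_le[of f n t] by (simp add: abs_le_square_iff)
  { assume "integrable (\<mu> x) (\<lambda>t. (f t)\<^sup>2)"
    hence "(\<lambda>n. \<integral>t. (trunc f n t)\<^sup>2 \<partial>\<mu> x) \<longlonglongrightarrow> (\<integral>t. (f t)\<^sup>2 \<partial>\<mu> x)"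
      using bdd_borel_meas[OF bdd_borel_power2[OF b]]
      by (intro integral_dominated_convergence[where w = "\<lambda>t. (f t)\<^sup>2"])
         (auto simp: ab intro!: tendsto_power trunc_tendsto)
    hence "convergent (\<lambda>n. \<integral>t. (trunc f n t)\<^sup>2 \<partial>\<mu> x)" by (rule convergentI)
    thus "convergent (\<lambda>n. bint (trunc f n) x)"
    proof (rule convergent_of_power2)
      fix m n :: nat assume mn: "m \<le> n"
      have "(dist (bint (trunc f m) x) (bint (trunc f n) x))\<^sup>2 = (norm (bint (trunc f n) x - bint (trunc f m) x))\<^sup>2"
        by (simp add: dist_norm norm_minus_commute)
      also have "\<dots> = (\<integral>t. (trunc f n t - trunc f m t)\<^sup>2 \<partial>\<mu> x)"
        by (simp add: bint_diff[OF b b, symmetric] bint_norm bdd_borel_diff b)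
      also have "\<dots> = (\<integral>t. (trunc f n t)\<^sup>2 \<partial>\<mu> x) - (\<integral>t. (trunc f m t)\<^sup>2 \<partial>\<mu> x)"
        by (simp add: trunc_diff_power2[OF mn] integrable_bdd bdd_borel_power2 b)
      finally show "(dist (bint (trunc f m) x) (bint (trunc f n) x))\<^sup>2 \<le>
          \<bar>(\<integral>t. (trunc f m t)\<^sup>2 \<partial>\<mu> x) - (\<integral>t. (trunc f n t)\<^sup>2 \<partial>\<mu> x)\<bar>" by simp
    qed }
  assume "convergent (\<lambda>n. bint (trunc f n) x)"
  then obtain y where "(\<lambda>n. bint (trunc f n) x) \<longlonglongrightarrow> y" by (auto simp: convergent_def)
  hence "(\<lambda>n. (norm (bint (trunc f n) x))\<^sup>2) \<longlonglongrightarrow> (norm y)\<^sup>2" by (intro tendsto_intros)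
  hence lim: "(\<lambda>n. \<integral>t. (trunc f n t)\<^sup>2 \<partial>\<mu> x) \<longlonglongrightarrow> (norm y)\<^sup>2" by (simp add: bint_norm b)
  show "integrable (\<mu> x) (\<lambda>t. (f t)\<^sup>2)"
  proof (rule integrable_monotone_convergence[where f = "\<lambda>n t. (trunc f n t)\<^sup>2"])
    show "AE t in \<mu> x. mono (\<lambda>n. (trunc f n t)\<^sup>2)" by (auto simp: mono_def trunc_def)
    show "AE t in \<mu> x. (\<lambda>n. (trunc f n t)\<^sup>2) \<longlonglongrightarrow> (f t)\<^sup>2" by (auto intro!: tendsto_power trunc_tendsto)
  qed (use lim in \<open>auto intro: integrable_bdd bdd_borel_power2 b\<close>)
qed

text \<open>A witness for the \<open>THE\<close> in \<open>spectral_integral\<close>; as a strong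
  limit it turns membership in the domain and the value there into one convergence statement,
  \<open>sint_Some\<close>.\<close>

definition sint :: "(real \<Rightarrow> real) \<Rightarrow> ('a \<rightharpoonup> 'a)" where
  "sint f x = (if convergent (\<lambda>n. bint (trunc f n) x) then Some (lim (\<lambda>n. bint (trunc f n) x)) else None)"

lemma sint_Some: "sint f x = Some y \<longleftrightarrow> (\<lambda>n. bint (trunc f n) x) \<longlonglongrightarrow> y"
proof
  show "(\<lambda>n. bint (trunc f n) x) \<longlonglongrightarrow> y" if "sint f x = Some y"
    using that by (auto simp: sint_def convergent_LIMSEQ_iff split: if_splits)
  show "sint f x = Some y" if "(\<lambda>n. bint (trunc f n) x) \<longlonglongrightarrow> y"
    using that convergentI[OF that] limI[OF that] by (simp add: sint_def)
qed

lemma sint_dom: "x \<in> dom (sint f) \<Longrightarrow> (\<lambda>n. bint (trunc f n) x) \<longlonglongrightarrow> the (sint f x)"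
  unfolding sint_Some[symmetric] by (simp add: domIff)

lemma sint_linear: assumes f: "f \<in> borel_measurable borel" shows "linear_op (sint f)"
  unfolding linear_op_def
proof (intro conjI ballI allI)
  note b = bint_bsym[OF trunc_bdd[OF f]]
  show "sint f 0 = Some 0" by (simp add: sint_Some bsym_lin[OF b])
  show "sint f (x + y) = Some (the (sint f x) + the (sint f y))" if "x \<in> dom (sint f)" "y \<in> dom (sint f)" for x y
    using tendsto_add[OF sint_dom[OF that(1)] sint_dom[OF that(2)]] by (simp add: sint_Some bsym_lin[OF b])
  show "sint f (c *\<^sub>C x) = Some (c *\<^sub>C the (sint f x))" if "x \<in> dom (sint f)" for c x
    using bounded_linear.tendsto[OF bounded_linear_scaleC sint_dom[OF that]] by (simp add: sint_Some bsym_lin[OF b])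
qed

lemma sint_dense: assumes f: "f \<in> borel_measurable borel" shows "closure (dom (sint f)) = UNIV"
proof -
  have "x \<in> closure (dom (sint f))" for x
    unfolding closure_sequential
  proof (intro exI[of _ "\<lambda>n. E {t. \<bar>f t\<bar> \<le> real n} x"] conjI allI E_level_tendsto f)
    fix k
    have "(\<lambda>n. bint (trunc f n) (E {t. \<bar>f t\<bar> \<le> real k} x)) \<longlonglongrightarrow> bint (trunc f k) x"
      by (rule tendsto_eventually) (auto simp: eventually_sequentially bint_trunc_E[OF f] intro!: exI[of _ k])
    thus "E {t. \<bar>f t\<bar> \<le> real k} x \<in> dom (sint f)" unfolding sint_Some[symmetric] by auto
  qed
  thus ?thesis by auto
qed

lemma sint_form:
  assumes f [measurable]: "f \<in> borel_measurable borel" and x: "x \<in> dom (sint f)"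
  shows "cinner x (the (sint f x)) = complex_of_real (\<integral>t. f t \<partial>\<mu> x)"
proof -
  obtain y where y: "sint f x = Some y" using x by (auto simp: dom_def)
  hence lim: "(\<lambda>n. bint (trunc f n) x) \<longlonglongrightarrow> y" by (simp add: sint_Some)
  have "integrable (\<mu> x) (\<lambda>t. (f t)\<^sup>2)" using lim trunc_convergent_iff[OF f, of x] by (auto simp: convergent_def)
  hence int: "integrable (\<mu> x) (\<lambda>t. 1 + (f t)\<^sup>2)" by (simp add: integrable_bdd bdd_borel_const)
  \<comment> \<open>On a finite measure \<open>1 + f^2\<close> is an integrable majorant of all
    truncations once \<open>f^2\<close> is integrable.\<close>
  have "\<bar>a\<bar> \<le> 1 + a\<^sup>2" for a :: real
    using zero_le_power2[of "\<bar>a\<bar> - 1/2"] by (simp add: power2_diff power_divide)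
  hence "\<bar>trunc f n t\<bar> \<le> 1 + (f t)\<^sup>2" for n t using trunc_abs_le[of f n t] order_trans by blast
  hence "(\<lambda>n. \<integral>t. trunc f n t \<partial>\<mu> x) \<longlonglongrightarrow> (\<integral>t. f t \<partial>\<mu> x)"
    using bdd_borel_meas[OF trunc_bdd[OF f]]
    by (intro integral_dominated_convergence[OF _ _ int]) (auto intro: trunc_tendsto)
  hence "(\<lambda>n. complex_of_real (\<integral>t. trunc f n t \<partial>\<mu> x)) \<longlonglongrightarrow> complex_of_real (\<integral>t. f t \<partial>\<mu> x)"
    by (rule tendsto_of_real)
  moreover have "(\<lambda>n. cinner x (bint (trunc f n) x)) \<longlonglongrightarrow> cinner x y"
    by (intro tendsto_cinner lim tendsto_const)
  ultimately show ?thesis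
    by (simp add: y bsym_cinner_real bint_bsym bint_form trunc_bdd f LIMSEQ_unique)
qed

lemma spectral_integral_eq_sint:
  assumes f: "f \<in> borel_measurable borel" shows "spectral_integral E f = sint f"
  unfolding spectral_integral_def
proof (rule the_equality)
  have dom: "dom (sint f) = {x. integrable (\<mu> x) (\<lambda>t. (f t)\<^sup>2)}"
    unfolding dom_def sint_def trunc_convergent_iff[OF f] by simp
  show *: "linear_op (sint f) \<and> dom (sint f) = {x. integrable (\<mu> x) (\<lambda>t. (f t)\<^sup>2)} \<and>
      (\<forall>x\<in>dom (sint f). cinner x (the (sint f x)) = complex_of_real (\<integral>t. f t \<partial>\<mu> x))"
    using sint_linear[OF f] dom sint_form[OF f] by simp
  fix T assume "linear_op T \<and> dom T = {x. integrable (\<mu> x) (\<lambda>t. (f t)\<^sup>2)} \<and>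
      (\<forall>x\<in>dom T. cinner x (the (T x)) = complex_of_real (\<integral>t. f t \<partial>\<mu> x))"
  with * sint_dense[OF f] show "T = sint f"
    by (intro linear_op_eqI[symmetric]) auto
qed

lemma spectral_integral_Some:
  assumes "f \<in> borel_measurable borel"
  shows "spectral_integral E f x = Some y \<longleftrightarrow> (\<lambda>n. bint (trunc f n) x) \<longlonglongrightarrow> y"
  by (simp add: spectral_integral_eq_sint[OF assms] sint_Some)

text \<open>On the carrier \<open>U\<close> the product of \<open>trunc f n\<close> and
  \<open>g\<close> is the indicator of a level set of \<open>f\<close>, and the level projections
  tend to the identity. Hence the truncations undo \<open>bint g\<close> in the limit from either
  side.\<close>

lemma spectral_integral_inverse:
  assumes f: "f \<in> borel_measurable borel" and g: "bdd_borel g"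
    and U: "U \<in> sets borel" "\<And>x. E U x = x" "\<And>t. t \<in> U \<Longrightarrow> f t * g t = 1"
  shows "inj (bint g)" "spectral_integral E f = inv_map (bint g)"
proof -
  have m: "{t. \<bar>f t\<bar> \<le> real n} \<in> sets borel" for n using f by measurable
  have "bint (\<lambda>t. trunc f n t * g t) = bint (indicator {t. \<bar>f t\<bar> \<le> real n})" for n
    by (rule bint_cong[OF bdd_borel_mult[OF trunc_bdd[OF f] g] bdd_borel_indicator[OF m] U(1,2)])
       (use U(3) in \<open>auto simp: trunc_def indicator_def\<close>)
  hence *: "bint (trunc f n) (bint g x) = E {t. \<bar>f t\<bar> \<le> real n} x" for n x
    by (simp add: bint_mult trunc_bdd f g bint_indicator m)
  have lim: "(\<lambda>n. bint (trunc f n) (bint g y)) \<longlonglongrightarrow> y" for y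
    unfolding * by (rule E_level_tendsto[OF f])
  show inj: "inj (bint g)"
  proof (rule injI)
    fix x y assume "bint g x = bint g y"
    with lim[of x] lim[of y] show "x = y" by (simp add: LIMSEQ_unique)
  qed
  show "spectral_integral E f = inv_map (bint g)"
  proof (rule option_map_eqI)
    fix x y
    have "x = bint g y" if "(\<lambda>n. bint (trunc f n) x) \<longlonglongrightarrow> y"
    proof (rule LIMSEQ_unique)
      show "(\<lambda>n. bint g (bint (trunc f n) x)) \<longlonglongrightarrow> bint g y"
        by (rule bsym_tendsto[OF bint_bsym[OF g] that])
      have "bint g (bint (trunc f n) x) = E {t. \<bar>f t\<bar> \<le> real n} x" for n
        unfolding *[symmetric] by (intro bint_commute g trunc_bdd f)
      thus "(\<lambda>n. bint g (bint (trunc f n) x)) \<longlonglongrightarrow> x" using E_level_tendsto[OF f] by simp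
    qed
    with lim show "spectral_integral E f x = Some y \<longleftrightarrow> inv_map (bint g) x = Some y"
      unfolding spectral_integral_Some[OF f] inv_map_Some[OF inj] by blast
  qed
qed

lemma spectral_integral_bounded:
  assumes f: "f \<in> borel_measurable borel" and g: "bdd_borel g"
    and U: "U \<in> sets borel" "\<And>x. E U x = x" "\<And>t. t \<in> U \<Longrightarrow> f t = g t"
  shows "spectral_integral E f x = Some (bint g x)"
  unfolding spectral_integral_Some[OF f]
proof (rule tendsto_eventually)
  obtain c where c: "\<And>t. \<bar>g t\<bar> \<le> c" using bdd_borel_bound[OF g] by blast
  obtain k where k: "c \<le> real k" using real_arch_simple by blast
  have "bint (trunc f n) = bint g" if "n \<ge> k" for n
  proof (rule bint_cong[OF trunc_bdd[OF f] g U(1,2)])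
    fix t assume "t \<in> U"
    thus "trunc f n t = g t" using U(3)[of t] c[of t] k that by (simp add: trunc_def)
  qed
  thus "\<forall>\<^sub>F n in sequentially. bint (trunc f n) x = bint g x"
    unfolding eventually_sequentially by (intro exI[of _ k]) simp
qed

end

section \<open>The spectral theorem for operators with bounded inverse\<close>

context spectral_family
begin

text \<open>A Riemann-Stieltjes estimate. On an interval from \<open>a\<close> to \<open>b\<close>
  the forms of \<open>T\<close> and of the integral both lie between \<open>a * (norm z)^2\<close>
  and \<open>b * (norm z)^2\<close>, so \<open>h\<close> changes by at most the mesh times the
  growth of \<open>F x\<close>. Summed over a uniform partition, this bounds the form of the
  difference \<open>D\<close> by a multiple of the mesh.\<close>

lemma bint_eq:
  assumes pE: "pvm E" "\<And>a. E {..a} = P a"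
    and c: "c > 0" "\<And>a x. a \<le> - c \<Longrightarrow> P a x = 0" "\<And>a x. a \<ge> c \<Longrightarrow> P a x = x"
  shows "pvm.bint E (\<lambda>t. t * indicator {- c<..c} t) = T"
proof -
  interpret pvm E by fact
  let ?g = "\<lambda>t::real. t * indicator {- c<..c} t"
  have g: "bdd_borel ?g" by (rule bdd_borelI[of _ c]) (use c(1) in \<open>auto simp: indicator_def\<close>)
  define D where "D x = T x - bint ?g x" for x
  have bD: "bsym D" unfolding D_def by (rule bsym_minus_op[OF T bint_bsym[OF g]])
  have cD: "D (P a x) = P a (D x)" for a x
    using commT[of a] bint(2)[OF g, of "{..a}"] by (simp add: D_def lin comm_def pE)
  have E_Ioc: "E {a<..b} x = P b x - P a x" if "a \<le> b" for a b x
  proof -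
    have "{..a} \<union> {a<..b} = {..b}" "{..a} \<inter> {a<..b} = {}" using that by auto
    thus ?thesis using E_add[of "{..a}" "{a<..b}"] by (simp add: pE(2) fun_eq_iff)
  qed
  define h where "h x a = rip x (D (P a x))" for x a
  have h_step: "\<bar>h x b - h x a\<bar> \<le> (b - a) * (F x b - F x a)" if ab: "a \<le> b" "- c \<le> a" "b \<le> c" for x a b
  proof -
    define z where "z = P b x - P a x"
    have z: "E {a<..b} x = z" by (simp add: z_def E_Ioc ab)
    have bQ: "oproj (E {a<..b})" by (rule E) simp
    have "h x b - h x a = rip x (D z)" by (simp add: h_def z_def bsym_lin[OF bD] rip_simps)
    \<comment> \<open>\<open>D\<close> commutes with all \<open>P a\<close>, so its form localizes
      to the increment \<open>z\<close>.\<close>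
    also have "D z = E {a<..b} (D z)"
      using oproj_idem[OF bQ, of x] by (simp add: z E_Ioc ab z_def cD bsym_lin[OF bD] lin oproj_idem[OF P] mono_proj)
    also have "rip x \<dots> = rip z (D z)" by (simp add: bsym_rip[OF oproj_bsym[OF bQ], symmetric] z)
    finally have 1: "h x b - h x a = rip z (T z) - rip z (bint ?g z)" by (simp add: D_def rip_simps)
    have n: "(norm z)\<^sup>2 = F x b - F x a" by (simp add: z_def F_diff ab)
    have "P b z = z" "P a z = 0" using ab by (simp_all add: z_def lin mono_proj oproj_idem[OF P])
    hence 2: "rip z (T z) \<le> b * (norm z)\<^sup>2" "a * (norm z)\<^sup>2 \<le> rip z (T z)" using le ge by auto
    have 3: "rip z (bint ?g z) = (\<integral>t. ?g t * indicator {a<..b} t \<partial>\<mu> x)"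
      by (simp only: z[symmetric] bint_form[OF g]) (rule integral_mu_E[OF _ g], simp)
    have 4: "(\<integral>t. k * indicator {a<..b} t \<partial>\<mu> x) = k * (norm z)\<^sup>2" for k
      by (simp add: measure_mu z)
    have "(\<integral>t. a * indicator {a<..b} t \<partial>\<mu> x) \<le> rip z (bint ?g z)" "rip z (bint ?g z) \<le> (\<integral>t. b * indicator {a<..b} t \<partial>\<mu> x)"
      unfolding 3 using ab
      by (intro integral_mono integrable_bdd bdd_borel_cmult bdd_borel_mult[OF g] bdd_borel_indicator; auto simp: indicator_def)+
    with 2 have "\<bar>rip z (T z) - rip z (bint ?g z)\<bar> \<le> b * (norm z)\<^sup>2 - a * (norm z)\<^sup>2" unfolding 4 by linarith
    thus ?thesis unfolding 1 n by (simp add: algebra_simps)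
  qed
  have D0: "rip x (D x) = 0" for x
  proof -
    have bound: "\<bar>rip x (D x)\<bar> \<le> (2 * c * (norm x)\<^sup>2) / real (Suc N)" for N
    proof -
      \<comment> \<open>\<open>Suc N\<close> equal steps lead from \<open>- c\<close>, where
        \<open>P\<close> is 0, to \<open>c\<close>, where it is the identity.\<close>
      define \<delta> where "\<delta> = 2 * c / real (Suc N)"
      have d: "\<delta> > 0" using c(1) by (simp add: \<delta>_def)
      have dN: "real (Suc N) * \<delta> = 2 * c" by (simp add: \<delta>_def)
      define s where "s k = - c + real k * \<delta>" for k
      have s_le: "s k \<le> c" if "k \<le> Suc N" for k
      proof -
        have "real k * \<delta> \<le> real (Suc N) * \<delta>" using that d by (intro mult_right_mono) auto
        thus ?thesis using dN by (simp add: s_def del: of_nat_Suc)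
      qed
      have "\<bar>h x (s k) - h x (s 0)\<bar> \<le> \<delta> * (F x (s k) - F x (s 0))" if "k \<le> Suc N" for k
        using that
      proof (induction k)
        case (Suc k)
        have "\<bar>h x (s (Suc k)) - h x (s k)\<bar> \<le> (s (Suc k) - s k) * (F x (s (Suc k)) - F x (s k))"
          by (rule h_step) (use s_le[OF Suc.prems] d in \<open>auto simp: s_def algebra_simps\<close>)
        also have "s (Suc k) - s k = \<delta>" by (simp add: s_def algebra_simps)
        finally show ?case using Suc by (simp add: algebra_simps)
      qed simp
      from this[of "Suc N"] have "\<bar>h x c - h x (- c)\<bar> \<le> \<delta> * (F x c - F x (- c))"
        using dN by (simp add: s_def)
      thus ?thesis using c(2)[of "- c" x] c(3)[of c x] by (simp add: h_def F_def bsym_lin[OF bD] \<delta>_def)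
    qed
    have "(\<lambda>N. (2 * c * (norm x)\<^sup>2) * inverse (real (Suc N))) \<longlonglongrightarrow> (2 * c * (norm x)\<^sup>2) * 0"
      by (intro tendsto_mult tendsto_const LIMSEQ_inverse_real_of_nat)
    hence "\<bar>rip x (D x)\<bar> \<le> 0"
      using bound by (intro LIMSEQ_le_const[of _ 0]) (auto simp: divide_inverse)
    thus ?thesis by simp
  qed
  show ?thesis
  proof
    fix x show "bint ?g x = T x" using bsym_zeroI[OF bD D0, of x] by (simp add: D_def)
  qed
qed

end

lemma bounded_spectral_theorem:
  fixes C :: "'a::chilbert_space \<Rightarrow> 'a"
  assumes "bsym C"
  obtains E U where "pvm E" "U \<in> sets borel" "bounded U" "\<And>x. E U x = x" "pvm.bint E (\<lambda>t. t * indicator U t) = C"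
proof -
  obtain P where "spectral_family C P" using spectral_family_exists[OF assms] .
  then interpret spectral_family C P .
  obtain E where E0: "projection_valued_measure E" "\<And>a. E {..a} = P a" using pvm by blast
  then have pE: "pvm E" by unfold_locales
  interpret pvm E by fact
  obtain c where c: "c > 0" "\<And>a x. a \<le> - c \<Longrightarrow> P a x = 0" "\<And>a x. a \<ge> c \<Longrightarrow> P a x = x" using bounds by blast
  show ?thesis
  proof (rule that[OF pE, of "{- c<..c}"])
    have "{..- c} \<union> {- c<..c} = {..c}" "{..- c} \<inter> {- c<..c} = {}" using c(1) by auto
    hence "E {..c} x = E {..- c} x + E {- c<..c} x" for x
      using E_add[of "{..- c}" "{- c<..c}"] by simp
    thus "E {- c<..c} x = x" for x using c(2)[of "- c" x] c(3)[of c x] by (simp add: E0(2))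
    show "bint (\<lambda>t. t * indicator {- c<..c} t) = C" by (rule bint_eq[OF pE E0(2) c])
  qed auto
qed

section \<open>Image measures and the gap of the spectrum around 0\<close>

context pvm
begin

definition image_pvm :: "(real \<Rightarrow> real) \<Rightarrow> real set \<Rightarrow> 'a \<Rightarrow> 'a" where
  "image_pvm \<phi> S = E (\<phi> -` S)"

lemma pvm_image_pvm:
  assumes \<phi>: "\<phi> \<in> borel_measurable borel" shows "pvm (image_pvm \<phi>)"
proof
  have m: "\<phi> -` S \<in> sets borel" if "S \<in> sets borel" for S
    using measurable_sets[OF \<phi> that] by simp
  show "projection_valued_measure (image_pvm \<phi>)"
    unfolding projection_valued_measure_def image_pvm_def
  proof (intro conjI ballI allI impI)
    show "oproj (E (\<phi> -` S))" if "S \<in> sets borel" for S by (rule E[OF m[OF that]])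
    show "E (\<phi> -` UNIV) = id" using E_UNIV by (simp add: fun_eq_iff)
    fix F :: "nat \<Rightarrow> real set" and x
    assume F: "range F \<subseteq> sets borel" "disjoint_family F"
    have "(\<lambda>n. E (\<phi> -` F n) x) sums E (\<Union>n. \<phi> -` F n) x"
      by (rule E_sums) (use F m in \<open>auto simp: disjoint_family_on_def\<close>)
    thus "(\<lambda>n. E (\<phi> -` F n) x) sums E (\<phi> -` (\<Union>n. F n)) x" by (simp add: vimage_UN)
  qed
qed

lemma bint_image_pvm:
  assumes \<phi> [measurable]: "\<phi> \<in> borel_measurable borel" and g: "bdd_borel g"
  shows "pvm.bint (image_pvm \<phi>) g = bint (\<lambda>t. g (\<phi> t))"
proof -
  interpret im: pvm "image_pvm \<phi>" by (rule pvm_image_pvm[OF \<phi>])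
  note [measurable] = bdd_borel_meas[OF g]
  have gp: "bdd_borel (\<lambda>t. g (\<phi> t))"
  proof -
    obtain c where "\<And>t. \<bar>g t\<bar> \<le> c" using bdd_borel_bound[OF g] by blast
    moreover have "(\<lambda>t. g (\<phi> t)) \<in> borel_measurable borel" by measurable
    ultimately show ?thesis by (intro bdd_borelI)
  qed
  have "im.\<mu> x = distr (\<mu> x) borel \<phi>" for x
  proof (rule measure_eqI)
    fix S assume "S \<in> sets (im.\<mu> x)"
    hence S: "S \<in> sets borel" by simp
    hence "\<phi> -` S \<in> sets borel" using measurable_sets[OF \<phi> S] by simp
    thus "emeasure (im.\<mu> x) S = emeasure (distr (\<mu> x) borel \<phi>) S"
      using S by (simp add: im.emeasure_mu emeasure_distr emeasure_mu image_pvm_def)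
  qed simp
  hence "im.represents g (bint (\<lambda>t. g (\<phi> t)))"
    by (auto simp: im.represents_def bint_bsym gp bint_form integral_distr)
  thus ?thesis by (rule im.bint_eqI[OF g])
qed

text \<open>The spectral measure of \<open>inv_map C\<close> is a matter of choice, so its support
  has to be derived from the operator identity. On the range of \<open>E S\<close> the operator
  \<open>inv_map C\<close> multiplies norms by at most \<open>e\<close>, and \<open>C\<close> then
  recovers the vector at the cost of a factor \<open>c\<close>; as \<open>c * e = 1 / 2\<close>, the
  vector is 0.\<close>

lemma spectral_gap:
  assumes C: "bsym C" "inj C" and eq: "spectral_integral E (\<lambda>t. t) = inv_map C"
  obtains \<epsilon> where "\<epsilon> > 0" "\<And>x. E {t. \<epsilon> \<le> \<bar>t\<bar>} x = x"
proof -
  obtain c where c: "c > 0" "\<And>x. norm (C x) \<le> c * norm x" using bsym_bound[OF C(1)] by blast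
  define e where "e = 1 / (2 * c)"
  define S where "S = {t::real. \<bar>t\<bar> < e}"
  have e: "e > 0" using c(1) by (simp add: e_def)
  have S: "S \<in> sets borel" unfolding S_def by measurable
  define g where "g t = t * indicator S t" for t
  have ge: "\<bar>g t\<bar> \<le> e" for t using e by (auto simp: g_def S_def indicator_def)
  have g: "bdd_borel g" by (rule bdd_borelI[OF _ ge]) (use S in \<open>auto simp: g_def[abs_def]\<close>)
  obtain k where k: "e \<le> real k" using real_arch_simple by blast
  have ES: "E S x = 0" for x
  proof -
    have "bint (trunc (\<lambda>t. t) n) (E S x) = bint g x" if "n \<ge> k" for n
    proof -
      have "(\<lambda>t. trunc (\<lambda>t. t) n t * indicator S t) = g"
        using that k by (auto simp: fun_eq_iff trunc_def g_def S_def indicator_def)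
      thus ?thesis using bint_E[OF trunc_bdd S, of "\<lambda>t. t" n x] by simp
    qed
    hence "(\<lambda>n. bint (trunc (\<lambda>t. t) n) (E S x)) \<longlonglongrightarrow> bint g x"
      by (intro tendsto_eventually) (auto simp: eventually_sequentially)
    hence "spectral_integral E (\<lambda>t. t) (E S x) = Some (bint g x)" by (simp add: spectral_integral_Some)
    hence "E S x = C (bint g x)" unfolding eq inv_map_Some[OF C(2)] .
    moreover have "bint g x = bint g (E S x)"
    proof -
      have "(\<lambda>t. g t * indicator S t) = g" by (auto simp: fun_eq_iff g_def indicator_def)
      thus ?thesis using bint_E[OF g S, of x] by simp
    qed
    ultimately have "norm (E S x) \<le> c * norm (bint g (E S x))" using c(2) by metis
    also have "\<dots> \<le> c * (e * norm (E S x))" using c(1) bint_norm_le[OF g ge] by simp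
    also have "\<dots> = norm (E S x) / 2" using c(1) by (simp add: e_def)
    finally show ?thesis by simp
  qed
  have "E (- S) x = x" for x
    using E_add[of S "- S"] S by (simp add: fun_eq_iff E_UNIV ES)
  moreover have "- S = {t. e \<le> \<bar>t\<bar>}" by (auto simp: S_def)
  ultimately show ?thesis using that[OF e] by simp
qed

end

theorem spectral_theorem_inv_map:
  fixes C :: "'a::chilbert_space \<Rightarrow> 'a"
  assumes C: "bsym C" "inj C"
  obtains E where "projection_valued_measure E" "spectral_integral E (\<lambda>t. t) = inv_map C"
proof -
  obtain E U where EU: "pvm E" "U \<in> sets borel" "bounded U" "\<And>x. E U x = x" "pvm.bint E (\<lambda>t. t * indicator U t) = C"
    using bounded_spectral_theorem[OF C(1)] by blast
  interpret pvm E by fact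
  note U [measurable] = EU(2)
  interpret im: pvm "image_pvm inverse" by (rule pvm_image_pvm) simp
  let ?g = "\<lambda>t. t * indicator U t"
  obtain c where c: "\<And>t. t \<in> U \<Longrightarrow> \<bar>t\<bar> \<le> c" using \<open>bounded U\<close> by (auto simp: bounded_iff)
  have ge: "\<bar>?g t\<bar> \<le> \<bar>c\<bar>" for t using c[of t] by (auto simp: indicator_def)
  have g: "bdd_borel ?g" by (rule bdd_borelI[OF _ ge]) simp
  have gi: "bdd_borel (\<lambda>t. ?g (inverse t))" by (rule bdd_borelI[OF _ ge]) simp
  \<comment> \<open>Injectivity of \<open>C\<close> excludes mass at 0, where \<open>inverse\<close>
    takes the default value 0.\<close>
  have "E {0} x = 0" for x
  proof -
    have "(\<lambda>t. ?g t * indicator {0} t) = (\<lambda>t. 0)" by (auto simp: indicator_def)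
    hence "C (E {0} x) = C 0" using bint_E[OF g, of "{0}" x] bsym_zero[OF C(1)] by (simp add: EU(5) bint_const)
    thus ?thesis using C(2) by (simp add: inj_eq)
  qed
  hence E0: "E (- {0}) x = x" for x
    using E_add[of "{0}" "- {0}"] by (simp add: fun_eq_iff E_UNIV)
  let ?V = "{t. t \<noteq> 0 \<and> inverse t \<in> U}"
  have V: "?V \<in> sets borel" by measurable
  have "inverse -` ?V = U \<inter> (- {0::real})" by auto
  hence EV: "image_pvm inverse ?V x = x" for x
    using E_Int[of U "- {0}" x] U by (simp add: image_pvm_def EU(4) E0)
  have "spectral_integral (image_pvm inverse) (\<lambda>t. t) = inv_map (im.bint (\<lambda>t. ?g (inverse t)))"
    by (rule im.spectral_integral_inverse(2)[OF _ gi V EV]) (auto simp: indicator_def)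
  also have "im.bint (\<lambda>t. ?g (inverse t)) = C"
    using bint_image_pvm[OF _ gi, of inverse] by (simp add: EU(5))
  finally show ?thesis using that im.pvm by blast
qed

section \<open>Self-adjoint operators and their bounded inverses\<close>

lemma selfadjoint_symmetric:
  assumes "selfadjoint T" "x \<in> dom T" "y \<in> dom T"
  shows "cinner (the (T x)) y = cinner x (the (T y))"
proof -
  have dense: "closure (dom T) = UNIV" and adj: "adjoint_op T = T"
    using assms(1) by (auto simp: selfadjoint_def densely_defined_def)
  let ?Q = "\<lambda>z. \<forall>y\<in>dom T. cinner x (the (T y)) = cinner z y"
  have "adjoint_op T x \<noteq> None" using assms(2) by (auto simp: adj)
  hence "\<exists>z. ?Q z" and eq: "T x = Some (THE z. ?Q z)"
    by (auto simp: adjoint_op_def fun_cong[OF adj, of x, symmetric] split: if_splits)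
  then obtain z where z: "?Q z" by blast
  \<comment> \<open>\<open>adjoint_op\<close> hides the vector behind \<open>THE\<close>; density of
    the domain makes it unique.\<close>
  have "(THE z. ?Q z) = z"
  proof (rule the_equality[of ?Q, OF z])
    fix w assume "?Q w"
    with z show "w = z" by (intro cinner_ext_dense[OF dense]) auto
  qed
  with eq z assms(3) show ?thesis by simp
qed

lemma selfadjoint_inverse:
  assumes T: "selfadjoint T" "has_bounded_inverse T"
  obtains C where "bsym C" "inj C" "T = inv_map C"
proof -
  from T have i: "inj_on T (dom T)" and r: "ran T = UNIV" and b: "bounded_op (inverse_op T)"
    by (auto simp: has_bounded_inverse_def)
  have "\<exists>x. T x = Some y" for y using r unfolding ran_def by blast
  then obtain C where C: "\<And>y. T (C y) = Some y" by metis
  have uniq: "x = C y" if "T x = Some y" for x y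
    by (rule inj_onD[OF i]) (use that C in auto)
  have inj: "inj C" by (rule injI) (metis C option.inject)
  have "inverse_op T y = Some (C y)" for y
    unfolding inverse_op_def r using C uniq by (auto intro!: the_equality)
  then obtain c where "\<And>y. norm (C y) \<le> c * norm y" using b by (auto simp: bounded_op_def dom_def)
  moreover have "cinner (C x) y = cinner x (C y)" for x y
    using selfadjoint_symmetric[OF T(1), of "C x" "C y"] C by (simp add: domI)
  ultimately have "bsym C" by (intro bsymI)
  moreover have "T = inv_map C"
    by (rule option_map_eqI) (use uniq C in \<open>auto simp: inv_map_Some[OF inj]\<close>)
  ultimately show ?thesis using inj that by blast
qed

text \<open>The spectral measure of \<open>inv_map C\<close> lives on \<open>{t. \<epsilon> \<le> \<bar>t\<bar>}\<close>, so \<open>f\<close> and \<open>g\<close> matter only there.\<close>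

theorem fun_calc_inv_map:
  fixes C :: "'a::chilbert_space \<Rightarrow> 'a"
  assumes C: "bsym C" "inj C"
  obtains E \<epsilon> where "pvm E" "\<epsilon> > 0" 
    "C = pvm.bint E (\<lambda>t. inverse t * indicator {t. \<epsilon> \<le> \<bar>t\<bar>} t)"
    "\<And>f g. f \<in> borel_measurable borel \<Longrightarrow> bdd_borel g \<Longrightarrow> (\<And>t. \<epsilon> \<le> \<bar>t\<bar> \<Longrightarrow> f t * g t = 1) \<Longrightarrow>
       inj (pvm.bint E g) \<and> closure (range (pvm.bint E g)) = UNIV \<and> fun_calc f (inv_map C) = inv_map (pvm.bint E g)"
    "\<And>f g x. f \<in> borel_measurable borel \<Longrightarrow> bdd_borel g \<Longrightarrow> (\<And>t. \<epsilon> \<le> \<bar>t\<bar> \<Longrightarrow> f t = g t) \<Longrightarrow>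
       fun_calc f (inv_map C) x = Some (pvm.bint E g x)"
    "\<And>g h. bdd_borel g \<Longrightarrow> bdd_borel h \<Longrightarrow> (\<And>t. \<epsilon> \<le> \<bar>t\<bar> \<Longrightarrow> g t = h t) \<Longrightarrow> pvm.bint E g = pvm.bint E h"
proof -
  \<comment> \<open>The measure inside \<open>fun_calc\<close> is whatever \<open>SOME\<close>
    picks, so all that is available about it are the defining properties \<open>?Q\<close>.\<close>
  define E where "E = spectral_measure (inv_map C)"
  let ?Q = "\<lambda>E. projection_valued_measure E \<and> spectral_integral E (\<lambda>t. t) = inv_map C"
  obtain E' where "?Q E'" by (rule spectral_theorem_inv_map[OF C]) auto
  hence "?Q E" unfolding E_def spectral_measure_def by (rule someI[of ?Q])
  hence pE: "pvm E" and id: "spectral_integral E (\<lambda>t. t) = inv_map C" by (auto simp: pvm_def)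
  interpret pvm E by fact
  obtain e where e: "e > 0" "\<And>x. E {t. e \<le> \<bar>t\<bar>} x = x" using spectral_gap[OF C id] by blast
  have U: "{t. e \<le> \<bar>t\<bar>} \<in> sets borel" by measurable
  let ?g = "\<lambda>t. inverse t * indicator {t. e \<le> \<bar>t\<bar>} t"
  have g: "bdd_borel ?g"
  proof (rule bdd_borelI[of _ "inverse e"])
    show "?g \<in> borel_measurable borel" using U by simp
    show "\<bar>?g t\<bar> \<le> inverse e" for t
      using e(1) le_imp_inverse_le[of e "\<bar>t\<bar>"] by (simp add: indicator_def abs_inverse)
  qed
  have "t * ?g t = 1" if "t \<in> {t. e \<le> \<bar>t\<bar>}" for t
    using that e(1) by (auto simp: indicator_def)
  from spectral_integral_inverse[OF _ g U e(2), of "\<lambda>t. t", OF _ this]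
  have "inj (bint ?g)" "inv_map C = inv_map (bint ?g)" by (simp_all add: id)
  hence "C y = bint ?g y" for y
    using inv_map_Some[OF C(2), of "C y" y] inv_map_Some[of "bint ?g" "C y" y] by simp
  hence C_eq: "C = bint ?g" by blast
  have fc: "fun_calc f (inv_map C) = spectral_integral E f" for f
    by (simp add: fun_calc_def E_def)
  show ?thesis
  proof (rule that[OF pE e(1) C_eq])
    fix f g :: "real \<Rightarrow> real"
    assume fg: "f \<in> borel_measurable borel" "bdd_borel g"
    show "inj (bint g) \<and> closure (range (bint g)) = UNIV \<and> fun_calc f (inv_map C) = inv_map (bint g)"
      if "\<And>t. e \<le> \<bar>t\<bar> \<Longrightarrow> f t * g t = 1"
      using spectral_integral_inverse[OF fg U e(2)] sint_dense[OF fg(1)] that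
      by (simp add: fc dom_inv_map flip: spectral_integral_eq_sint[OF fg(1)])
    show "fun_calc f (inv_map C) x = Some (bint g x)" if "\<And>t. e \<le> \<bar>t\<bar> \<Longrightarrow> f t = g t" for x
      using spectral_integral_bounded[OF fg U e(2)] that by (simp add: fc)
  next
    fix g h
    assume "bdd_borel g" "bdd_borel h" "\<And>t. e \<le> \<bar>t\<bar> \<Longrightarrow> g t = h t"
    thus "bint g = bint h" by (intro bint_cong[OF _ _ U e(2)]) auto
  qed
qed

section \<open>Range inclusions and the equivalences\<close>

text \<open>By Baire's theorem one of the closed sets \<open>F n\<close> contains a ball, and
  functionals \<open>rip a\<close> that are jointly bounded on a ball have jointly bounded
  norms.\<close>

lemma uniform_boundedness:
  fixes S :: "'a::chilbert_space set"
  assumes bd: "\<And>y. \<exists>K. \<forall>a\<in>S. \<bar>rip a y\<bar> \<le> K"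
  shows "\<exists>K. \<forall>a\<in>S. norm a \<le> K"
proof -
  define F where "F n = (\<Inter>a\<in>S. {y. \<bar>rip a y\<bar> \<le> real n})" for n
  have cont: "continuous_on UNIV (rip a)" for a :: 'a
    by (rule linear_continuous_on[OF bounded_linear_rip])
  have cl: "closed (F n)" for n
    unfolding F_def by (intro closed_INT ballI closed_Collect_le continuous_intros cont)
  have "(\<Union>n. F n) = UNIV"
  proof -
    have "\<exists>n. y \<in> F n" for y
    proof -
      obtain K where K: "\<forall>a\<in>S. \<bar>rip a y\<bar> \<le> K" using bd by blast
      obtain n where "K \<le> real n" using real_arch_simple by blast
      with K show ?thesis unfolding F_def by (intro exI[of _ n]) force
    qed
    thus ?thesis by auto
  qed
  moreover have "interior (\<Union>(range F)) = {}" if "\<And>n. interior (F n) = {}"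
  proof -
    have "Met_TC.mcomplete TYPE('a)" by (simp add: mcomplete_iff_complete complete_UNIV)
    from Met_TC.metric_Baire_category_alt[OF this, of "range F"] cl that show ?thesis by auto
  qed
  ultimately obtain n where "interior (F n) \<noteq> {}" by force
  then obtain x r where r: "r > 0" "cball x r \<subseteq> F n" by (meson ex_in_conv mem_interior_cball)
  show ?thesis
  proof (intro exI[of _ "2 * real n / r"] ballI)
    fix a assume a: "a \<in> S"
    \<comment> \<open>\<open>z\<close> points along \<open>a\<close>, where the functional
      \<open>rip a\<close> attains its norm; for \<open>a = 0\<close> the quotient is 0 and so is
      \<open>z\<close>.\<close>
    define z where "z = (r / norm a) *\<^sub>R a"
    have "norm z \<le> r" using r by (simp add: z_def)
    hence "x + z \<in> F n" "x \<in> F n" using r by (auto simp: dist_norm subset_iff)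
    hence "\<bar>rip a (x + z)\<bar> \<le> real n" "\<bar>rip a x\<bar> \<le> real n" using a by (auto simp: F_def)
    moreover have "rip a z = r * norm a"
      by (simp add: z_def rip_simps rip_self power2_eq_square)
    ultimately have "r * norm a \<le> 2 * real n" by (simp add: rip_simps)
    thus "norm a \<le> 2 * real n / r" using r by (simp add: field_simps)
  qed
qed

text \<open>One half of Douglas' range inclusion theorem.\<close>

lemma range_subset_imp_bound:
  assumes Q: "bsym Q" and L: "bounded_linear L'" and adj: "\<And>x y. rip (L' x) y = rip x (L y)" and sub: "range L \<subseteq> range Q"
  shows "\<exists>c. \<forall>x. norm (L' x) \<le> c * norm (Q x)"
proof -
  interpret L: bounded_linear L' by fact
  let ?S = "L' ` {x. norm (Q x) \<le> 1}"
  \<comment> \<open>Solving \<open>L y = Q z\<close> gives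
    \<open>rip (L' x) y = rip (Q x) z\<close>, which is bounded by \<open>norm z\<close> on all of
    \<open>?S\<close>.\<close>
  have "\<exists>K. \<forall>a\<in>?S. \<bar>rip a y\<bar> \<le> K" for y
  proof -
    obtain z where z: "L y = Q z" using sub by blast
    have "\<bar>rip (L' x) y\<bar> \<le> norm z" if "norm (Q x) \<le> 1" for x
    proof -
      have "\<bar>rip (L' x) y\<bar> = \<bar>rip (Q x) z\<bar>" by (simp add: adj z bsym_rip[OF Q])
      also have "\<dots> \<le> 1 * norm z" by (rule order_trans[OF abs_rip_le]) (intro mult_right_mono that, simp)
      finally show ?thesis by simp
    qed
    thus ?thesis by auto
  qed
  from uniform_boundedness[OF this] obtain K where K: "\<And>x. norm (Q x) \<le> 1 \<Longrightarrow> norm (L' x) \<le> K" by blast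
  have "norm (L' x) \<le> (\<bar>K\<bar> + 1) * norm (Q x)" for x
  proof (cases "Q x = 0")
    case False
    have "norm (Q ((1 / norm (Q x)) *\<^sub>R x)) \<le> 1" using False by (simp add: bsym_lin[OF Q])
    from K[OF this] have "norm (L' x) \<le> K * norm (Q x)" using False by (simp add: L.scaleR field_simps)
    also have "\<dots> \<le> (\<bar>K\<bar> + 1) * norm (Q x)" by (intro mult_right_mono) auto
    finally show ?thesis .
  next
    case True
    \<comment> \<open>If \<open>Q x = 0\<close>, the images of all positive multiples of
      \<open>x\<close> lie in \<open>?S\<close>, so a nonzero \<open>L' x\<close> would contradict
      the bound \<open>K\<close>.\<close>
    have "norm (L' x) * r \<le> K" if "r > 0" for r
      using K[of "r *\<^sub>R x"] that by (simp add: bsym_lin[OF Q] True L.scaleR mult.commute)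
    from this[of "(\<bar>K\<bar> + 1) / norm (L' x)"] have "L' x = 0"
      by (cases "L' x = 0") auto
    thus ?thesis by simp
  qed
  thus ?thesis by blast
qed

text \<open>The bound by itself points towards \<open>range Q \<subseteq> range G\<close>; the
  equality of the two products reverses it. The roles are abstract so that the pairs
  \<open>(G, M)\<close> and \<open>(Q, J)\<close> can be exchanged.\<close>

lemma range_subset_of_bound:
  assumes G: "bsym G" "closure (range G) = UNIV" and Q: "bsym Q" and M: "bsym M" "surj M" and J: "bsym J"
    and eq: "\<And>x. G (M (G x)) = Q (J (Q x))" and c: "\<And>x. norm (Q x) \<le> c * norm (G x)"
  shows "range G \<subseteq> range Q"
proof
  fix y assume "y \<in> range G"
  then obtain u where y: "y = G (M u)" using M(2) by (metis imageE surj_def)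
  have "u \<in> closure (range G)" by (simp add: G)
  then obtain s where s: "\<And>n. s n \<in> range G" "s \<longlonglongrightarrow> u" unfolding closure_sequential by blast
  have "\<forall>n. \<exists>v. s n = G v" using s(1) by auto
  then obtain v where v: "\<And>n. s n = G (v n)" by metis
  have "Cauchy (\<lambda>n. Q (v n))"
  proof (rule CauchyI)
    fix e :: real assume e: "e > 0"
    have "e / (\<bar>c\<bar> + 1) > 0" using e by simp
    from CauchyD[OF LIMSEQ_imp_Cauchy[OF s(2)] this] obtain k where
      k: "\<And>m n. m \<ge> k \<Longrightarrow> n \<ge> k \<Longrightarrow> norm (s m - s n) < e / (\<bar>c\<bar> + 1)" by blast
    have "norm (Q (v m) - Q (v n)) < e" if "m \<ge> k" "n \<ge> k" for m n
    proof -
      have "norm (Q (v m) - Q (v n)) \<le> c * norm (s m - s n)"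
        using c[of "v m - v n"] by (simp add: bsym_lin[OF Q] bsym_lin[OF G(1)] v)
      also have "\<dots> \<le> (\<bar>c\<bar> + 1) * norm (s m - s n)" by (intro mult_right_mono) auto
      also have "\<dots> < e" using k[OF that] by (simp add: field_simps)
      finally show ?thesis .
    qed
    thus "\<exists>k. \<forall>m\<ge>k. \<forall>n\<ge>k. norm (Q (v m) - Q (v n)) < e" by blast
  qed
  then obtain w where w: "(\<lambda>n. Q (v n)) \<longlonglongrightarrow> w" by (auto simp: Cauchy_convergent_iff convergent_def)
  \<comment> \<open>Convergence is known for \<open>Q (v n)\<close> and not for \<open>v n\<close>
    itself; \<open>J w\<close> is the preimage of \<open>y\<close> all the same.\<close>
  have "y = Q (J w)"
  proof (rule LIMSEQ_unique)
    show "(\<lambda>n. Q (J (Q (v n)))) \<longlonglongrightarrow> Q (J w)" by (rule bsym_tendsto[OF Q bsym_tendsto[OF J w]])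
    show "(\<lambda>n. Q (J (Q (v n)))) \<longlonglongrightarrow> y"
      unfolding eq[symmetric] v[symmetric] y by (rule bsym_tendsto[OF G(1) bsym_tendsto[OF M(1) s(2)]])
  qed
  thus "y \<in> range Q" by simp
qed

section \<open>Operators given by a parametrized graph\<close>

lemma symmetric_op_paramI:
  fixes T :: "'a::chilbert_space \<rightharpoonup> 'a"
  assumes T: "\<And>x z. T x = Some z \<longleftrightarrow> (\<exists>y. x = L y \<and> z = N y)"
    and lin: "\<And>x y. L (x + y) = L x + L y" "\<And>c x. L (c *\<^sub>C x) = c *\<^sub>C L x" "L 0 = 0"
      "\<And>x y. N (x + y) = N x + N y" "\<And>c x. N (c *\<^sub>C x) = c *\<^sub>C N x" "N 0 = 0"
    and dense: "closure (range L) = UNIV" and sym: "\<And>x y. cinner (N x) (L y) = cinner (L x) (N y)"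
  shows "symmetric_op T"
proof -
  have dom: "dom T = range L" by (auto simp: dom_def T)
  have TL: "T (L y) = Some (N y)" for y using T by blast
  show ?thesis
    unfolding symmetric_op_def linear_op_def densely_defined_def dom
  proof (intro conjI allI ballI)
    show "T 0 = Some 0" using TL[of 0] by (simp add: lin)
    show "T (x + y) = Some (the (T x) + the (T y))" if "x \<in> range L" "y \<in> range L" for x y
      using that by (auto simp: TL simp flip: lin)
    show "T (c *\<^sub>C x) = Some (c *\<^sub>C the (T x))" if "x \<in> range L" for c x
      using that by (auto simp: TL simp flip: lin)
    show "cinner (the (T x)) y = cinner x (the (T y))" if "x \<in> range L" "y \<in> range L" for x y
      using that by (auto simp: TL sym)
  qed (fact dense)
qed

lemma bounded_op_paramI:
  assumes T: "\<And>x z. T x = Some z \<longleftrightarrow> (\<exists>y. x = L y \<and> z = N y)"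
  shows "bounded_op T \<longleftrightarrow> (\<exists>c. \<forall>y. norm (N y) \<le> c * norm (L y))"
proof -
  have dom: "dom T = range L" by (auto simp: dom_def T)
  have TL: "T (L y) = Some (N y)" for y using T by blast
  show ?thesis by (simp add: bounded_op_def dom TL)
qed

text \<open>(d) differs from the boundedness of \<open>X\<close> and of \<open>Y\<close> by a factor
  \<open>M\<close> on one side, and \<open>M\<close> is bounded from above and from below.\<close>

lemma ex_bound_comparison:
  assumes "\<And>y. norm (N' y) \<le> a * norm (N y)" "\<And>y. norm (L y) \<le> b * norm (L' y)" "a \<ge> (0::real)"
    and "\<exists>c. \<forall>y. norm (N y) \<le> c * norm (L y)"
  shows "\<exists>c. \<forall>y. norm (N' y) \<le> c * norm (L' y)"
proof -
  obtain c where c: "\<And>y. norm (N y) \<le> c * norm (L y)" using assms(4) by blast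
  have "norm (N' y) \<le> (a * (\<bar>c\<bar> * b)) * norm (L' y)" for y
  proof -
    have "norm (N y) \<le> \<bar>c\<bar> * norm (L y)" by (rule order_trans[OF c]) (intro mult_right_mono, auto)
    also have "\<dots> \<le> \<bar>c\<bar> * (b * norm (L' y))" by (intro mult_left_mono assms) auto
    finally have "a * norm (N y) \<le> a * (\<bar>c\<bar> * (b * norm (L' y)))" by (rule mult_left_mono) fact
    thus ?thesis using assms(1)[of y] by (simp add: ac_simps)
  qed
  thus ?thesis by blast
qed

section \<open>The square root of \<open>A\<close> and the polar decomposition of
  \<open>B\<close>\<close>

lemma inverse_sqrt_bdd:
  assumes "e > 0"
  shows "bdd_borel (\<lambda>t. inverse (sqrt t) * indicator {t. e \<le> \<bar>t\<bar>} t)"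
    "bdd_borel (\<lambda>t. inverse (sqrt \<bar>t\<bar>) * indicator {t. e \<le> \<bar>t\<bar>} t)"
    "bdd_borel (\<lambda>t. inverse \<bar>t\<bar> * indicator {t. e \<le> \<bar>t\<bar>} t)"
    "bdd_borel (\<lambda>t. inverse t * indicator {t. e \<le> \<bar>t\<bar>} t)"
proof -
  have [measurable]: "{t::real. e \<le> \<bar>t\<bar>} \<in> sets borel" by measurable
  have s: "inverse (sqrt \<bar>t\<bar>) \<le> inverse (sqrt e)" "inverse \<bar>t\<bar> \<le> inverse e" if "e \<le> \<bar>t\<bar>" for t
    using that assms by (auto intro!: le_imp_inverse_le)
  \<comment> \<open>\<open>sqrt\<close> is odd, so
    \<open>\<bar>sqrt t\<bar> = sqrt \<bar>t\<bar>\<close> covers negative \<open>t\<close> as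
    well.\<close>
  show "bdd_borel (\<lambda>t. inverse (sqrt t) * indicator {t. e \<le> \<bar>t\<bar>} t)"
    "bdd_borel (\<lambda>t. inverse (sqrt \<bar>t\<bar>) * indicator {t. e \<le> \<bar>t\<bar>} t)"
    by (rule bdd_borelI[of _ "inverse (sqrt e)"],
        use s(1) assms in \<open>auto simp: indicator_def abs_mult real_sqrt_abs'[symmetric]\<close>)+
  show "bdd_borel (\<lambda>t. inverse \<bar>t\<bar> * indicator {t. e \<le> \<bar>t\<bar>} t)"
    "bdd_borel (\<lambda>t. inverse t * indicator {t. e \<le> \<bar>t\<bar>} t)"
    by (rule bdd_borelI[of _ "inverse e"],
        use s(2) assms in \<open>auto simp: indicator_def abs_mult\<close>)+
qed

text \<open>A positive infimum keeps 0 out of the spectrum; since the operator shifted by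
  \<open>z = 0\<close> is \<open>A\<close> itself, \<open>A\<close> has a bounded inverse. The gap
  around 0 then makes \<open>inverse (sqrt t)\<close> a bounded function.\<close>

lemma sqrt_inverse:
  assumes A: "selfadjoint A" "(INF z\<in>spectrum A. ereal (Re z)) > 0"
  obtains G where "bsym G" "inj G" "closure (range G) = UNIV" "fun_calc sqrt A = inv_map G"
proof -
  have "0 \<notin> spectrum A"
  proof
    assume "0 \<in> spectrum A"
    hence "(INF z\<in>spectrum A. ereal (Re z)) \<le> ereal (Re 0)" by (rule INF_lower)
    thus False using A(2) by (simp add: zero_ereal_def)
  qed
  moreover have "(0::complex) *\<^sub>C x = 0" for x :: 'a using scaleR_scaleC[of 0 x] by simp
  ultimately have "has_bounded_inverse A" by (simp add: spectrum_def option.map_ident)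
  then obtain C where C: "bsym C" "inj C" "A = inv_map C" using selfadjoint_inverse[OF A(1)] by blast
  show ?thesis
  proof (rule fun_calc_inv_map[OF C(1,2)])
    fix E e
    assume pE: "pvm E" "e > 0"
     "\<And>f g. f \<in> borel_measurable borel \<Longrightarrow> bdd_borel g \<Longrightarrow> (\<And>t. e \<le> \<bar>t\<bar> \<Longrightarrow> f t * g t = 1) \<Longrightarrow>
       inj (pvm.bint E g) \<and> closure (range (pvm.bint E g)) = UNIV \<and> fun_calc f (inv_map C) = inv_map (pvm.bint E g)"
    let ?g = "\<lambda>t. inverse (sqrt t) * indicator {t. e \<le> \<bar>t\<bar>} t"
    have g: "bdd_borel ?g" by (rule inverse_sqrt_bdd[OF pE(2)])
    have "sqrt t * ?g t = 1" if "e \<le> \<bar>t\<bar>" for t using that pE(2) by auto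
    from pE(3)[OF _ g this] have *: "inj (pvm.bint E ?g)" "closure (range (pvm.bint E ?g)) = UNIV"
      "fun_calc sqrt A = inv_map (pvm.bint E ?g)" by (simp_all add: C(3))
    show thesis by (rule that[OF pvm.bint_bsym[OF pE(1) g] *])
  qed
qed

text \<open>Each identity is one between functions where \<open>e \<le> \<bar>t\<bar>\<close>,
  chiefly \<open>sgn t * q t * q t = inverse t\<close>. The zero of \<open>sgn\<close> lies outside
  this set, so \<open>J\<close> is an involution.\<close>

lemma polar_decomposition:
  fixes C :: "'a::chilbert_space \<Rightarrow> 'a"
  assumes C: "bsym C" "inj C"
  obtains J Q where "bsym J" "bsym Q" "closure (range Q) = UNIV" "\<And>x. J (J x) = x" "\<And>x. J (Q x) = Q (J x)"
    "\<And>x. C x = Q (J (Q x))" "inj (\<lambda>x. Q (Q x))"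
    "fun_calc (\<lambda>t. sqrt \<bar>t\<bar>) (inv_map C) = inv_map Q"
    "fun_calc abs (inv_map C) = inv_map (\<lambda>x. Q (Q x))"
    "fun_calc (\<lambda>t. inverse \<bar>t\<bar>) (inv_map C) = (\<lambda>x. Some (Q (Q x)))"
    "fun_calc sgn (inv_map C) = (\<lambda>x. Some (J x))"
proof (rule fun_calc_inv_map[OF C])
  fix E e
  assume pE: "pvm E" "e > 0" "C = pvm.bint E (\<lambda>t. inverse t * indicator {t. e \<le> \<bar>t\<bar>} t)"
    and unb: "\<And>f g. f \<in> borel_measurable borel \<Longrightarrow> bdd_borel g \<Longrightarrow> (\<And>t. e \<le> \<bar>t\<bar> \<Longrightarrow> f t * g t = 1) \<Longrightarrow>
       inj (pvm.bint E g) \<and> closure (range (pvm.bint E g)) = UNIV \<and> fun_calc f (inv_map C) = inv_map (pvm.bint E g)"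
    and bd: "\<And>f g x. f \<in> borel_measurable borel \<Longrightarrow> bdd_borel g \<Longrightarrow> (\<And>t. e \<le> \<bar>t\<bar> \<Longrightarrow> f t = g t) \<Longrightarrow>
       fun_calc f (inv_map C) x = Some (pvm.bint E g x)"
    and cong: "\<And>g h. bdd_borel g \<Longrightarrow> bdd_borel h \<Longrightarrow> (\<And>t. e \<le> \<bar>t\<bar> \<Longrightarrow> g t = h t) \<Longrightarrow> pvm.bint E g = pvm.bint E h"
  interpret pvm E by fact
  let ?U = "{t. e \<le> \<bar>t\<bar>}"
  define q where "q t = inverse (sqrt \<bar>t\<bar>) * indicator ?U t" for t
  define d where "d t = inverse \<bar>t\<bar> * indicator ?U t" for t
  define i where "i t = inverse t * indicator ?U t" for t
  have q: "bdd_borel q" and d: "bdd_borel d" and i: "bdd_borel i"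
    unfolding q_def[abs_def] d_def[abs_def] i_def[abs_def] by (rule inverse_sqrt_bdd[OF pE(2)])+
  have s: "bdd_borel (sgn :: real \<Rightarrow> real)" by (rule bdd_borelI[of _ 1]) (auto simp: sgn_real_def)
  have C_eq: "C x = bint i x" for x using pE(3) by (simp add: i_def[abs_def])
  have qq: "bint q (bint q x) = bint d x" for x
    unfolding bint_mult[OF q q]
    by (rule fun_cong[OF cong[OF bdd_borel_mult[OF q q] d]]) (simp add: q_def d_def flip: inverse_mult_distrib)
  have sg: "sgn t * inverse \<bar>t\<bar> = inverse t" for t :: real by (auto simp: sgn_real_def)
  show thesis
  proof (rule that[of "bint sgn" "bint q"])
    show "bsym (bint sgn)" "bsym (bint q)" by (intro bint_bsym s q)+
    show "bint sgn (bint sgn x) = x" for x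
    proof -
      have "bint (\<lambda>t. sgn t * sgn t) = bint (\<lambda>t. 1)"
        by (rule cong[OF bdd_borel_mult[OF s s] bdd_borel_const]) (use pE(2) in \<open>auto simp: sgn_real_def\<close>)
      thus ?thesis by (simp only: bint_mult[OF s s] bint_const) simp
    qed
    show c: "bint sgn (bint q x) = bint q (bint sgn x)" for x by (rule bint_commute[OF s q])
    show "C x = bint q (bint sgn (bint q x))" for x
      unfolding C_eq c[symmetric] qq bint_mult[OF s d]
      by (rule fun_cong[OF cong[OF i bdd_borel_mult[OF s d]]]) (simp add: i_def d_def sg)
    have "sqrt \<bar>t\<bar> * q t = 1" "\<bar>t\<bar> * d t = 1" if "e \<le> \<bar>t\<bar>" for t
      using that pE(2) by (auto simp: q_def d_def)
    with unb[OF _ q, of "\<lambda>t. sqrt \<bar>t\<bar>"] unb[OF _ d, of abs]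
    show "closure (range (bint q)) = UNIV" "fun_calc (\<lambda>t. sqrt \<bar>t\<bar>) (inv_map C) = inv_map (bint q)"
      "inj (\<lambda>x. bint q (bint q x))" "fun_calc abs (inv_map C) = inv_map (\<lambda>x. bint q (bint q x))"
      by (auto simp: qq)
    show "fun_calc sgn (inv_map C) = (\<lambda>x. Some (bint sgn x))"
      using bd[OF _ s] bdd_borel_meas[OF s] by auto
    have "inverse \<bar>t\<bar> = d t" if "e \<le> \<bar>t\<bar>" for t using that by (simp add: d_def)
    with bd[OF _ d, of "\<lambda>t. inverse \<bar>t\<bar>"]
    show "fun_calc (\<lambda>t. inverse \<bar>t\<bar>) (inv_map C) = (\<lambda>x. Some (bint q (bint q x)))"
      by (auto simp: qq)
  qed
qed

lemma inverse_op_inv_map: "inj C \<Longrightarrow> inverse_op (inv_map C) = (\<lambda>x. Some (C x))"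
proof
  fix y assume C: "inj C"
  have "y \<in> ran (inv_map C)" using inv_map_apply[OF C, of y] by (rule ranI)
  moreover have "(THE x. inv_map C x = Some y) = C y"
    by (rule the_equality) (auto simp: inv_map_Some[OF C])
  ultimately show "inverse_op (inv_map C) y = Some (C y)" by (simp add: inverse_op_def)
qed

text \<open>Boundedness of \<open>H\<close> bounds its inverse \<open>M\<close> from below, so
  \<open>range M\<close> is closed; as the domain of \<open>H\<close> it is also dense.\<close>

lemma surj_inverse:
  assumes H: "selfadjoint H" "bounded_op H" "H = inv_map M" and M: "bsym M" "inj M"
  obtains h where "h > 0" "\<And>y. norm y \<le> h * norm (M y)" "surj M"
proof -
  from H(2) obtain b where b: "\<And>x. x \<in> dom H \<Longrightarrow> norm (the (H x)) \<le> b * norm x" by (auto simp: bounded_op_def)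
  define h where "h = \<bar>b\<bar> + 1"
  have h: "norm y \<le> h * norm (M y)" for y
  proof -
    have "norm y \<le> b * norm (M y)" using b[of "M y"] M(2) by (simp add: H(3) domI)
    also have "\<dots> \<le> h * norm (M y)" unfolding h_def by (intro mult_right_mono) auto
    finally show ?thesis .
  qed
  have "surj M"
    unfolding surj_def
  proof
    fix x
    have "x \<in> closure (range M)"
      using H(1) unfolding selfadjoint_def densely_defined_def H(3) dom_inv_map by simp
    then obtain s where s: "\<And>n. s n \<in> range M" "s \<longlonglongrightarrow> x" unfolding closure_sequential by blast
    have "\<forall>n. \<exists>v. s n = M v" using s(1) by auto
    then obtain v where v: "\<And>n. s n = M (v n)" by metis
    have "Cauchy v"
    proof (rule CauchyI)
      fix e :: real assume "e > 0"
      hence "e / h > 0" by (simp add: h_def add_nonneg_pos)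
      from CauchyD[OF LIMSEQ_imp_Cauchy[OF s(2)] this] obtain k where
        k: "\<And>m n. m \<ge> k \<Longrightarrow> n \<ge> k \<Longrightarrow> norm (s m - s n) < e / h" by blast
      have "norm (v m - v n) < e" if "m \<ge> k" "n \<ge> k" for m n
      proof -
        have "norm (v m - v n) \<le> h * norm (s m - s n)"
          using h[of "v m - v n"] by (simp add: bsym_lin[OF M(1)] v)
        also have "\<dots> < e" using k[OF that] by (simp add: h_def pos_less_divide_eq mult.commute add_nonneg_pos)
        finally show ?thesis .
      qed
      thus "\<exists>k. \<forall>m\<ge>k. \<forall>n\<ge>k. norm (v m - v n) < e" by blast
    qed
    then obtain u where "v \<longlonglongrightarrow> u" by (auto simp: Cauchy_convergent_iff convergent_def)
    hence "s \<longlonglongrightarrow> M u" using bsym_tendsto[OF M(1), of v u] by (simp flip: v)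
    thus "\<exists>u. x = M u" using s(2) LIMSEQ_unique by blast
  qed
  thus ?thesis using h by (intro that[of h]) (auto simp: h_def)
qed

text \<open>Density of the domain of \<open>X\<close>: a continuous surjection carries dense sets to
  dense sets.\<close>

lemma closure_range_comp:
  assumes "bsym M" "surj M" "closure (range G) = UNIV"
  shows "closure (range (\<lambda>x. M (G x))) = UNIV"
proof -
  have "y \<in> closure (range (\<lambda>x. M (G x)))" for y
  proof -
    obtain u where u: "y = M u" using assms(2) by (metis surjD)
    have "u \<in> closure (range G)" by (simp add: assms(3))
    then obtain s where s: "\<And>n. s n \<in> range G" "s \<longlonglongrightarrow> u" unfolding closure_sequential by blast
    have "M (s n) \<in> range (\<lambda>x. M (G x))" for n using s(1)[of n] by auto
    with bsym_tendsto[OF assms(1) s(2)] show ?thesis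
      unfolding closure_sequential u by (intro exI[of _ "\<lambda>n. M (s n)"]) simp
  qed
  thus ?thesis by auto
qed

theorem theorem3p2:
  fixes A H R B S X Y K :: "'a::chilbert_space \<rightharpoonup> 'a"
  assumes A: "selfadjoint A" "(INF z\<in>spectrum A. ereal (Re z)) > 0"
    and H: "selfadjoint H" "bounded_op H" "has_bounded_inverse H"
    and R: "R = fun_calc sqrt A"
    and B: "B = R \<circ>\<^sub>m H \<circ>\<^sub>m R"
    and S: "S = fun_calc (\<lambda>t. sqrt \<bar>t\<bar>) B"
    and X: "X = inverse_op R \<circ>\<^sub>m fun_calc abs B \<circ>\<^sub>m inverse_op R"
    and Y: "Y = R \<circ>\<^sub>m fun_calc (\<lambda>t. inverse \<bar>t\<bar>) B \<circ>\<^sub>m R"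
    and K: "K = R \<circ>\<^sub>m fun_calc sgn B \<circ>\<^sub>m inverse_op R"
  shows "all_equivalent
    [dom S = dom R,
     dom R \<subseteq> dom S,
     dom S \<subseteq> dom R,
     dom X = (the \<circ> R) ` dom B \<and> symmetric_op X \<and> bounded_op X,
     dom Y = dom R \<and> symmetric_op Y \<and> bounded_op Y,
     dom K = UNIV \<and> bounded_op K \<and> K \<circ>\<^sub>m K = Some,
     (the \<circ> fun_calc sgn B) ` dom R \<subseteq> dom R]"
proof -
  obtain G where G: "bsym G" "inj G" "closure (range G) = UNIV" and R_eq: "R = inv_map G"
    unfolding R by (rule sqrt_inverse[OF A])
  obtain M where M: "bsym M" "inj M" and H_eq: "H = inv_map M"
    by (rule selfadjoint_inverse[OF H(1,3)])
  obtain h where h: "h > 0" "\<And>y. norm y \<le> h * norm (M y)" and surjM: "surj M"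
    by (rule surj_inverse[OF H(1,2) H_eq M]) (rule that, assumption+)
  obtain m where m: "m > 0" "\<And>y. norm (M y) \<le> m * norm y" using bsym_bound[OF M(1)] by blast
  define C where "C x = G (M (G x))" for x
  have C: "bsym C" unfolding C_def by (rule bsym_comp3[OF G(1) M(1)])
  have injC: "inj C" using inj_compose[OF G(2) inj_compose[OF M(2) G(2)]] by (simp add: comp_def C_def[abs_def])
  have B_eq: "B = inv_map C"
    unfolding B H_eq R_eq
    by (rule option_map_eqI) (auto simp: map_comp_Some_iff inv_map_Some G M injC C_def)
  obtain J Q where J: "bsym J" and Q: "bsym Q" "closure (range Q) = UNIV" and JJ: "\<And>x. J (J x) = x"
    and JQ: "\<And>x. J (Q x) = Q (J x)" and CQ: "\<And>x. C x = Q (J (Q x))"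
    and injQQ: "inj (\<lambda>x. Q (Q x))" and S_eq: "fun_calc (\<lambda>t. sqrt \<bar>t\<bar>) (inv_map C) = inv_map Q"
    and abs_eq: "fun_calc abs (inv_map C) = inv_map (\<lambda>x. Q (Q x))"
    and inv_eq: "fun_calc (\<lambda>t. inverse \<bar>t\<bar>) (inv_map C) = (\<lambda>x. Some (Q (Q x)))"
    and sgn_eq: "fun_calc sgn (inv_map C) = (\<lambda>x. Some (J x))"
    by (rule polar_decomposition[OF C injC]) (rule that, assumption+)
  have surjJ: "surj J" unfolding surj_def by (metis JJ)
  have GMG: "G (M (G x)) = Q (J (Q x))" for x using CQ by (simp add: C_def)
  have QQJ: "Q (Q (J y)) = G (M (G y))" for y by (simp add: GMG JQ)
  \<comment> \<open>Inserting \<open>J (J y) = y\<close> expresses the inverse of the absolute value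
    of \<open>B\<close> by \<open>G\<close>, \<open>M\<close> and \<open>J\<close>, which makes
    \<open>X\<close> and \<open>Y\<close> computable.\<close>
  have QQ: "Q (Q y) = G (M (G (J y)))" for y using QQJ[of "J y"] by (simp add: JJ)
  have JGMG: "J (G (M (G y))) = G (M (G (J y)))" for y by (simp add: GMG JQ JJ)
  have invR: "inverse_op R = (\<lambda>x. Some (G x))" by (simp add: R_eq inverse_op_inv_map G)

  have X_iff: "X x = Some z \<longleftrightarrow> (\<exists>y. x = M (G y) \<and> z = G (J y))" for x z
  proof -
    have "X x = Some z \<longleftrightarrow> (\<exists>k. G x = Q (Q k) \<and> z = G k)"
      unfolding X invR B_eq abs_eq by (auto simp: map_comp_Some_iff inv_map_Some injQQ)
    \<comment> \<open>Substituting \<open>k = J y\<close> turns \<open>Q (Q k)\<close> into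
      \<open>G (M (G y))\<close>, and injectivity of \<open>G\<close> cancels the outer
      factor.\<close>
    also have "\<dots> \<longleftrightarrow> (\<exists>y. x = M (G y) \<and> z = G (J y))"
      by (metis JJ QQJ G(2) injD)
    finally show ?thesis .
  qed
  have Y_iff: "Y x = Some z \<longleftrightarrow> (\<exists>y. x = G y \<and> z = M (G (J y)))" for x z
    unfolding Y R_eq B_eq inv_eq
    by (auto simp: map_comp_Some_iff inv_map_Some G QQ inj_eq[OF G(2)])
  have K_iff: "K x = Some z \<longleftrightarrow> J (G x) = G z" for x z
    unfolding K invR B_eq sgn_eq by (auto simp: map_comp_Some_iff R_eq inv_map_Some G)

  define d where "d \<longleftrightarrow> (\<exists>c. \<forall>y. norm (G (J y)) \<le> c * norm (G y))"
  have GQ: "range Q \<subseteq> range G" if sub: "range G \<subseteq> range Q"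
  proof -
    obtain c where "\<And>x. norm (G x) \<le> c * norm (Q x)"
      using range_subset_imp_bound[OF Q(1) bsym_bounded_linear[OF G(1)] bsym_rip[OF G(1)] sub] by blast
    thus ?thesis by (rule range_subset_of_bound[OF Q G(1) J surjJ M(1) GMG[symmetric]])
  qed
  have QG: "range G \<subseteq> range Q" if sub: "range Q \<subseteq> range G"
  proof -
    obtain c where "\<And>x. norm (Q x) \<le> c * norm (G x)"
      using range_subset_imp_bound[OF G(1) bsym_bounded_linear[OF Q(1)] bsym_rip[OF Q(1)] sub] by blast
    thus ?thesis by (rule range_subset_of_bound[OF G(1,3) Q(1) M(1) surjM J GMG])
  qed
  have dGQ: "range G \<subseteq> range Q" if d
  proof -
    from that obtain c where c: "\<And>y. norm (G (J y)) \<le> c * norm (G y)" by (auto simp: d_def)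
    have "norm (Q x) \<le> sqrt (m * \<bar>c\<bar>) * norm (G x)" for x
    proof (rule power2_le_imp_le)
      have "(norm (Q x))\<^sup>2 = rip (G x) (M (G (J x)))"
        using bsym_rip[OF Q(1), of x "Q x"] bsym_rip[OF G(1), of x "M (G (J x))"] by (simp add: QQ rip_self)
      also have "\<dots> \<le> norm (G x) * norm (M (G (J x)))" using abs_rip_le by (rule order_trans[OF abs_ge_self])
      also have "norm (M (G (J x))) \<le> m * norm (G (J x))" by (rule m)
      also have "norm (G (J x)) \<le> \<bar>c\<bar> * norm (G x)" by (rule order_trans[OF c]) (intro mult_right_mono, auto)
      finally show "(norm (Q x))\<^sup>2 \<le> (sqrt (m * \<bar>c\<bar>) * norm (G x))\<^sup>2"
        using m(1) by (simp add: power_mult_distrib mult_left_mono) (simp add: power2_eq_square ac_simps)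
    qed (use m in simp)
    thus ?thesis by (rule range_subset_of_bound[OF G(1,3) Q(1) M(1) surjM J GMG])
  qed
  define v where "v \<longleftrightarrow> (\<forall>x. J (G x) \<in> range G)"
  have Qv: "v" if eq: "range G = range Q"
    unfolding v_def
  proof
    fix x
    have "G x \<in> range Q" by (simp flip: eq)
    then obtain y where "G x = Q y" by blast
    hence "J (G x) = Q (J y)" by (simp add: JQ)
    thus "J (G x) \<in> range G" by (simp add: eq)
  qed
  have vd: "d" if v
  proof -
    \<comment> \<open>\<open>G J\<close> is the adjoint of \<open>J G\<close>: the range inclusion
      (v) for \<open>J G\<close> becomes the bound (d) for \<open>G J\<close>.\<close>
    have "range (\<lambda>x. J (G x)) \<subseteq> range G" using that by (auto simp: v_def)
    moreover have "bounded_linear (\<lambda>x. G (J x))"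
      by (rule bounded_linear_compose[OF bsym_bounded_linear[OF G(1)] bsym_bounded_linear[OF J]])
    ultimately show d
      unfolding d_def using range_subset_imp_bound[OF G(1), of "\<lambda>x. G (J x)" "\<lambda>x. J (G x)"]
      by (simp add: bsym_rip[OF G(1)] bsym_rip[OF J])
  qed

  have domS: "dom S = range Q" by (simp add: S B_eq S_eq dom_inv_map)
  have domR: "dom R = range G" by (simp add: R_eq dom_inv_map)
  \<comment> \<open>Either inclusion gives the other, hence equal ranges, then \<open>v\<close> and
    \<open>d\<close>; \<open>dGQ\<close> closes the circle.\<close>
  have e1: "dom S = dom R \<longleftrightarrow> d" and e2: "dom R \<subseteq> dom S \<longleftrightarrow> d" and e3: "dom S \<subseteq> dom R \<longleftrightarrow> d"
    and ev: "v \<longleftrightarrow> d"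
    unfolding domS domR using GQ QG dGQ Qv vd by blast+
  have e7: "(the \<circ> fun_calc sgn B) ` dom R \<subseteq> dom R \<longleftrightarrow> d"
    unfolding ev[symmetric] v_def domR B_eq sgn_eq by auto

  have "dom X = (the \<circ> R) ` dom B"
  proof -
    have "dom X = range (\<lambda>y. M (G y))" by (auto simp: dom_def X_iff)
    thus ?thesis unfolding B_eq dom_inv_map R_eq by (auto simp: image_image C_def G)
  qed
  moreover have "symmetric_op X"
  proof (rule symmetric_op_paramI[OF X_iff])
    show "closure (range (\<lambda>y. M (G y))) = UNIV" by (rule closure_range_comp[OF M(1) surjM G(3)])
    show "cinner (G (J x)) (M (G y)) = cinner (M (G x)) (G (J y))" for x y
      by (simp add: bsym_cinner[OF G(1)] bsym_cinner[OF J] bsym_cinner[OF M(1)] JGMG)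
  qed (use G(1) J M(1) in \<open>simp_all add: bsym_lin\<close>)
  moreover have "bounded_op X \<longleftrightarrow> d"
    unfolding bounded_op_paramI[OF X_iff] d_def
  proof
    show "\<exists>c. \<forall>y. norm (G (J y)) \<le> c * norm (G y)" if "\<exists>c. \<forall>y. norm (G (J y)) \<le> c * norm (M (G y))"
      by (rule ex_bound_comparison[where a = 1, OF _ m(2) _ that]) auto
    show "\<exists>c. \<forall>y. norm (G (J y)) \<le> c * norm (M (G y))" if "\<exists>c. \<forall>y. norm (G (J y)) \<le> c * norm (G y)"
      by (rule ex_bound_comparison[where a = 1, OF _ h(2) _ that]) auto
  qed
  ultimately have e4: "dom X = (the \<circ> R) ` dom B \<and> symmetric_op X \<and> bounded_op X \<longleftrightarrow> d" by simp

  have "dom Y = dom R" unfolding domR by (auto simp: dom_def Y_iff)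
  moreover have "symmetric_op Y"
  proof (rule symmetric_op_paramI[OF Y_iff])
    show "cinner (M (G (J x))) (G y) = cinner (G x) (M (G (J y)))" for x y
      by (simp add: bsym_cinner[OF G(1)] bsym_cinner[OF J] bsym_cinner[OF M(1)] JGMG)
  qed (use G(1,3) J M(1) in \<open>simp_all add: bsym_lin\<close>)
  moreover have "bounded_op Y \<longleftrightarrow> d"
    unfolding bounded_op_paramI[OF Y_iff] d_def
  proof
    show "\<exists>c. \<forall>y. norm (G (J y)) \<le> c * norm (G y)" if "\<exists>c. \<forall>y. norm (M (G (J y))) \<le> c * norm (G y)"
      by (rule ex_bound_comparison[where b = 1, OF h(2) _ _ that]) (use h(1) in auto)
    show "\<exists>c. \<forall>y. norm (M (G (J y))) \<le> c * norm (G y)" if "\<exists>c. \<forall>y. norm (G (J y)) \<le> c * norm (G y)"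
      by (rule ex_bound_comparison[where b = 1, OF m(2) _ _ that]) (use m(1) in auto)
  qed
  ultimately have e5: "dom Y = dom R \<and> symmetric_op Y \<and> bounded_op Y \<longleftrightarrow> d" by simp

  have domK: "dom K = UNIV \<longleftrightarrow> d"
    unfolding ev[symmetric] v_def by (auto simp: dom_def K_iff image_iff set_eq_iff)
  have "bounded_op K" if d
  proof -
    from that obtain c where c: "\<And>y. norm (G (J y)) \<le> c * norm (G y)" by (auto simp: d_def)
    have "norm z \<le> \<bar>c\<bar> * norm x" if xz: "K x = Some z" for x z
    proof -
      \<comment> \<open>The value \<open>z\<close> of \<open>K\<close> at \<open>x\<close> is tested
        against the dense range of \<open>G\<close>, where \<open>J\<close> can be moved to the
        other side and (d) applies; \<open>z\<close> itself is then reached as a limit.\<close>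
      have *: "rip z y \<le> norm x * (c * norm y)" if y: "y \<in> range G" for y
      proof -
        obtain w where w: "y = G w" using y by blast
        have "rip z y = rip (J (G x)) w" using xz by (simp add: K_iff w bsym_rip[OF G(1), symmetric])
        also have "\<dots> = rip x (G (J w))" by (simp add: bsym_rip[OF G(1)] bsym_rip[OF J])
        also have "\<dots> \<le> norm x * norm (G (J w))" using abs_rip_le by (rule order_trans[OF abs_ge_self])
        also have "\<dots> \<le> norm x * (c * norm y)" unfolding w by (intro mult_left_mono c) simp
        finally show ?thesis .
      qed
      have "z \<in> closure (range G)" by (simp add: G)
      then obtain s where s: "\<And>n. s n \<in> range G" "s \<longlonglongrightarrow> z" unfolding closure_sequential by blast
      have "rip z z \<le> norm x * (c * norm z)"
      proof (rule LIMSEQ_le)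
        show "(\<lambda>n. rip z (s n)) \<longlonglongrightarrow> rip z z" by (intro tendsto_rip tendsto_const s)
        show "(\<lambda>n. norm x * (c * norm (s n))) \<longlonglongrightarrow> norm x * (c * norm z)" by (intro tendsto_intros s)
      qed (use * s(1) in auto)
      hence "norm z \<le> c * norm x" if "z \<noteq> 0"
        using that by (simp add: rip_self power2_eq_square mult.commute)
      moreover have "c * norm x \<le> \<bar>c\<bar> * norm x" by (intro mult_right_mono) auto
      ultimately show "norm z \<le> \<bar>c\<bar> * norm x" by (cases "z = 0") auto
    qed
    thus ?thesis unfolding bounded_op_def by (intro exI[of _ "\<bar>c\<bar>"]) auto
  qed
  moreover have "K \<circ>\<^sub>m K = Some" if d: d
  proof
    fix x
    obtain z where z: "K x = Some z" using d domK by (metis UNIV_I domD)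
    \<comment> \<open>Applying \<open>J\<close> to \<open>J (G x) = G z\<close> exchanges the roles
      of \<open>x\<close> and \<open>z\<close>.\<close>
    hence "K z = Some x" unfolding K_iff by (metis JJ)
    with z show "(K \<circ>\<^sub>m K) x = Some x" by simp
  qed
  ultimately have e6: "dom K = UNIV \<and> bounded_op K \<and> K \<circ>\<^sub>m K = Some \<longleftrightarrow> d" using domK by blast

  show ?thesis unfolding all_equivalent_def e1 e2 e3 e4 e5 e6 e7 by simp
qed

end
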